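(* Let $X=X(\mathcal{G})$ be a coded shift with generating set $\mathcal{G}$ such that $\mathcal{G}$ uniquely represents $X_{\rm con}(\mathcal{G})$. Let $(g_i)_{i\in\mathbb{N}}$ be an oracle of $\mathcal{G}$. Let $\mu$ be a $\mathcal{G}$-Bernoulli measure given by positive real numbers $(p_g)_{g\in\mathcal{G}}$ with normalizing constant $c=\sum_{g\in\mathcal{G}}|g|p_g<\infty$, and write $p_i=p_{g_i}$. Suppose that $c$ is $\mathcal{G}$-computable and that $(p_i)_{i\in\mathbb{N}}$ is uniformly computable. Then $\mu$ is computable based on having oracle access to $\mathcal{G}$.
   Context: Shift spaces. $\mathcal{A}=\{0,\dots,d-1\}$ is a finite alphabet, $\mathcal{A}^*=\bigcup_{n\ge1}\mathcal{A}^n$, $|w|$ is the length of a word $w$. $\mathcal{A}^{\mathbb{Z}}$ carries the metric $d(x,y)=2^{-\min\{|k|:x_k\ne y_k\}}$ (and $d(x,x)=0$) and the left shift $\sigma$. A shift space is a closed shift-invariant $X\subset\mathcal{A}^{\mathbb{Z}}$. Coded shifts. A generating set is a countably infinite set $\mathcal{G}\subset\mathcal{A}^*$. $X_{\rm con}=X_{\rm con}(\mathcal{G})$ is the set of all bi-infinite concatenations $\cdots g_{i_{-1}}g_{i_0}g_{i_1}\cdots$ of elements of $\mathcal{G}$ (in all shifted positions), and $X(\mathcal{G})$ is the closure of $X_{\rm con}$. $\mathcal{G}$ uniquely represents $X_{\rm con}$ if every $x\in X_{\rm con}$ has exactly one decomposition as a bi-infinite concatenation of elements of $\mathcal{G}$.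 $\mathcal{G}$-Bernoulli measures. For $h_0,\dots,h_k\in\mathcal{G}$ the $\mathcal{G}$-cylinder $\llbracket h_0\cdots h_k\rrbracket$ is the set of $x=\cdots g'_{-1}.g'_0g'_1\cdots\in X_{\rm con}$ (with $g'_j\in\mathcal{G}$ and $g'_0$ starting at coordinate $0$) such that $g'_j=h_j$ for $0\le j\le k$. A shift-invariant Borel probability measure $\mu$ on $X$ is $\mathcal{G}$-Bernoulli, given by positive numbers $p_g$ with $\sum_{g\in\mathcal{G}}p_g=1$ and $c=\sum_{g\in\mathcal{G}}|g|p_g<\infty$, if $\mu(\llbracket h_0\cdots h_k\rrbracket)=\frac1c\,p_{h_0}\cdots p_{h_k}$ for all $h_0,\dots,h_k\in\mathcal{G}$. Oracles and computability. $\mathbb{N}=\{1,2,\dots\}$. An oracle of $\mathcal{G}$ is an enumeration $(g_i)_{i\in\mathbb{N}}$ of $\mathcal{G}$ (each generator listed once) with $|g_{i+1}|\ge|g_i|$. Turing machines below may query this oracle. $(p_i)_i$ is uniformly computable if there is a Turing machine which on input $(n,i)$ outputs a rational $T(n,i)$ with $|T(n,i)-p_i|<2^{-n}$. $c$ is $\mathcal{G}$-computable if there is a Turing machine which on input $n$ outputs $\ell\in\mathbb{N}$ with $|c-\sum_{i=1}^{\ell}|g_i|p_i|<2^{-n}$. Computable measures. Fix a dense sequence $S_X=(s_i)_{i}$ in $X$ (ideal points) such that a Turing machine with access to the available oracles outputs, on input $(i,m)$, the $m$-th coordinate of $s_i$ (for example, the shifts of periodic points $w^\infty$ with $w$ a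 finite concatenation of generators; the notion below does not depend on the choice). Ideal measures are the finite sums $\sum_i q_i\delta_{s_i}$ with positive rational weights $q_i$ summing to $1$; fix an effective enumeration $(\mu_i)_{i\in\mathbb{N}}$ of them. $W_1(\mu,\nu)=\sup_f|\int f\,d\mu-\int f\,d\nu|$ over all $f:X\to\mathbb{R}$ with Lipschitz constant $1$. $\mu$ is computable (based on given oracles) if there is a Turing machine $\chi$ with access to these oracles which on input $n$ outputs $\chi(n)\in\mathbb{N}$ with $W_1(\mu,\mu_{\chi(n)})<2^{-n}$. *)

theory Defs
  imports "HOL-Probability.Probability"
begin

section \<open>Oracle Turing machines\<close>

text \<open>
  Deterministic multitape machines with one oracle.  Tapes are infinite in both directions and
  stored relative to the head: the scanned cell is cell 0, so moving the head shifts the function.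
  Symbol 0 is the blank, 1 a stroke and 2 a separator; state 0 is the start state.
\<close>

type_synonym tape = "int \<Rightarrow> nat"

datatype move = Move_Left | Move_Right | No_Move

record otm =
  tm_tapes :: nat
  tm_symbols :: nat
  tm_states :: nat
  tm_delta :: "nat \<Rightarrow> nat list \<Rightarrow> nat \<times> (nat \<times> move) list"

abbreviation halt_state :: nat where "halt_state \<equiv> 1"
abbreviation query_state :: nat where "query_state \<equiv> 2"
abbreviation answer_state :: nat where "answer_state \<equiv> 3"

text \<open>
  The last clause makes the set of states and the tape alphabet closed under the transition
  function, so only its finitely many values on them are ever used.
\<close>

definition wf_otm :: "otm \<Rightarrow> bool" where
  "wf_otm M \<longleftrightarrow> 2 \<le> tm_tapes M \<and> 3 \<le> tm_symbols M \<and> 4 \<le> tm_states M \<and>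
    (\<forall>q < tm_states M. \<forall>as. length as = tm_tapes M \<and> set as \<subseteq> {..<tm_symbols M} \<longrightarrow>
       (case tm_delta M q as of (q', acts) \<Rightarrow>
          q' < tm_states M \<and> length acts = tm_tapes M \<and> fst ` set acts \<subseteq> {..<tm_symbols M}))"

text \<open>Numbers are written in unary, each followed by a separator.\<close>

definition encode :: "nat list \<Rightarrow> nat list" where
  "encode ns = concat (map (\<lambda>n. replicate n 1 @ [2]) ns)"

definition tape_of :: "nat list \<Rightarrow> tape" where
  "tape_of w = (\<lambda>z. if 0 \<le> z \<and> nat z < length w then w ! nat z else 0)"

definition apply_action :: "nat \<times> move \<Rightarrow> tape \<Rightarrow> tape" where
  "apply_action act t =
     (let t' = t(0 := fst act) in
      case snd act of
        Move_Left \<Rightarrow> (\<lambda>z. t' (z - 1))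
      | Move_Right \<Rightarrow> (\<lambda>z. t' (z + 1))
      | No_Move \<Rightarrow> t')"

text \<open>The query is the number of consecutive strokes starting at the head.\<close>

definition query_number :: "tape \<Rightarrow> nat" where
  "query_number t = (LEAST k. t (int k) \<noteq> 1)"

text \<open>
  In the query state the machine replaces tape 1 by the encoded answer of the oracle and
  continues in the answer state.
\<close>

fun otm_step :: "otm \<Rightarrow> (nat \<Rightarrow> nat list) \<Rightarrow> nat \<times> tape list \<Rightarrow> nat \<times> tape list" where
  "otm_step M orc (q, ts) =
     (if q = halt_state then (q, ts)
      else if q = query_state then
        (answer_state, ts[1 := tape_of (encode (orc (query_number (ts ! 1))))])
      else
        (case tm_delta M q (map (\<lambda>t. t 0) ts) of
           (q', acts) \<Rightarrow> (q', map2 apply_action acts ts)))"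

definition otm_init :: "otm \<Rightarrow> nat list \<Rightarrow> nat \<times> tape list" where
  "otm_init M inp = (0, tape_of (encode inp) # replicate (tm_tapes M - 1) (\<lambda>_. 0))"

text \<open>
  The output is the word on tape 0 that starts at the head and extends to the next blank.
\<close>

definition otm_outputs :: "otm \<Rightarrow> (nat \<Rightarrow> nat list) \<Rightarrow> nat list \<Rightarrow> nat list \<Rightarrow> bool" where
  "otm_outputs M orc inp out \<longleftrightarrow>
     (\<exists>n ts. (otm_step M orc ^^ n) (otm_init M inp) = (halt_state, ts) \<and>
        (\<forall>k < length (encode out). (ts ! 0) (int k) = encode out ! k) \<and>
        (ts ! 0) (int (length (encode out))) = 0)"


section \<open>Shift spaces\<close>

definition shift_dist :: "(int \<Rightarrow> nat) \<Rightarrow> (int \<Rightarrow> nat) \<Rightarrow> real" where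
  "shift_dist x y = (if x = y then 0 else (1/2) ^ (LEAST n. \<exists>k. x k \<noteq> y k \<and> n = nat \<bar>k\<bar>))"

definition shift :: "(int \<Rightarrow> nat) \<Rightarrow> (int \<Rightarrow> nat)" where
  "shift x = (\<lambda>k. x (k + 1))"

lemma shift_dist_less_iff:
  "shift_dist x y < (1/2) ^ N \<longleftrightarrow> (\<forall>k. \<bar>k\<bar> \<le> int N \<longrightarrow> x k = y k)"
proof (cases "x = y")
  case False
  let ?P = "\<lambda>n. \<exists>k. x k \<noteq> y k \<and> n = nat \<bar>k\<bar>"
  have ex: "\<exists>n. ?P n"
    using False by blast
  then obtain k where k: "x k \<noteq> y k" "(LEAST n. ?P n) = nat \<bar>k\<bar>"
    using LeastI_ex[OF ex] by blast
  have least: "(LEAST n. ?P n) \<le> nat \<bar>j\<bar>" if "x j \<noteq> y j" for j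
    using that by (intro Least_le) blast
  have "shift_dist x y < (1/2) ^ N \<longleftrightarrow> N < (LEAST n. ?P n)"
    using False by (simp add: shift_dist_def)
  also have "\<dots> \<longleftrightarrow> (\<forall>k. \<bar>k\<bar> \<le> int N \<longrightarrow> x k = y k)"
    using k least by (smt (verit) nat_less_iff zless_nat_eq_int_zless not_less)
  finally show ?thesis .
qed (simp add: shift_dist_def)

text \<open>
  The library topology on sequences is the product of discrete topologies.  It is the one of the
  metric above, so \<^const>\<open>closure\<close> and \<^const>\<open>borel\<close> can be used below.
\<close>

lemma open_iff_shift_dist:
  fixes U :: "(int \<Rightarrow> nat) set"
  shows "open U \<longleftrightarrow> (\<forall>x\<in>U. \<exists>e>0. \<forall>y. shift_dist x y < e \<longrightarrow> y \<in> U)"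
proof
  assume "open U"
  show "\<forall>x\<in>U. \<exists>e>0. \<forall>y. shift_dist x y < e \<longrightarrow> y \<in> U"
  proof
    fix x assume "x \<in> U"
    with \<open>open U\<close> obtain V where V: "finite {i. V i \<noteq> (UNIV :: nat set)}"
      "x \<in> Pi\<^sub>E UNIV V" "Pi\<^sub>E UNIV V \<subseteq> U"
      unfolding open_fun_def openin_product_topology_alt by auto
    define N where "N = Max (insert 0 ((\<lambda>i. nat \<bar>i\<bar>) ` {i. V i \<noteq> UNIV}))"
    have N: "\<bar>i\<bar> \<le> int N" if "V i \<noteq> UNIV" for i
    proof -
      have "nat \<bar>i\<bar> \<le> N"
        unfolding N_def using that V(1) by (intro Max_ge) auto
      then show ?thesis by linarith
    qed
    have "y \<in> U" if "shift_dist x y < (1/2) ^ N" for y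
    proof -
      have "y i \<in> V i" for i
      proof (cases "V i = UNIV")
        case False
        then have "y i = x i"
          using N that unfolding shift_dist_less_iff by metis
        then show ?thesis using V(2) by auto
      qed auto
      then show ?thesis using V(3) by auto
    qed
    then show "\<exists>e>0. \<forall>y. shift_dist x y < e \<longrightarrow> y \<in> U"
      by (intro exI[of _ "(1/2) ^ N"]) auto
  qed
next
  assume *: "\<forall>x\<in>U. \<exists>e>0. \<forall>y. shift_dist x y < e \<longrightarrow> y \<in> U"
  show "open U"
    unfolding open_fun_def openin_product_topology_alt
  proof (intro conjI ballI)
    fix x assume "x \<in> U"
    then obtain e where e: "e > 0" "\<And>y. shift_dist x y < e \<Longrightarrow> y \<in> U"
      using * by blast
    obtain N where N: "(1/2) ^ N < e"
      using real_arch_pow_inv[OF \<open>e > 0\<close>, of "1/2"] by auto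
    define V where "V = (\<lambda>k. if \<bar>k\<bar> \<le> int N then {x k} else UNIV)"
    have "{k. V k \<noteq> UNIV} \<subseteq> {- int N..int N}"
      by (auto simp: V_def abs_le_iff split: if_splits)
    then have "finite {k. V k \<noteq> UNIV}"
      by (rule finite_subset) simp
    moreover have "Pi\<^sub>E UNIV V \<subseteq> U"
    proof
      fix y assume "y \<in> Pi\<^sub>E UNIV V"
      then have "y k \<in> V k" for k by auto
      then have "\<forall>k. \<bar>k\<bar> \<le> int N \<longrightarrow> x k = y k"
        unfolding V_def by (metis singletonD)
      then show "y \<in> U"
        using N e(2) shift_dist_less_iff[of x y N] by simp
    qed
    moreover have "x \<in> Pi\<^sub>E UNIV V"
      by (auto simp: V_def)
    ultimately show "\<exists>U'. finite {i \<in> UNIV. U' i \<noteq> topspace euclidean} \<and>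
        (\<forall>i\<in>UNIV. openin euclidean (U' i)) \<and> x \<in> Pi\<^sub>E UNIV U' \<and> Pi\<^sub>E UNIV U' \<subseteq> U"
      by (intro exI[of _ V]) (auto intro: Topological_Spaces.open_discrete)
  qed
qed


section \<open>Coded shifts and Bernoulli measures\<close>

definition generating_set :: "nat \<Rightarrow> nat list set \<Rightarrow> bool" where
  "generating_set d G \<longleftrightarrow> infinite G \<and> countable G \<and> (\<forall>w\<in>G. w \<noteq> [] \<and> set w \<subseteq> {..<d})"

text \<open>
  The \<open>j\<close>-th generator \<open>\<gamma> j\<close> occupies the coordinates from \<open>\<tau> j\<close> to \<open>\<tau> (j + 1) - 1\<close>.  The first
  clause fixes the numbering of the blocks: block 0 is the one that covers coordinate 0.  So
  decompositions that differ only in the numbering are not counted twice, whereas different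
  cutting points give different decompositions.
\<close>

definition decomposition ::
  "nat list set \<Rightarrow> (int \<Rightarrow> nat) \<Rightarrow> (int \<Rightarrow> int) \<times> (int \<Rightarrow> nat list) \<Rightarrow> bool" where
  "decomposition G x = (\<lambda>(\<tau>, \<gamma>). \<tau> 0 \<le> 0 \<and> 0 < \<tau> 1 \<and>
     (\<forall>j. \<gamma> j \<in> G \<and> \<tau> (j + 1) = \<tau> j + int (length (\<gamma> j)) \<and>
          (\<forall>m < length (\<gamma> j). x (\<tau> j + int m) = \<gamma> j ! m)))"

definition X_con :: "nat list set \<Rightarrow> (int \<Rightarrow> nat) set" where
  "X_con G = {x. \<exists>D. decomposition G x D}"

definition coded_shift :: "nat list set \<Rightarrow> (int \<Rightarrow> nat) set" where
  "coded_shift G = closure (X_con G)"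

definition uniquely_represents :: "nat list set \<Rightarrow> bool" where
  "uniquely_represents G \<longleftrightarrow> (\<forall>x \<in> X_con G. \<exists>!D. decomposition G x D)"

definition G_cylinder :: "nat list set \<Rightarrow> nat list list \<Rightarrow> (int \<Rightarrow> nat) set" where
  "G_cylinder G hs = {x. \<exists>\<tau> \<gamma>. decomposition G x (\<tau>, \<gamma>) \<and> \<tau> 0 = 0 \<and>
     (\<forall>j < length hs. \<gamma> (int j) = hs ! j)}"

definition invariant_measure :: "(int \<Rightarrow> nat) set \<Rightarrow> (int \<Rightarrow> nat) measure \<Rightarrow> bool" where
  "invariant_measure X \<mu> \<longleftrightarrow> prob_space \<mu> \<and> space \<mu> = X \<and>
     sets \<mu> = sets (restrict_space borel X) \<and> distr \<mu> \<mu> shift = \<mu>"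

definition bernoulli_measure ::
  "nat list set \<Rightarrow> (nat list \<Rightarrow> real) \<Rightarrow> real \<Rightarrow> (int \<Rightarrow> nat) measure \<Rightarrow> bool" where
  "bernoulli_measure G p c \<mu> \<longleftrightarrow> invariant_measure (coded_shift G) \<mu> \<and>
     (\<forall>g\<in>G. p g > 0) \<and> (p has_sum 1) G \<and> ((\<lambda>g. real (length g) * p g) has_sum c) G \<and>
     (\<forall>hs. hs \<noteq> [] \<and> set hs \<subseteq> G \<longrightarrow>
        measure \<mu> (G_cylinder G hs) = 1 / c * (\<Prod>h\<leftarrow>hs. p h))"


section \<open>Computability\<close>

definition oracle_of :: "nat list set \<Rightarrow> (nat \<Rightarrow> nat list) \<Rightarrow> bool" where
  "oracle_of G g \<longleftrightarrow> bij_betw g {1..} G \<and> (\<forall>i\<ge>1. length (g i) \<le> length (g (Suc i)))"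

text \<open>Indices start at 1; this hides the meaningless value at 0 from the machines.\<close>

definition oracle_access :: "(nat \<Rightarrow> nat list) \<Rightarrow> nat \<Rightarrow> nat list" where
  "oracle_access g i = (if i = 0 then [] else g i)"

text \<open>Rational outputs \<open>(a - b) / q\<close> are given by natural numbers \<open>a\<close>, \<open>b\<close> and \<open>q > 0\<close>.\<close>

definition uniformly_computable :: "(nat \<Rightarrow> nat list) \<Rightarrow> (nat \<Rightarrow> real) \<Rightarrow> bool" where
  "uniformly_computable orc r \<longleftrightarrow>
     (\<exists>M. wf_otm M \<and> (\<forall>n\<ge>1. \<forall>i\<ge>1. \<exists>a b q. q > 0 \<and> otm_outputs M orc [n, i] [a, b, q] \<and>
        \<bar>(real a - real b) / real q - r i\<bar> < (1/2) ^ n))"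

definition G_computable :: "(nat \<Rightarrow> nat list) \<Rightarrow> (nat list \<Rightarrow> real) \<Rightarrow> real \<Rightarrow> bool" where
  "G_computable g p c \<longleftrightarrow>
     (\<exists>M. wf_otm M \<and> (\<forall>n\<ge>1. \<exists>l\<ge>1. otm_outputs M (oracle_access g) [n] [l] \<and>
        \<bar>c - (\<Sum>i=1..l. real (length (g i)) * p (g i))\<bar> < (1/2) ^ n))"

text \<open>A coordinate \<open>m\<close> is passed to the machine as its positive and its negative part.\<close>

definition ideal_points ::
  "(nat \<Rightarrow> nat list) \<Rightarrow> (int \<Rightarrow> nat) set \<Rightarrow> (nat \<Rightarrow> int \<Rightarrow> nat) \<Rightarrow> bool" where
  "ideal_points orc X s \<longleftrightarrow> s ` {1..} \<subseteq> X \<and> X \<subseteq> closure (s ` {1..}) \<and>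
     (\<exists>M. wf_otm M \<and> (\<forall>i\<ge>1. \<forall>m. otm_outputs M orc [i, nat m, nat (- m)] [s i m]))"

text \<open>
  A triple \<open>(i, a, b)\<close> stands for the weight \<open>a / b\<close> at the ideal point \<open>s i\<close>.
\<close>

definition ideal_code :: "(nat \<times> nat \<times> nat) list \<Rightarrow> bool" where
  "ideal_code L \<longleftrightarrow> (\<forall>(i, a, b) \<in> set L. i \<ge> 1 \<and> a > 0 \<and> b > 0) \<and>
     (\<Sum>(i, a, b)\<leftarrow>L. real a / real b) = 1"

definition ideal_measure ::
  "(int \<Rightarrow> nat) set \<Rightarrow> (nat \<Rightarrow> int \<Rightarrow> nat) \<Rightarrow> (nat \<times> nat \<times> nat) list \<Rightarrow> (int \<Rightarrow> nat) measure" where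
  "ideal_measure X s L = measure_of X (sets (restrict_space borel X))
     (\<lambda>A. \<Sum>(i, a, b)\<leftarrow>L. ennreal (real a / real b) * indicator A (s i))"

definition effective_enumeration ::
  "(nat \<Rightarrow> nat list) \<Rightarrow> (int \<Rightarrow> nat) set \<Rightarrow> (nat \<Rightarrow> int \<Rightarrow> nat) \<Rightarrow>
   (nat \<Rightarrow> (int \<Rightarrow> nat) measure) \<Rightarrow> bool" where
  "effective_enumeration orc X s \<nu> \<longleftrightarrow>
     \<nu> ` {1..} = {ideal_measure X s L | L. ideal_code L} \<and>
     (\<exists>M. wf_otm M \<and> (\<forall>i\<ge>1. \<exists>L. ideal_code L \<and> \<nu> i = ideal_measure X s L \<and>
        otm_outputs M orc [i] (concat (map (\<lambda>(j, a, b). [j, a, b]) L))))"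

text \<open>
  For probability measures the supremum is over a bounded set because the diameter of \<open>X\<close> is at
  most 1.
\<close>

definition W1 ::
  "(int \<Rightarrow> nat) set \<Rightarrow> (int \<Rightarrow> nat) measure \<Rightarrow> (int \<Rightarrow> nat) measure \<Rightarrow> real" where
  "W1 X \<mu> \<nu> =
     (SUP f \<in> {f :: (int \<Rightarrow> nat) \<Rightarrow> real. \<forall>x\<in>X. \<forall>y\<in>X. \<bar>f x - f y\<bar> \<le> shift_dist x y}.
        \<bar>(\<integral>x. f x \<partial>\<mu>) - (\<integral>x. f x \<partial>\<nu>)\<bar>)"

definition computable_measure ::
  "(nat \<Rightarrow> nat list) \<Rightarrow> (int \<Rightarrow> nat) set \<Rightarrow> (nat \<Rightarrow> (int \<Rightarrow> nat) measure) \<Rightarrow>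
   (int \<Rightarrow> nat) measure \<Rightarrow> bool" where
  "computable_measure orc X \<nu> \<mu> \<longleftrightarrow>
     (\<exists>M. wf_otm M \<and> (\<forall>n\<ge>1. \<exists>k\<ge>1. otm_outputs M orc [n] [k] \<and> W1 X \<mu> (\<nu> k) < (1/2) ^ n))"

end

theory Submission
  imports Defs
begin

text \<open>
  For a word \<open>w\<close> of length \<open>2 N + 1\<close> the points of
  \<open>X\<^sub>c\<^sub>o\<^sub>n\<close> that read \<open>w\<close> around coordinate 0 are partitioned by the \<open>2 N + 1\<close> generators around
  coordinate 0 and the offset of coordinate 0 in the middle one; by uniqueness of the decomposition and
  by invariance such a piece has measure \<open>p(h\<^sub>0) \<cdots> p(h\<^sub>2\<^sub>N) / c\<close>.  As \<open>X\<^sub>c\<^sub>o\<^sub>n\<close> has full measure, finite sums of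
  these products approximate \<open>\<mu>[w]\<close> from below, so \<open>a / D < \<mu>[w]\<close> is recursively enumerable.  If two
  measures both give mass at least \<open>a\<^sub>w / D\<close> to \<open>[w]\<close> and the \<open>a\<^sub>w / D\<close> sum up to almost 1, they are close in
  \<open>W\<^sub>1\<close>.  This is an enumerable certificate for \<open>W\<^sub>1(\<mu>, \<nu>\<^sub>k) < 2\<^sup>-\<^sup>n\<close>, one exists for some \<open>k\<close> by density of
  the ideal points, and the machine searches for it.

  The machine is obtained from functions that are primitive recursive in the oracle: the given machines
  are simulated step by step by such functions, and these are compiled to an oracle machine that
  performs a single unbounded search.
\<close>

section \<open>Structured programs for oracle machines\<close>

text \<open>Lower bounds suffice because both measures have total mass 1: if disjoint words carry
  common mass 1 - e, at most e is left over in either measure, so no upper bound for any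
  \<open>\<mu>[w]\<close> has to be enumerated. That the pieces leave nothing out of \<mu> is the
  identity (sum of |g| p_g) / c = 1.

  A product of values of p divided by c is bounded below by bounding p below and c above. The second
  is the obstacle: c is an infinite sum, and approximations of finitely many p_g do not bound its
  tail. G-computability supplies, for each r, an index l beyond which the tail is less than 2^-r;
  upper bounds for p_1, ..., p_l then bound c from above.

  Certificates carry numerators over a common denominator, so that each comparison is one inequality
  of natural numbers.\<close>

datatype cmd =
    Done
  | Act nat "nat option" move
  | Ask
  | Seq cmd cmd  (infixl ";;" 60)
  | Cond nat "nat set" cmd cmd
  | Loop nat "nat set" cmd

datatype effect = Nop | Edit nat nat move | Consult

abbreviation answer_tape :: "(nat \<Rightarrow> nat list) \<Rightarrow> tape \<Rightarrow> tape" where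
  "answer_tape orc t \<equiv> tape_of (encode (orc (query_number t)))"

definition act_on :: "nat option \<Rightarrow> move \<Rightarrow> tape \<Rightarrow> tape" where
  "act_on a m t = apply_action (case a of None \<Rightarrow> t 0 | Some b \<Rightarrow> b, m) t"

text \<open>The command that remains after a step later becomes the state of the machine, so a step
  may depend only on scanned symbols and has at most one elementary effect.\<close>

fun nxt :: "cmd \<Rightarrow> (nat \<Rightarrow> nat) \<Rightarrow> cmd \<times> effect" where
  "nxt Done as = (Done, Nop)"
| "nxt (Act i a m) as = (Done, Edit i (case a of None \<Rightarrow> as i | Some b \<Rightarrow> b) m)"
| "nxt Ask as = (Done, Consult)"
| "nxt (c ;; d) as = (if c = Done then (d, Nop) else (fst (nxt c as) ;; d, snd (nxt c as)))"
| "nxt (Cond i A c d) as = (if as i \<in> A then (c, Nop) else (d, Nop))"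
| "nxt (Loop i A c) as = (if as i \<in> A then (c ;; Loop i A c, Nop) else (Done, Nop))"

definition enact :: "(nat \<Rightarrow> nat list) \<Rightarrow> effect \<Rightarrow> (nat \<Rightarrow> tape) \<Rightarrow> (nat \<Rightarrow> tape)" where
  "enact orc e ts = (case e of Nop \<Rightarrow> ts | Edit i a m \<Rightarrow> ts(i := apply_action (a, m) (ts i))
     | Consult \<Rightarrow> ts(1 := answer_tape orc (ts 1)))"

definition sstep :: "(nat \<Rightarrow> nat list) \<Rightarrow> cmd \<times> (nat \<Rightarrow> tape) \<Rightarrow> cmd \<times> (nat \<Rightarrow> tape)" where
  "sstep orc = (\<lambda>(c, ts). (fst (nxt c (\<lambda>i. ts i 0)), enact orc (snd (nxt c (\<lambda>i. ts i 0))) ts))"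

lemma sstep_Done: "(sstep orc ^^ n) (Done, ts) = (Done, ts)"
  by (induction n) (auto simp: sstep_def enact_def)

text \<open>\<open>Done\<close> is absorbing, so n may exceed the time at which c finishes; the
  number m of steps is therefore only asserted to exist.\<close>

lemma sstep_Seq:
  assumes "(sstep orc ^^ n) (c, ts) = (Done, ts')"
  shows "\<exists>m. (sstep orc ^^ m) (c ;; d, ts) = (d, ts')"
  using assms
proof (induction n arbitrary: c ts)
  case 0
  then show ?case by (intro exI[of _ 1]) (auto simp: sstep_def enact_def)
next
  case (Suc n)
  show ?case
  proof (cases "c = Done")
    case True
    with Suc.prems sstep_Done[of "Suc n" orc ts] have "ts = ts'" by (metis prod.inject)
    with True show ?thesis by (intro exI[of _ 1]) (auto simp: sstep_def enact_def)
  next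
    case False
    obtain c1 ts1 where 1: "sstep orc (c, ts) = (c1, ts1)" by fastforce
    from Suc.prems have "(sstep orc ^^ n) (c1, ts1) = (Done, ts')"
      by (simp add: funpow_Suc_right 1 del: funpow.simps)
    from Suc.IH[OF this] obtain m where "(sstep orc ^^ m) (c1 ;; d, ts1) = (d, ts')" by blast
    moreover have "sstep orc (c ;; d, ts) = (c1 ;; d, ts1)" using 1 False by (auto simp: sstep_def)
    ultimately show ?thesis
      by (intro exI[of _ "Suc m"]) (simp add: funpow_Suc_right del: funpow.simps)
  qed
qed

text \<open>Big-step semantics with termination built in; the rules that follow remove step counts
  from the verification of programs.\<close>

definition exec :: "(nat \<Rightarrow> nat list) \<Rightarrow> cmd \<Rightarrow> (nat \<Rightarrow> tape) \<Rightarrow> (nat \<Rightarrow> tape) \<Rightarrow> bool" where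
  "exec orc c ts ts' \<longleftrightarrow> (\<exists>n. (sstep orc ^^ n) (c, ts) = (Done, ts'))"

lemma exec_step: "sstep orc (c, ts) = (d, us) \<Longrightarrow> exec orc d us ts' \<Longrightarrow> exec orc c ts ts'"
  unfolding exec_def
  by (metis (no_types, lifting) comp_apply funpow_Suc_right)

lemma exec_Done: "exec orc Done ts ts"
  unfolding exec_def by (intro exI[of _ 0]) simp

lemma exec_Act: "exec orc (Act i a m) ts (ts(i := act_on a m (ts i)))"
  by (rule exec_step[OF _ exec_Done]) (simp add: sstep_def enact_def act_on_def fun_upd_def)

lemma exec_Ask: "exec orc Ask ts (ts(1 := answer_tape orc (ts 1)))"
  by (rule exec_step[OF _ exec_Done]) (simp add: sstep_def enact_def fun_upd_def)

lemma exec_Seq: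
  assumes "exec orc c ts us" and "exec orc d us ts'"
  shows "exec orc (c ;; d) ts ts'"
proof -
  obtain m where "(sstep orc ^^ m) (c ;; d, ts) = (d, us)"
    using assms(1) sstep_Seq unfolding exec_def by blast
  moreover obtain n where "(sstep orc ^^ n) (d, us) = (Done, ts')"
    using assms(2) unfolding exec_def by blast
  ultimately show ?thesis
    unfolding exec_def by (intro exI[of _ "n + m"]) (simp add: funpow_add)
qed

lemma exec_Cond_True: "ts i 0 \<in> A \<Longrightarrow> exec orc c ts ts' \<Longrightarrow> exec orc (Cond i A c d) ts ts'"
  by (rule exec_step) (simp_all add: sstep_def enact_def)

lemma exec_Cond_False: "ts i 0 \<notin> A \<Longrightarrow> exec orc d ts ts' \<Longrightarrow> exec orc (Cond i A c d) ts ts'"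
  by (rule exec_step) (simp_all add: sstep_def enact_def)

lemma exec_Loop_stop: "ts i 0 \<notin> A \<Longrightarrow> exec orc (Loop i A c) ts ts"
  by (rule exec_step[OF _ exec_Done]) (simp add: sstep_def enact_def)

lemma exec_Loop_step:
  "ts i 0 \<in> A \<Longrightarrow> exec orc c ts ts' \<Longrightarrow> exec orc (Loop i A c) ts' ts'' \<Longrightarrow> exec orc (Loop i A c) ts ts''"
  by (rule exec_step[OF _ exec_Seq]) (simp_all add: sstep_def enact_def)

subsection \<open>Compilation\<close>

text \<open>A finite superset of the commands reachable from c, to serve as state set. Loops do not
  make it infinite: unfolding \<open>Loop i A c\<close> only produces
  \<open>c' ;; Loop i A c\<close> with c' a residual of c.\<close>

fun residuals :: "cmd \<Rightarrow> cmd set" where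
  "residuals Done = {Done}"
| "residuals (Act i a m) = {Done, Act i a m}"
| "residuals Ask = {Done, Ask}"
| "residuals (c ;; d) = (\<lambda>c'. c' ;; d) ` residuals c \<union> residuals d"
| "residuals (Cond i A c d) = {Cond i A c d} \<union> residuals c \<union> residuals d"
| "residuals (Loop i A c) = {Done, Loop i A c} \<union> (\<lambda>c'. c' ;; Loop i A c) ` residuals c"

lemma finite_residuals: "finite (residuals c)"
  by (induction c) auto

lemma self_in_residuals: "c \<in> residuals c"
  by (induction c) auto

lemma Done_in_residuals: "Done \<in> residuals c"
  by (induction c) auto

lemma nxt_residuals: "c' \<in> residuals c \<Longrightarrow> fst (nxt c' as) \<in> residuals c"
  by (induction c arbitrary: c') (auto simp: self_in_residuals split: if_split_asm)

fun cmd_ok :: "nat \<Rightarrow> cmd \<Rightarrow> bool" where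
  "cmd_ok k Done = True"
| "cmd_ok k (Act i a m) = (i < k \<and> (\<forall>b. a = Some b \<longrightarrow> b < 3))"
| "cmd_ok k Ask = True"
| "cmd_ok k (c ;; d) = (cmd_ok k c \<and> cmd_ok k d)"
| "cmd_ok k (Cond i A c d) = (i < k \<and> cmd_ok k c \<and> cmd_ok k d)"
| "cmd_ok k (Loop i A c) = (i < k \<and> cmd_ok k c)"

lemma cmd_ok_residuals: "cmd_ok k c \<Longrightarrow> residuals c \<subseteq> Collect (cmd_ok k)"
  by (induction c) auto

lemma cmd_ok_mono: "cmd_ok k c \<Longrightarrow> k \<le> k' \<Longrightarrow> cmd_ok k' c"
  by (induction c) auto

text \<open>The case \<open>a = as i\<close> comes from actions that only move: they write back the
  scanned symbol, which on the compiled machine may be any of its more than three symbols.\<close>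

lemma cmd_ok_Edit:
  "cmd_ok k c \<Longrightarrow> snd (nxt c as) = Edit i a m \<Longrightarrow> i < k \<and> (a < 3 \<or> a = as i)"
  by (induction c) (auto split: if_splits option.splits)

text \<open>Program states have infinitely many tapes, a machine finitely many. This allows cutting
  a state down to its first k tapes.\<close>

lemma nxt_cong:
  "cmd_ok k c \<Longrightarrow> (\<And>i. i < k \<Longrightarrow> as i = as' i) \<Longrightarrow> nxt c as = nxt c as'"
  by (induction c) (auto split: option.splits)

text \<open>
  All queries return to the same answer state.  Therefore the machine has an extra tape, whose
  scanned symbol is the number of the state in which it continues after the query.
\<close>

definition keep :: "nat list \<Rightarrow> (nat \<times> move) list" where
  "keep as = map (\<lambda>a. (a, No_Move)) as"

definition cmd_delta ::
  "(cmd \<Rightarrow> nat) \<Rightarrow> (nat \<Rightarrow> cmd) \<Rightarrow> nat \<Rightarrow> nat \<Rightarrow> nat \<Rightarrow> nat list \<Rightarrow> nat \<times> (nat \<times> move) list" where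
  "cmd_delta code dec S k q as =
    (if q = answer_state then (if as ! k < S then as ! k else halt_state, keep as)
     else let c = fst (nxt (dec q) ((!) as)) in
       (case snd (nxt (dec q) ((!) as)) of
          Nop \<Rightarrow> (code c, keep as)
        | Edit i a m \<Rightarrow> (code c, (keep as)[i := (a, m)])
        | Consult \<Rightarrow> (query_state, (keep as)[k := (code c, No_Move)])))"

lemma apply_action_keep: "apply_action (t 0, No_Move) t = t"
  by (auto simp: apply_action_def)

lemma map2_keep: "map2 apply_action (keep (map (\<lambda>t. t 0) ts)) ts = ts"
  by (rule nth_equalityI) (auto simp: keep_def apply_action_keep)

lemma map2_keep_update:
  "i < length ts \<Longrightarrow>
   map2 apply_action ((keep (map (\<lambda>t. t 0) ts))[i := x]) ts = ts[i := apply_action x (ts ! i)]"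
  by (rule nth_equalityI) (auto simp: keep_def apply_action_keep nth_list_update)

lemma set_keep_update: "fst ` set ((keep as)[i := x]) \<subseteq> insert (fst x) (set as)"
  using set_update_subset_insert[of "keep as" i x] by (fastforce simp: keep_def)

text \<open>The machine follows the program step by step, with one machine step for each program
  step and three for a query. The content r of the extra tape is left unspecified.\<close>

lemma machine_of_cmd:
  assumes ok: "cmd_ok k c0" and k: "2 \<le> k" and c0: "c0 \<noteq> Done"
  shows "\<exists>M. wf_otm M \<and> (\<forall>orc inp ts.
    exec orc c0 (\<lambda>i. if i = 0 then tape_of (encode inp) else (\<lambda>_. 0)) ts \<longrightarrow>
    (\<exists>n r. (otm_step M orc ^^ n) (otm_init M inp) = (halt_state, map ts [0..<k] @ [r])))"
proof -
  let ?R = "residuals c0"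
  let ?Q = "?R - {c0, Done}"
  have ok_R: "cmd_ok k c" if "c \<in> ?R" for c
    using cmd_ok_residuals[OF ok] that by blast
  obtain f where f: "bij_betw f ?Q {0..<card ?Q}"
    using ex_bij_betw_finite_nat[of ?Q] finite_residuals by auto
  define S where "S = 4 + card ?Q"
  \<comment> \<open>\<open>c0\<close> must be the start state 0 and \<open>Done\<close> the halting
    state 1; the others begin at 4 to leave the query and answer states free.\<close>
  define code where "code c = (if c = c0 then 0 else if c = Done then halt_state else 4 + f c)" for c
  \<comment> \<open>\<open>wf_otm\<close> constrains every state below S, including numbers that
    code no command; these are read as \<open>Done\<close>.\<close>
  define dec where "dec q = (if q \<in> code ` ?R then inv_into ?R code q else Done)" for q
  have fQ: "f c < card ?Q" if "c \<in> ?Q" for c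
    using bij_betwE[OF f] that by auto
  have code_less: "code c < S" if "c \<in> ?R" for c
    using fQ that by (auto simp: code_def S_def)
  have inj: "inj_on code ?R"
  proof (rule inj_onI)
    fix x y assume "x \<in> ?R" "y \<in> ?R" "code x = code y"
    then show "x = y"
      using inj_onD[OF bij_betw_imp_inj_on[OF f], of x y] by (simp add: code_def split: if_splits)
  qed
  have dec_code: "dec (code c) = c" if "c \<in> ?R" for c
    using inj that by (simp add: dec_def)
  have dec_R: "dec q \<in> ?R" for q
    by (auto simp: dec_def inv_into_into Done_in_residuals)
  \<comment> \<open>The alphabet has S symbols because the extra tape holds state numbers as
    symbols.\<close>
  define M where "M = \<lparr>tm_tapes = k + 1, tm_symbols = S, tm_states = S,
     tm_delta = cmd_delta code dec S k\<rparr>"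
  have wf: "wf_otm M"
    unfolding wf_otm_def
  proof (intro conjI allI impI)
    fix q as
    assume q: "q < tm_states M" and as: "length as = tm_tapes M \<and> set as \<subseteq> {..<tm_symbols M}"
    have lt: "code (fst (nxt (dec q) ((!) as))) < S"
      using code_less dec_R nxt_residuals by blast
    have ed: "a < S" if "snd (nxt (dec q) ((!) as)) = Edit i a m" for i a m
    proof -
      have "i < k \<and> (a < 3 \<or> a = as ! i)"
        using cmd_ok_Edit[OF ok_R[OF dec_R] that] .
      then show ?thesis using as nth_mem[of i as] by (auto simp: M_def S_def subset_iff)
    qed
    have "fst ` set (keep as) \<subseteq> {..<S}" using as by (auto simp: keep_def M_def)
    moreover have "fst ` set ((keep as)[i := x]) \<subseteq> {..<S}" if "fst x < S" for i x
      using set_keep_update[of as i x] as that by (auto simp: M_def)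
    moreover have "4 \<le> S" by (simp add: S_def)
    ultimately show "case tm_delta M q as of (q', acts) \<Rightarrow> q' < tm_states M \<and>
        length acts = tm_tapes M \<and> fst ` set acts \<subseteq> {..<tm_symbols M}"
      using as lt ed by (auto simp: M_def cmd_delta_def Let_def keep_def split: effect.splits)
  qed (use k in \<open>auto simp: M_def S_def\<close>)
  have step: "\<exists>m r'. (otm_step M orc ^^ m) (code c, map ts [0..<k] @ [r]) =
      (code c', map ts' [0..<k] @ [r'])"
    if c: "c \<in> ?R" "c \<noteq> Done" and s: "sstep orc (c, ts) = (c', ts')" for orc c ts c' ts' r
  proof -
    let ?tl = "map ts [0..<k] @ [r]"
    let ?as = "map (\<lambda>t. t 0) ?tl"
    have q: "code c \<noteq> halt_state" "code c \<noteq> query_state" "code c \<noteq> answer_state"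
      using c c0 by (auto simp: code_def)
    have nx: "nxt c (\<lambda>i. ts i 0) = nxt c ((!) ?as)"
      by (rule nxt_cong[OF ok_R[OF c(1)]]) (auto simp: nth_append)
    have c': "c' = fst (nxt c ((!) ?as))" "ts' = enact orc (snd (nxt c ((!) ?as))) ts"
      using s nx by (auto simp: sstep_def)
    have R': "c' \<in> ?R" using c'(1) nxt_residuals[OF c(1)] by auto
    have stp: "otm_step M orc (code c, ?tl) = (case cmd_delta code dec S k (code c) ?as of
        (q', acts) \<Rightarrow> (q', map2 apply_action acts ?tl))"
      using q by (simp add: M_def)
    show ?thesis
    proof (cases "snd (nxt c ((!) ?as))")
      case Nop
      then have "otm_step M orc (code c, ?tl) = (code c', ?tl)" "ts' = ts"
        unfolding stp using q c' map2_keep[of ?tl]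
        by (auto simp: cmd_delta_def dec_code[OF c(1)] enact_def)
      then show ?thesis by (intro exI[of _ 1] exI[of _ r]) simp
    next
      case (Edit i a m)
      have i: "i < k" using cmd_ok_Edit[OF ok_R[OF c(1)] Edit] by simp
      have "otm_step M orc (code c, ?tl) = (code c', ?tl[i := apply_action (a, m) (?tl ! i)])"
        unfolding stp using q c'(1) Edit i map2_keep_update[of i ?tl]
        by (simp add: cmd_delta_def dec_code[OF c(1)])
      moreover have "?tl[i := apply_action (a, m) (?tl ! i)] = map ts' [0..<k] @ [r]"
        using i c'(2) Edit
        by (intro nth_equalityI) (auto simp: nth_list_update nth_append enact_def)
      ultimately show ?thesis by (intro exI[of _ 1] exI[of _ r]) simp
    next
      case Consult
      define r' where "r' = apply_action (code c', No_Move) r"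
      let ?tl' = "map ts [0..<k] @ [r']"
      let ?tl'' = "map ts' [0..<k] @ [r']"
      have "otm_step M orc (code c, ?tl) = (query_state, ?tl[k := apply_action (code c', No_Move) (?tl ! k)])"
        unfolding stp using q c'(1) Consult map2_keep_update[of k ?tl]
        by (simp add: cmd_delta_def dec_code[OF c(1)])
      also have "?tl[k := apply_action (code c', No_Move) (?tl ! k)] = ?tl'"
        by (intro nth_equalityI) (auto simp: nth_list_update nth_append r'_def)
      finally have 1: "otm_step M orc (code c, ?tl) = (query_state, ?tl')" .
      have "?tl'[1 := answer_tape orc (?tl' ! 1)] = ?tl''"
        using k c'(2) Consult
        by (intro nth_equalityI) (auto simp: nth_list_update nth_append enact_def)
      then have 2: "otm_step M orc (query_state, ?tl') = (answer_state, ?tl'')" by simp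
      have "(map (\<lambda>t. t 0) ?tl'') ! k = code c'"
        by (simp add: nth_append r'_def apply_action_def)
      then have 3: "otm_step M orc (answer_state, ?tl'') = (code c', ?tl'')"
        using code_less[OF R'] map2_keep[of ?tl''] by (simp add: M_def cmd_delta_def)
      have "(otm_step M orc ^^ 3) (code c, ?tl) = (code c', ?tl'')"
        unfolding numeral_3_eq_3 by (simp only: funpow.simps o_apply id_apply 1 2 3)
      then show ?thesis by blast
    qed
  qed
  have steps: "\<exists>m r'. (otm_step M orc ^^ m) (code c, map ts [0..<k] @ [r]) =
      (halt_state, map ts' [0..<k] @ [r'])"
    if "c \<in> ?R" "(sstep orc ^^ n) (c, ts) = (Done, ts')" for orc c ts ts' r n
    using that
  proof (induction n arbitrary: c ts r)
    case 0
    then show ?case using c0 by (intro exI[of _ 0] exI[of _ r]) (auto simp: code_def)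
  next
    case (Suc n)
    show ?case
    proof (cases "c = Done")
      case True
      with Suc.prems sstep_Done[of "Suc n" orc ts] have "ts = ts'" by (metis prod.inject)
      with True c0 show ?thesis by (intro exI[of _ 0] exI[of _ r]) (auto simp: code_def)
    next
      case False
      obtain c1 ts1 where 1: "sstep orc (c, ts) = (c1, ts1)" by fastforce
      from Suc.prems have n: "(sstep orc ^^ n) (c1, ts1) = (Done, ts')"
        by (simp add: funpow_Suc_right 1 del: funpow.simps)
      have "c1 = fst (nxt c (\<lambda>i. ts i 0))" using 1 by (auto simp: sstep_def)
      then have R1: "c1 \<in> ?R" using nxt_residuals Suc.prems(1) by blast
      obtain m r1 where m: "(otm_step M orc ^^ m) (code c, map ts [0..<k] @ [r]) =
          (code c1, map ts1 [0..<k] @ [r1])"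
        using step[OF Suc.prems(1) False 1] by blast
      obtain m' r' where "(otm_step M orc ^^ m') (code c1, map ts1 [0..<k] @ [r1]) =
          (halt_state, map ts' [0..<k] @ [r'])"
        using Suc.IH[OF R1 n] by blast
      then show ?thesis
        by (intro exI[of _ "m' + m"] exI[of _ r']) (simp add: funpow_add m)
    qed
  qed
  show ?thesis
  proof (intro exI[of _ M] conjI wf allI impI)
    fix orc inp ts
    let ?ts0 = "\<lambda>i. if i = 0 then tape_of (encode inp) else (\<lambda>_. 0)"
    assume "exec orc c0 ?ts0 ts"
    then obtain n where n: "(sstep orc ^^ n) (c0, ?ts0) = (Done, ts)"
      unfolding exec_def by blast
    have "tape_of (encode inp) # replicate k (\<lambda>_. 0) = map ?ts0 [0..<k] @ [\<lambda>_. 0]"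
    proof (rule nth_equalityI)
      fix i assume "i < length (tape_of (encode inp) # replicate k (\<lambda>_. 0 :: nat))"
      then show "(tape_of (encode inp) # replicate k (\<lambda>_. 0)) ! i = (map ?ts0 [0..<k] @ [\<lambda>_. 0]) ! i"
        using k by (cases i) (auto simp: nth_append)
    qed simp
    then have "otm_init M inp = (code c0, map ?ts0 [0..<k] @ [\<lambda>_. 0])"
      by (simp add: otm_init_def M_def code_def)
    then show "\<exists>n r. (otm_step M orc ^^ n) (otm_init M inp) = (halt_state, map ts [0..<k] @ [r])"
      using steps[OF self_in_residuals n] by metis
  qed
qed

section \<open>Register programs\<close>

text \<open>Tape 0 carries input and output, tape 1 the queries; the other tapes are unary registers.\<close>

definition reg :: "nat \<Rightarrow> tape" where
  "reg v = tape_of (replicate v 1)"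

definition regs :: "tape \<Rightarrow> tape \<Rightarrow> (nat \<Rightarrow> nat) \<Rightarrow> nat \<Rightarrow> tape" where
  "regs t u s = (\<lambda>i. if i = 0 then t else if i = 1 then u else reg (s i))"

lemma tape_of_0 [simp]: "tape_of [] 0 = 0" "tape_of (a # w) 0 = a"
  by (auto simp: tape_of_def)

lemma act_on_push [simp]: "act_on (Some a) No_Move (act_on None Move_Left (tape_of w)) = tape_of (a # w)"
  by (auto simp: act_on_def apply_action_def tape_of_def fun_eq_iff nth_Cons' nat_diff_distrib)

lemma act_on_pop: "act_on (Some 0) Move_Right (tape_of (a # w)) = tape_of w"
  by (auto simp: act_on_def apply_action_def tape_of_def fun_eq_iff nth_Cons' nat_add_distrib)

lemma reg_0_iff: "reg v 0 \<in> {1} \<longleftrightarrow> v \<noteq> 0"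
  by (cases v) (auto simp: reg_def)

lemma exec_eq: "exec orc c ts us \<Longrightarrow> us = us' \<Longrightarrow> exec orc c ts us'"
  by simp

text \<open>Every word is handled at its left end only, so a tape acts as a stack with its top under
  the head. \<open>Pop\<close> blanks the cell that it leaves, so everything left of the head stays
  blank.\<close>

definition Push :: "nat \<Rightarrow> nat \<Rightarrow> cmd" where
  "Push i a = Act i None Move_Left ;; Act i (Some a) No_Move"

definition Pop :: "nat \<Rightarrow> cmd" where
  "Pop i = Act i (Some 0) Move_Right"

lemma exec_Push: "ts i = tape_of w \<Longrightarrow> exec orc (Push i a) ts (ts(i := tape_of (a # w)))"
  unfolding Push_def by (rule exec_eq[OF exec_Seq[OF exec_Act exec_Act]]) simp

lemma exec_Pop: "ts i = tape_of (a # w) \<Longrightarrow> exec orc (Pop i) ts (ts(i := tape_of w))"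
  unfolding Pop_def by (rule exec_eq[OF exec_Act]) (simp add: act_on_pop)

lemma exec_Loop:
  assumes "\<And>j. j < n \<Longrightarrow> \<sigma> j i 0 \<in> A \<and> exec orc c (\<sigma> j) (\<sigma> (Suc j))" and "\<sigma> n i 0 \<notin> A"
  shows "exec orc (Loop i A c) (\<sigma> 0) (\<sigma> n)"
proof -
  have "j \<le> n \<Longrightarrow> exec orc (Loop i A c) (\<sigma> (n - j)) (\<sigma> n)" for j
  proof (induction j)
    case 0
    then show ?case using exec_Loop_stop[of "\<sigma> n" i A] assms(2) by simp
  next
    case (Suc j)
    then have "Suc (n - Suc j) = n - j" by simp
    then show ?case using exec_Loop_step assms(1)[of "n - Suc j"] Suc by fastforce
  qed
  from this[of n] show ?thesis by simp
qed

lemma regs_upd: "2 \<le> i \<Longrightarrow> (regs t u s)(i := reg v) = regs t u (s(i := v))"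
  by (auto simp: regs_def)

lemma exec_Inc: "2 \<le> i \<Longrightarrow> exec orc (Push i 1) (regs t u s) (regs t u (s(i := Suc (s i))))"
  using exec_Push[of "regs t u s" i "replicate (s i) 1" orc 1]
  by (simp add: regs_upd[symmetric]) (simp add: regs_def reg_def)

lemma exec_Dec: "2 \<le> i \<Longrightarrow> s i = Suc v \<Longrightarrow> exec orc (Pop i) (regs t u s) (regs t u (s(i := v)))"
  using exec_Pop[of "regs t u s" i 1 "replicate v 1" orc]
  by (simp add: regs_upd[symmetric]) (simp add: regs_def reg_def)

lemma regs_test: "2 \<le> i \<Longrightarrow> regs t u s i 0 \<in> {1} \<longleftrightarrow> s i \<noteq> 0"
  using reg_0_iff[of "s i"] by (simp add: regs_def)

lemma exec_while:
  assumes "2 \<le> i"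
    and "\<And>j. j < n \<Longrightarrow> s j i \<noteq> 0 \<and> exec orc c (regs t u (s j)) (regs t u (s (Suc j)))"
    and "s n i = 0" and "s 0 = s0" and "s n = s1"
  shows "exec orc (Loop i {1} c) (regs t u s0) (regs t u s1)"
  using exec_Loop[of n "\<lambda>j. regs t u (s j)" i "{1}" orc c] assms regs_test by simp

lemma exec_regs_eq: "exec orc c ts (regs t u s) \<Longrightarrow> (\<And>i. s i = s' i) \<Longrightarrow> exec orc c ts (regs t u s')"
  using exec_eq[of orc c ts "regs t u s" "regs t u s'"] by (simp add: ext[of s s'])

definition Clear :: "nat \<Rightarrow> cmd" where
  "Clear i = Loop i {1} (Pop i)"

definition Move :: "nat \<Rightarrow> nat \<Rightarrow> cmd" where
  "Move i j = Loop i {1} (Pop i ;; Push j 1)"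

text \<open>A unary register can be read only by emptying it; copying means moving it into two
  registers at once.\<close>

definition Fork :: "nat \<Rightarrow> nat \<Rightarrow> nat \<Rightarrow> cmd" where
  "Fork i j k = Loop i {1} (Pop i ;; Push j 1 ;; Push k 1)"

lemma exec_Clear: "2 \<le> i \<Longrightarrow> exec orc (Clear i) (regs t u s) (regs t u (s(i := 0)))"
  unfolding Clear_def
proof (rule exec_while[where n = "s i" and s = "\<lambda>j. s(i := s i - j)"])
  fix j assume "2 \<le> i" and j: "j < s i"
  then show "(s(i := s i - j)) i \<noteq> 0 \<and> exec orc (Pop i) (regs t u (s(i := s i - j)))
      (regs t u (s(i := s i - Suc j)))"
    using exec_Dec[of i "s(i := s i - j)" "s i - Suc j" orc t u] by (simp add: Suc_diff_Suc)
qed auto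

lemma exec_Move:
  assumes "2 \<le> i" "2 \<le> j" "i \<noteq> j"
  shows "exec orc (Move i j) (regs t u s) (regs t u (s(i := 0, j := s j + s i)))"
  unfolding Move_def
proof (rule exec_while[where n = "s i" and s = "\<lambda>m. s(i := s i - m, j := s j + m)"])
  fix m assume m: "m < s i"
  let ?s = "s(i := s i - m, j := s j + m)"
  have "exec orc (Pop i ;; Push j 1) (regs t u ?s) (regs t u (s(i := s i - Suc m, j := s j + Suc m)))"
    by (rule exec_regs_eq[OF exec_Seq[OF exec_Dec exec_Inc]], rule assms)
      (use assms m in \<open>auto simp: Suc_diff_Suc fun_upd_twist\<close>)
  then show "?s i \<noteq> 0 \<and> exec orc (Pop i ;; Push j 1) (regs t u ?s)
      (regs t u (s(i := s i - Suc m, j := s j + Suc m)))"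
    using m assms by simp
qed (use assms in auto)

lemma exec_Fork:
  assumes "2 \<le> i" "2 \<le> j" "2 \<le> k" "i \<noteq> j" "i \<noteq> k" "j \<noteq> k"
  shows "exec orc (Fork i j k) (regs t u s) (regs t u (s(i := 0, j := s j + s i, k := s k + s i)))"
  unfolding Fork_def
proof (rule exec_while[where n = "s i" and s = "\<lambda>m. s(i := s i - m, j := s j + m, k := s k + m)"])
  fix m assume m: "m < s i"
  let ?s = "\<lambda>m. s(i := s i - m, j := s j + m, k := s k + m)"
  have "exec orc (Pop i ;; Push j 1 ;; Push k 1) (regs t u (?s m)) (regs t u (?s (Suc m)))"
    by (rule exec_regs_eq[OF exec_Seq[OF exec_Seq[OF exec_Dec exec_Inc] exec_Inc]], rule assms)
      (use assms m in \<open>auto simp: Suc_diff_Suc fun_upd_twist\<close>)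
  then show "?s m i \<noteq> 0 \<and> exec orc (Pop i ;; Push j 1 ;; Push k 1) (regs t u (?s m)) (regs t u (?s (Suc m)))"
    using m assms by simp
qed (use assms in auto)

subsection \<open>Pairing\<close>

lemma prod_decode_0: "prod_decode 0 = (0, 0)"
  using prod_encode_inverse[of "(0, 0)"] by (simp add: prod_encode_def)

text \<open>Pairs are counted along antidiagonals: a successor moves one place along the current one
  or, at its end, starts the next. \<open>Unpair\<close> decodes n by performing n such
  successors.\<close>

lemma prod_decode_Suc:
  "prod_decode (Suc n) = (let (a, c) = prod_decode n in if c = 0 then (0, Suc a) else (Suc a, c - 1))"
proof -
  obtain a c where ac: "prod_decode n = (a, c)" by fastforce
  then have n: "n = prod_encode (a, c)" by (metis prod_decode_inverse)
  have "Suc n = prod_encode (if c = 0 then (0, Suc a) else (Suc a, c - 1))"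
    unfolding n by (cases c) (auto simp: prod_encode_def)
  then have "prod_decode (Suc n) = (if c = 0 then (0, Suc a) else (Suc a, c - 1))"
    by (simp only: prod_encode_inverse)
  then show ?thesis
    by (simp add: ac)
qed

definition Unpair :: "nat \<Rightarrow> cmd" where
  "Unpair b = Loop b {1} (Pop b ;; Cond (b + 2) {1} (Pop (b + 2) ;; Push (b + 1) 1)
     (Move (b + 1) (b + 2) ;; Push (b + 2) 1))"

lemma exec_Unpair:
  assumes b: "2 \<le> b" and s: "s (b + 1) = 0" "s (b + 2) = 0"
  shows "exec orc (Unpair b) (regs t u s)
    (regs t u (s(b := 0, b + 1 := fst (prod_decode (s b)), b + 2 := snd (prod_decode (s b)))))"
  unfolding Unpair_def
proof (rule exec_while[where n = "s b"
      and s = "\<lambda>m. s(b := s b - m, b + 1 := fst (prod_decode m), b + 2 := snd (prod_decode m))"])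
  fix m assume m: "m < s b"
  obtain a c where ac: "prod_decode m = (a, c)" by fastforce
  let ?c = "Cond (b + 2) {1} (Pop (b + 2) ;; Push (b + 1) 1) (Move (b + 1) (b + 2) ;; Push (b + 2) 1)"
  let ?s = "\<lambda>m. s(b := s b - m, b + 1 := fst (prod_decode m), b + 2 := snd (prod_decode m))"
  define s' where "s' = s(b := s b - Suc m, b + 1 := a, b + 2 := c)"
  have 1: "exec orc (Pop b) (regs t u (?s m)) (regs t u s')"
    by (rule exec_regs_eq[OF exec_Dec[of _ _ "s b - Suc m"]])
      (use b m in \<open>auto simp: ac s'_def Suc_diff_Suc\<close>)
  have 2: "exec orc ?c (regs t u s') (regs t u (?s (Suc m)))"
  proof (cases c)
    case 0
    show ?thesis
      by (rule exec_Cond_False, simp add: regs_test[simplified] s'_def 0,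
          rule exec_regs_eq[OF exec_Seq[OF exec_Move exec_Inc]])
        (use b in \<open>auto simp: ac s'_def 0 prod_decode_Suc\<close>)
  next
    case (Suc d)
    show ?thesis
      by (rule exec_Cond_True, simp add: regs_test[simplified] s'_def Suc,
          rule exec_regs_eq[OF exec_Seq[OF exec_Dec[of _ _ d] exec_Inc]])
        (use b in \<open>auto simp: ac s'_def Suc prod_decode_Suc\<close>)
  qed
  show "?s m b \<noteq> 0 \<and> exec orc (Pop b ;; ?c) (regs t u (?s m)) (regs t u (?s (Suc m)))"
    using m exec_Seq[OF 1 2] by simp
qed (use assms in \<open>auto simp: prod_decode_0\<close>)

text \<open>\<open>prod_encode (x, y)\<close> is \<open>triangle (x + y) + x\<close>. The value x is
  added to register b + 2, the sum x + y is collected in b, and counting b down while adding it to b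
  + 2 contributes the triangular number.\<close>

definition Pair_at :: "nat \<Rightarrow> nat \<Rightarrow> nat \<Rightarrow> cmd" where
  "Pair_at i j b = Fork i (b + 2) b ;; Move j b ;; 
     Loop b {1} (Fork b (b + 1) (b + 2) ;; Move (b + 1) b ;; Pop b)"

lemma triangle_mono: "m \<le> n \<Longrightarrow> triangle m \<le> triangle n"
  by (induction n) (auto simp: le_Suc_eq)

lemma exec_Pair_at:
  assumes i: "2 \<le> i" "i < b" and j: "2 \<le> j" "j < b" "i \<noteq> j"
    and s: "s b = 0" "s (b + 1) = 0"
  shows "exec orc (Pair_at i j b) (regs t u s)
    (regs t u (s(i := 0, j := 0, b + 2 := s (b + 2) + prod_encode (s i, s j))))"
proof -
  define n where "n = s i + s j"
  \<comment> \<open>After m rounds b + 2 has received n + (n - 1) + ... + (n - m + 1), a difference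
    of two triangular numbers.\<close>
  define s1 where "s1 m = s(i := 0, j := 0, b := n - m,
    b + 2 := s (b + 2) + s i + (triangle n - triangle (n - m)))" for m
  have 1: "exec orc (Fork i (b + 2) b ;; Move j b) (regs t u s) (regs t u (s1 0))"
    by (rule exec_regs_eq[OF exec_Seq[OF exec_Fork exec_Move]])
      (use assms in \<open>auto simp: s1_def n_def\<close>)
  have 2: "exec orc (Loop b {1} (Fork b (b + 1) (b + 2) ;; Move (b + 1) b ;; Pop b))
      (regs t u (s1 0)) (regs t u (s1 n))"
  proof (rule exec_while[where n = n and s = s1])
    fix m assume m: "m < n"
    then obtain k where k: "n - m = Suc k" "n - Suc m = k" by (metis Suc_diff_Suc)
    have "triangle (Suc k) \<le> triangle n" by (rule triangle_mono) (use k in linarith)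
    then have "exec orc (Fork b (b + 1) (b + 2) ;; Move (b + 1) b ;; Pop b)
        (regs t u (s1 m)) (regs t u (s1 (Suc m)))"
      by (intro exec_regs_eq[OF exec_Seq[OF exec_Seq[OF exec_Fork exec_Move] exec_Dec[of _ _ k]]])
        (use assms k in \<open>auto simp: s1_def\<close>)
    then show "s1 m b \<noteq> 0 \<and> exec orc (Fork b (b + 1) (b + 2) ;; Move (b + 1) b ;; Pop b)
        (regs t u (s1 m)) (regs t u (s1 (Suc m)))"
      using m assms by (simp add: s1_def)
  qed (use assms in \<open>auto simp: s1_def\<close>)
  show ?thesis
    unfolding Pair_at_def
    by (rule exec_regs_eq[OF exec_Seq[OF 1 2]])
      (use assms in \<open>auto simp: s1_def n_def prod_encode_def\<close>)
qed

subsection \<open>Primitive recursive functions\<close>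

text \<open>Unary functions suffice since arguments are paired; \<open>PR_iter\<close>, with pairs
  as state, gives primitive recursion. The oracle's answer is reversed because its numbers are
  consed to a list in the order in which they are read off the tape.\<close>

inductive PR :: "(nat \<Rightarrow> nat list) \<Rightarrow> (nat \<Rightarrow> nat) \<Rightarrow> bool" for orc where
  PR_zero: "PR orc (\<lambda>_. 0)"
| PR_Suc: "PR orc Suc"
| PR_id: "PR orc (\<lambda>n. n)"
| PR_fst: "PR orc (\<lambda>n. fst (prod_decode n))"
| PR_snd: "PR orc (\<lambda>n. snd (prod_decode n))"
| PR_pair: "PR orc f \<Longrightarrow> PR orc g \<Longrightarrow> PR orc (\<lambda>n. prod_encode (f n, g n))"
| PR_comp: "PR orc f \<Longrightarrow> PR orc g \<Longrightarrow> PR orc (\<lambda>n. f (g n))"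
| PR_iter: "PR orc f \<Longrightarrow> PR orc (\<lambda>n. (f ^^ fst (prod_decode n)) (snd (prod_decode n)))"
| PR_oracle: "PR orc (\<lambda>n. list_encode (rev (orc n)))"

abbreviation "blank \<equiv> tape_of []"

text \<open>Argument and result are in register \<open>b\<close>; the registers above it are scratch space and left blank.\<close>

definition computes :: "(nat \<Rightarrow> nat list) \<Rightarrow> cmd \<Rightarrow> nat \<Rightarrow> (nat \<Rightarrow> nat) \<Rightarrow> bool" where
  "computes orc c b f \<longleftrightarrow> (\<forall>t s. (\<forall>i>b. s i = 0) \<longrightarrow>
     exec orc c (regs t blank s) (regs t blank (s(b := f (s b)))))"

lemma computesD:
  "computes orc c b f \<Longrightarrow> (\<And>i. b < i \<Longrightarrow> s i = 0) \<Longrightarrow>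
   exec orc c (regs t blank s) (regs t blank (s(b := f (s b))))"
  by (auto simp: computes_def)

text \<open>A cons on list codes,
  \<open>list_encode (x # xs) = Suc (prod_encode (x, list_encode xs))\<close>, with x in b + 1 and
  the list in b.\<close>

definition Record :: "nat \<Rightarrow> cmd" where
  "Record b = Pair_at (b + 1) b (b + 2) ;; Move (b + 4) b ;; Push b 1"

definition Read :: "nat \<Rightarrow> cmd" where
  "Read b = Loop 1 {1, 2} (Loop 1 {1} (Pop 1 ;; Push (b + 1) 1) ;; Pop 1 ;; Record b)"

lemma exec_Record:
  assumes "2 \<le> b" "s (b + 2) = 0" "s (b + 3) = 0" "s (b + 4) = 0"
  shows "exec orc (Record b) (regs t u s)
    (regs t u (s(b := Suc (prod_encode (s (b + 1), s b)), b + 1 := 0)))"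
  unfolding Record_def
  by (rule exec_regs_eq[OF exec_Seq[OF exec_Seq[OF exec_Pair_at exec_Move] exec_Inc]])
    (use assms in \<open>auto simp: numeral_eq_Suc\<close>)

lemma regs_upd_1: "(regs t u s)(1 := v) = regs t v s"
  by (auto simp: regs_def)

lemma regs_1: "regs t u s 1 = u"
  by (auto simp: regs_def)

text \<open>The answer is erased while it is read, so tape 1 is blank again, as
  \<open>computes\<close> demands before the next query.\<close>

lemma exec_Read:
  assumes b: "2 \<le> b"
  shows "(\<And>i. b < i \<Longrightarrow> s i = 0) \<Longrightarrow> s b = list_encode acc \<Longrightarrow>
    exec orc (Read b) (regs t (tape_of (encode ws)) s) (regs t blank (s(b := list_encode (rev ws @ acc))))"
proof (induction ws arbitrary: s acc)
  case Nil
  have "exec orc (Read b) (regs t blank s) (regs t blank s)"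
    unfolding Read_def by (rule exec_Loop_stop) (simp add: regs_def)
  then show ?case using Nil by (auto simp: encode_def fun_upd_idem)
next
  case (Cons w ws)
  let ?e = "encode ws"
  let ?\<sigma> = "\<lambda>j. regs t (tape_of (replicate (w - j) 1 @ 2 # ?e)) (s(b + 1 := j))"
  have "exec orc (Loop 1 {1} (Pop 1 ;; Push (b + 1) 1)) (?\<sigma> 0) (?\<sigma> w)"
  proof (rule exec_Loop)
    fix j assume "j < w"
    then obtain k where k: "w - j = Suc k" "w - Suc j = k" by (metis Suc_diff_Suc)
    have "exec orc (Pop 1) (?\<sigma> j) (regs t (tape_of (replicate k 1 @ 2 # ?e)) (s(b + 1 := j)))"
      using exec_Pop[of "?\<sigma> j" 1 1 "replicate k 1 @ 2 # ?e" orc] unfolding regs_1 regs_upd_1 k by simp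
    from exec_Seq[OF this exec_Inc[of "b + 1"]]
    have "exec orc (Pop 1 ;; Push (b + 1) 1) (?\<sigma> j) (?\<sigma> (Suc j))"
      using b k by simp
    then show "?\<sigma> j 1 0 \<in> {1} \<and> exec orc (Pop 1 ;; Push (b + 1) 1) (?\<sigma> j) (?\<sigma> (Suc j))"
      unfolding regs_1 using k by simp
  qed (simp add: regs_def)
  moreover have "?\<sigma> 0 = regs t (tape_of (encode (w # ws))) s"
    using Cons.prems(1)[of "b + 1"] by (simp add: encode_def fun_upd_idem)
  ultimately have 1: "exec orc (Loop 1 {1} (Pop 1 ;; Push (b + 1) 1))
      (regs t (tape_of (encode (w # ws))) s) (regs t (tape_of (2 # ?e)) (s(b + 1 := w)))"
    by simp
  have 2: "exec orc (Pop 1) (regs t (tape_of (2 # ?e)) (s(b + 1 := w))) (regs t (tape_of ?e) (s(b + 1 := w)))"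
    using exec_Pop[of "regs t (tape_of (2 # ?e)) (s(b + 1 := w))" 1 2 "?e" orc]
    unfolding regs_1 regs_upd_1 by simp
  let ?s = "s(b := list_encode (w # acc))"
  have 3: "exec orc (Record b) (regs t (tape_of ?e) (s(b + 1 := w))) (regs t (tape_of ?e) ?s)"
    by (rule exec_regs_eq[OF exec_Record])
      (use b Cons.prems in auto)
  have "exec orc (Read b) (regs t (tape_of ?e) ?s) (regs t blank (?s(b := list_encode (rev ws @ w # acc))))"
    by (rule Cons.IH) (use Cons.prems in auto)
  moreover have "regs t (tape_of (encode (w # ws))) s 1 0 \<in> {1, 2}"
    unfolding regs_1 by (cases w) (auto simp: encode_def)
  ultimately have "exec orc (Read b) (regs t (tape_of (encode (w # ws))) s)
      (regs t blank (?s(b := list_encode (rev ws @ w # acc))))"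
    unfolding Read_def by (intro exec_Loop_step[OF _ exec_Seq[OF exec_Seq[OF 1 2] 3]])
  then show ?case by (rule exec_regs_eq) simp
qed

definition Query_reg :: "nat \<Rightarrow> cmd" where
  "Query_reg b = Loop b {1} (Pop b ;; Push 1 1) ;; Ask ;; Read b"

lemma query_number_reg: "query_number (reg v) = v"
  unfolding query_number_def reg_def
  by (rule Least_equality) (auto simp: tape_of_def intro: leI)

lemma exec_Query_reg:
  assumes b: "2 \<le> b"
  shows "computes orc (Query_reg b) b (\<lambda>n. list_encode (rev (orc n)))"
  unfolding computes_def
proof (intro allI impI)
  fix t s assume s: "\<forall>i>b. s i = (0::nat)"
  let ?\<sigma> = "\<lambda>j. regs t (reg j) (s(b := s b - j))"
  have "exec orc (Loop b {1} (Pop b ;; Push 1 1)) (?\<sigma> 0) (?\<sigma> (s b))"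
  proof (rule exec_Loop)
    fix j assume "j < s b"
    then obtain k where k: "s b - j = Suc k" "s b - Suc j = k" by (metis Suc_diff_Suc)
    have 1: "exec orc (Pop b) (?\<sigma> j) (regs t (reg j) (s(b := k)))"
      using exec_Dec[OF b, of "s(b := s b - j)" k orc t "reg j"] k by simp
    have 2: "exec orc (Push 1 1) (regs t (reg j) (s(b := k))) (regs t (reg (Suc j)) (s(b := k)))"
      using exec_Push[of "regs t (reg j) (s(b := k))" 1 "replicate j 1" orc 1]
      unfolding regs_1 regs_upd_1 reg_def by simp
    show "?\<sigma> j b 0 \<in> {1} \<and> exec orc (Pop b ;; Push 1 1) (?\<sigma> j) (?\<sigma> (Suc j))"
      using exec_Seq[OF 1 2] k b by (simp add: regs_test[simplified])
  qed (use b in \<open>simp add: regs_test[simplified]\<close>)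
  then have 1: "exec orc (Loop b {1} (Pop b ;; Push 1 1)) (regs t blank s) (regs t (reg (s b)) (s(b := 0)))"
    by (simp add: reg_def)
  have 2: "exec orc Ask (regs t (reg (s b)) (s(b := 0))) (regs t (tape_of (encode (orc (s b)))) (s(b := 0)))"
    using exec_Ask[of orc "regs t (reg (s b)) (s(b := 0))"]
    unfolding regs_1 regs_upd_1 query_number_reg .
  have 3: "exec orc (Read b) (regs t (tape_of (encode (orc (s b)))) (s(b := 0)))
      (regs t blank (s(b := list_encode (rev (orc (s b))))))"
    using exec_Read[OF b, of "s(b := 0)" "[]"] s by simp
  show "exec orc (Query_reg b) (regs t blank s) (regs t blank (s(b := list_encode (rev (orc (s b))))))"
    unfolding Query_reg_def by (rule exec_Seq[OF exec_Seq[OF 1 2] 3])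
qed

lemmas program_defs = Push_def Pop_def Clear_def Move_def Fork_def Unpair_def Pair_at_def
  Record_def Read_def Query_reg_def

lemma computes_projection:
  assumes "2 \<le> b" and "(i, j, f) \<in> {(1, 2, fst), (2, 1, snd)}"
  shows "computes orc (Unpair b ;; Move (b + i) b ;; Clear (b + j)) b (\<lambda>n. f (prod_decode n))"
  unfolding computes_def
proof (intro allI impI)
  fix t s assume s: "\<forall>i>b. s i = (0::nat)"
  show "exec orc (Unpair b ;; Move (b + i) b ;; Clear (b + j)) (regs t blank s)
      (regs t blank (s(b := f (prod_decode (s b)))))"
    by (rule exec_regs_eq[OF exec_Seq[OF exec_Seq[OF exec_Unpair exec_Move] exec_Clear]])
      (use assms s in auto)
qed

lemma PR_program:
  assumes "PR orc f" and "2 \<le> b"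
  shows "\<exists>c k. cmd_ok k c \<and> computes orc c b f"
  using assms
proof (induction arbitrary: b)
  case PR_zero
  have "computes orc (Clear b) b (\<lambda>_. 0)"
    using exec_Clear[OF PR_zero] by (simp add: computes_def)
  then show ?case by (intro exI[of _ "Clear b"] exI[of _ "b + 1"]) (simp add: program_defs)
next
  case PR_Suc
  have "computes orc (Push b 1) b Suc"
    using exec_Inc[OF PR_Suc] by (simp add: computes_def)
  then show ?case by (intro exI[of _ "Push b 1"] exI[of _ "b + 1"]) (simp add: program_defs)
next
  case PR_id
  have "computes orc Done b (\<lambda>n. n)" by (simp add: computes_def exec_Done)
  then show ?case by (intro exI[of _ Done] exI[of _ 0]) simp
next
  case PR_fst
  then show ?case using computes_projection[of b 1 2 fst orc]
    by (intro exI[of _ "Unpair b ;; Move (b + 1) b ;; Clear (b + 2)"] exI[of _ "b + 3"])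
      (simp add: program_defs)
next
  case PR_snd
  then show ?case using computes_projection[of b 2 1 snd orc]
    by (intro exI[of _ "Unpair b ;; Move (b + 2) b ;; Clear (b + 1)"] exI[of _ "b + 3"])
      (simp add: program_defs)
next
  case (PR_pair f g)
  obtain cf kf where f: "cmd_ok kf cf" "computes orc cf (b + 1) f"
    using PR_pair.IH(1)[of "b + 1"] PR_pair.prems by auto
  obtain cg kg where g: "cmd_ok kg cg" "computes orc cg (b + 2) g"
    using PR_pair.IH(2)[of "b + 2"] PR_pair.prems by auto
  \<comment> \<open>A program at register r needs blank registers above r. So g runs first, at b +
    2, and its result is parked in b, below the scratch space of f at b + 1.\<close>
  let ?c = "Fork b (b + 1) (b + 2) ;; cg ;; Move (b + 2) b ;; cf ;; Pair_at (b + 1) b (b + 2) ;; Move (b + 4) b"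
  have "computes orc ?c b (\<lambda>n. prod_encode (f n, g n))"
    unfolding computes_def
  proof (intro allI impI)
    fix t s assume s: "\<forall>i>b. s i = (0::nat)"
    let ?R = "regs t blank"
    have 1: "exec orc (Fork b (b + 1) (b + 2)) (?R s) (?R (s(b := 0, b + 1 := s b, b + 2 := s b)))"
      by (rule exec_regs_eq[OF exec_Fork]) (use PR_pair.prems s in auto)
    have 2: "exec orc cg (?R (s(b := 0, b + 1 := s b, b + 2 := s b)))
        (?R (s(b := 0, b + 1 := s b, b + 2 := g (s b))))"
      by (rule exec_regs_eq[OF computesD[OF g(2)]]) (use s in auto)
    have 3: "exec orc (Move (b + 2) b) (?R (s(b := 0, b + 1 := s b, b + 2 := g (s b))))
        (?R (s(b := g (s b), b + 1 := s b)))"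
      by (rule exec_regs_eq[OF exec_Move])
        (use PR_pair.prems s in auto)
    have 4: "exec orc cf (?R (s(b := g (s b), b + 1 := s b)))
        (?R (s(b := g (s b), b + 1 := f (s b))))"
      by (rule exec_regs_eq[OF computesD[OF f(2)]]) (use s in auto)
    have 5: "exec orc (Pair_at (b + 1) b (b + 2)) (?R (s(b := g (s b), b + 1 := f (s b))))
        (?R (s(b := 0, b + 4 := prod_encode (f (s b), g (s b)))))"
      by (rule exec_regs_eq[OF exec_Pair_at])
        (use PR_pair.prems s in \<open>auto simp: numeral_eq_Suc\<close>)
    have 6: "exec orc (Move (b + 4) b) (?R (s(b := 0, b + 4 := prod_encode (f (s b), g (s b)))))
        (?R (s(b := prod_encode (f (s b), g (s b)))))"
      by (rule exec_regs_eq[OF exec_Move])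
        (use PR_pair.prems s in auto)
    show "exec orc ?c (?R s) (?R (s(b := prod_encode (f (s b), g (s b)))))"
      by (rule exec_Seq[OF exec_Seq[OF exec_Seq[OF exec_Seq[OF exec_Seq[OF 1 2] 3] 4] 5] 6])
  qed
  then show ?case
    using cmd_ok_mono[OF f(1), of "kf + kg + b + 5"] cmd_ok_mono[OF g(1), of "kf + kg + b + 5"]
    by (intro exI[of _ ?c] exI[of _ "kf + kg + b + 5"]) (simp add: program_defs)
next
  case (PR_comp f g)
  obtain cf kf where f: "cmd_ok kf cf" "computes orc cf b f"
    using PR_comp by blast
  obtain cg kg where g: "cmd_ok kg cg" "computes orc cg b g"
    using PR_comp by blast
  have "computes orc (cg ;; cf) b (\<lambda>n. f (g n))"
    unfolding computes_def
  proof (intro allI impI)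
    fix t s assume s: "\<forall>i>b. s i = (0::nat)"
    show "exec orc (cg ;; cf) (regs t blank s) (regs t blank (s(b := f (g (s b)))))"
      by (rule exec_regs_eq[OF exec_Seq[OF computesD[OF g(2)] computesD[OF f(2)]]]) (use s in auto)
  qed
  then show ?case
    using cmd_ok_mono[OF f(1), of "kf + kg"] cmd_ok_mono[OF g(1), of "kf + kg"]
    by (intro exI[of _ "cg ;; cf"] exI[of _ "kf + kg"]) simp
next
  case (PR_iter f)
  obtain cf k where f: "cmd_ok k cf" "computes orc cf (b + 2) f"
    using PR_iter.IH[of "b + 2"] by auto
  \<comment> \<open>The counter b + 1 lies below the register of \<open>cf\<close>, which leaves it
    unchanged.\<close>
  let ?l = "Loop (b + 1) {1} (Pop (b + 1) ;; cf)"
  have "computes orc (Unpair b ;; ?l ;; Move (b + 2) b) b (\<lambda>n. (f ^^ fst (prod_decode n)) (snd (prod_decode n)))"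
    unfolding computes_def
  proof (intro allI impI)
    fix t s assume s: "\<forall>i>b. s i = (0::nat)"
    let ?R = "regs t blank"
    obtain n m where nm: "prod_decode (s b) = (n, m)" by fastforce
    let ?s = "\<lambda>j. s(b := 0, b + 1 := n - j, b + 2 := (f ^^ j) m)"
    have 1: "exec orc (Unpair b) (?R s) (?R (?s 0))"
      by (rule exec_regs_eq[OF exec_Unpair]) (use PR_iter.prems s nm in auto)
    have 2: "exec orc ?l (?R (?s 0)) (?R (?s n))"
    proof (rule exec_while[where n = n and s = ?s])
      fix j assume "j < n"
      then obtain i where i: "n - j = Suc i" "n - Suc j = i" by (metis Suc_diff_Suc)
      have "exec orc (Pop (b + 1) ;; cf) (?R (?s j)) (?R (?s (Suc j)))"
        by (rule exec_regs_eq[OF exec_Seq[OF exec_Dec[of _ _ i] computesD[OF f(2)]]])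
          (use PR_iter.prems s i in auto)
      then show "?s j (b + 1) \<noteq> 0 \<and> exec orc (Pop (b + 1) ;; cf) (?R (?s j)) (?R (?s (Suc j)))"
        using i by simp
    qed (use PR_iter.prems in auto)
    have 3: "exec orc (Move (b + 2) b) (?R (?s n)) (?R (s(b := (f ^^ n) m)))"
      by (rule exec_regs_eq[OF exec_Move])
        (use PR_iter.prems s in auto)
    show "exec orc (Unpair b ;; ?l ;; Move (b + 2) b) (?R s)
        (?R (s(b := (f ^^ fst (prod_decode (s b))) (snd (prod_decode (s b))))))"
      using exec_Seq[OF exec_Seq[OF 1 2] 3] by (simp add: nm)
  qed
  then show ?case
    using cmd_ok_mono[OF f(1), of "k + b + 3"]
    by (intro exI[of _ "Unpair b ;; ?l ;; Move (b + 2) b"] exI[of _ "k + b + 3"]) (simp add: program_defs)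
next
  case PR_oracle
  then show ?case using exec_Query_reg[of b orc]
    by (intro exI[of _ "Query_reg b"] exI[of _ "b + 5"]) (simp add: program_defs)
qed

subsection \<open>Unbounded search\<close>

text \<open>Kleene's normal form as a program: an unbounded search around a primitive recursive
  test, followed by the primitive recursive output map h.\<close>

lemma PR_search:
  assumes Q: "PR orc Q" and h: "PR orc h"
    and ex: "\<And>n. 1 \<le> n \<Longrightarrow> \<exists>z. Q (prod_encode (n, z)) = 0"
  shows "\<exists>M. wf_otm M \<and> (\<forall>n\<ge>1. \<exists>z. Q (prod_encode (n, z)) = 0 \<and> otm_outputs M orc [n] [h z])"
proof -
  obtain cQ kQ where Q: "cmd_ok kQ cQ" "computes orc cQ 4 Q"
    using PR_program[OF Q, of 4] by auto
  obtain ch kh where h: "cmd_ok kh ch" "computes orc ch 3 h"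
    using PR_program[OF h, of 3] by auto
  \<comment> \<open>Registers 2 and 3 hold n and the candidate z. They are copied to 4 and 5 and
    restored through 5 and 6; their pair arises in 8 and is moved to 4, where \<open>cQ\<close>
    replaces it by the value of the test.\<close>
  define test where "test = Fork 2 4 5 ;; Move 5 2 ;; Fork 3 5 6 ;; Move 6 3 ;; (Pair_at 4 5 6 ;; Move 8 4) ;; cQ"
  \<comment> \<open>Only the strokes of the input are popped. Its separator stays on tape 0 and
    becomes that of the output, whose strokes are pushed in front of it. The search ends with
    register 4 empty, so \<open>ch\<close> finds blanks above register 3.\<close>
  define prog where "prog = Loop 0 {1} (Pop 0 ;; Push 2 1) ;; test ;;
    Loop 4 {1} (Clear 4 ;; Push 3 1 ;; test) ;; ch ;; Loop 3 {1} (Pop 3 ;; Push 0 1)"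
  define k where "k = kQ + kh + 9"
  have "cmd_ok k prog"
    using cmd_ok_mono[OF h(1), of k] cmd_ok_mono[OF Q(1), of k]
    by (simp add: prog_def test_def program_defs k_def)
  then obtain M where M: "wf_otm M" "\<And>orc inp ts.
    exec orc prog (\<lambda>i. if i = 0 then tape_of (encode inp) else (\<lambda>_. 0)) ts \<Longrightarrow>
    (\<exists>n r. (otm_step M orc ^^ n) (otm_init M inp) = (halt_state, map ts [0..<k] @ [r]))"
    using machine_of_cmd[of k prog] by (auto simp: prog_def k_def)
  have "\<exists>z. Q (prod_encode (n, z)) = 0 \<and> otm_outputs M orc [n] [h z]" if n: "1 \<le> n" for n
  proof -
    define z where "z = (LEAST z. Q (prod_encode (n, z)) = 0)"
    have z: "Q (prod_encode (n, z)) = 0" unfolding z_def by (rule LeastI_ex[OF ex[OF n]])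
    have less: "Q (prod_encode (n, y)) \<noteq> 0" if "y < z" for y
      using not_less_Least that unfolding z_def by blast
    define S :: "nat \<Rightarrow> nat \<Rightarrow> nat \<Rightarrow> nat" where "S y q = (\<lambda>_. 0)(2 := n, 3 := y, 4 := q)" for y q
    let ?T = "\<lambda>j. tape_of (replicate j 1 @ [2])"
    let ?R = "regs (tape_of [2]) blank"
    have upd0: "(regs t u s)(0 := t') = regs t' u s" "regs t u s 0 = t" for t u s t'
      by (auto simp: regs_def)
    have "exec orc (Loop 0 {1} (Pop 0 ;; Push 2 1))
        (regs (?T (n - 0)) blank (\<lambda>i. if i = 2 then 0 else 0))
        (regs (?T (n - n)) blank (\<lambda>i. if i = 2 then n else 0))"
    proof (rule exec_Loop[where \<sigma> = "\<lambda>j. regs (?T (n - j)) blank (\<lambda>i. if i = 2 then j else 0)"])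
      fix j assume "j < n"
      then obtain i where i: "n - j = Suc i" "n - Suc j = i" by (metis Suc_diff_Suc)
      let ?s = "\<lambda>j i. if i = 2 then j else (0 :: nat)"
      have 1: "exec orc (Pop 0) (regs (?T (n - j)) blank (?s j))
          (regs (?T i) blank (?s j))"
        using exec_Pop[of "regs (?T (n - j)) blank (?s j)" 0 1 "replicate i 1 @ [2]" orc]
        unfolding upd0 i by simp
      have 2: "exec orc (Push 2 1) (regs (?T i) blank (?s j))
          (regs (?T i) blank (?s (Suc j)))"
        by (rule exec_regs_eq[OF exec_Inc]) auto
      show "regs (?T (n - j)) blank (?s j) 0 0 \<in> {1} \<and>
         exec orc (Pop 0 ;; Push 2 1) (regs (?T (n - j)) blank (?s j))
           (regs (?T (n - Suc j)) blank (?s (Suc j)))"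
        using exec_Seq[OF 1 2] unfolding upd0 i by simp
    qed (simp add: upd0)
    moreover have "(\<lambda>i. if i = 2 then n else 0) = S 0 0" by (auto simp: S_def)
    ultimately have 1: "exec orc (Loop 0 {1} (Pop 0 ;; Push 2 1)) (regs (tape_of (encode [n])) blank (\<lambda>_. 0))
        (?R (S 0 0))"
      by (simp add: encode_def)
    have test: "exec orc test (?R (S y 0)) (?R (S y (Q (prod_encode (n, y)))))" for y
    proof -
      have a: "exec orc (Fork 2 4 5 ;; Move 5 2) (?R (S y 0)) (?R (S y n))"
        by (rule exec_regs_eq[OF exec_Seq[OF exec_Fork exec_Move]])
          (auto simp: S_def)
      have b: "exec orc (Fork 3 5 6) (?R (S y n)) (?R ((S 0 n)(5 := y, 6 := y)))"
        by (rule exec_regs_eq[OF exec_Fork])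
          (auto simp: S_def)
      have c: "exec orc (Move 6 3) (?R ((S 0 n)(5 := y, 6 := y))) (?R ((S y n)(5 := y)))"
        by (rule exec_regs_eq[OF exec_Move])
          (auto simp: S_def)
      have d: "exec orc (Pair_at 4 5 6 ;; Move 8 4) (?R ((S y n)(5 := y)))
          (?R (S y (prod_encode (n, y))))"
        by (rule exec_regs_eq[OF exec_Seq[OF exec_Pair_at exec_Move]])
          (auto simp: S_def)
      have e: "exec orc cQ (?R (S y (prod_encode (n, y)))) (?R (S y (Q (prod_encode (n, y)))))"
        by (rule exec_regs_eq[OF computesD[OF Q(2)]])
          (auto simp: S_def)
      show ?thesis unfolding test_def
        by (rule exec_Seq[OF exec_Seq[OF exec_Seq[OF exec_Seq[OF a b] c] d] e])
    qed
    have 2: "exec orc (Loop 4 {1} (Clear 4 ;; Push 3 1 ;; test)) (?R (S 0 (Q (prod_encode (n, 0)))))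
        (?R (S z 0))"
    proof (rule exec_while[where n = z and s = "\<lambda>y. S y (Q (prod_encode (n, y)))"])
      fix y assume y: "y < z"
      have "exec orc (Clear 4 ;; Push 3 1) (?R (S y (Q (prod_encode (n, y))))) (?R (S (Suc y) 0))"
        by (rule exec_regs_eq[OF exec_Seq[OF exec_Clear exec_Inc]])
          (auto simp: S_def)
      from exec_Seq[OF this test]
      show "S y (Q (prod_encode (n, y))) 4 \<noteq> 0 \<and> exec orc (Clear 4 ;; Push 3 1 ;; test)
          (?R (S y (Q (prod_encode (n, y))))) (?R (S (Suc y) (Q (prod_encode (n, Suc y)))))"
        using less[OF y] by (simp add: S_def)
    qed (auto simp: S_def z)
    have 3: "exec orc ch (?R (S z 0)) (?R (S (h z) 0))"
      by (rule exec_regs_eq[OF computesD[OF h(2)]])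
        (auto simp: S_def)
    have "exec orc (Loop 3 {1} (Pop 3 ;; Push 0 1))
        (regs (?T 0) blank (S (h z - 0) 0))
        (regs (?T (h z)) blank (S (h z - h z) 0))"
    proof (rule exec_Loop[where \<sigma> = "\<lambda>j. regs (?T j) blank (S (h z - j) 0)"])
      fix j assume "j < h z"
      then obtain i where i: "h z - j = Suc i" "h z - Suc j = i" by (metis Suc_diff_Suc)
      have 1: "exec orc (Pop 3) (regs (?T j) blank (S (Suc i) 0)) (regs (?T j) blank (S i 0))"
        by (rule exec_regs_eq[OF exec_Dec[of _ _ i]])
          (auto simp: S_def)
      have 2: "exec orc (Push 0 1) (regs (?T j) blank (S i 0)) (regs (?T (Suc j)) blank (S i 0))"
        using exec_Push[of "regs (?T j) blank (S i 0)" 0 "replicate j 1 @ [2]" orc 1]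
        unfolding upd0 by simp
      have "regs (?T j) blank (S (Suc i) 0) 3 0 \<in> {1}"
        by (subst regs_test) (auto simp: S_def)
      then show "regs (?T j) blank (S (h z - j) 0) 3 0 \<in> {1} \<and>
          exec orc (Pop 3 ;; Push 0 1) (regs (?T j) blank (S (h z - j) 0))
            (regs (?T (Suc j)) blank (S (h z - Suc j) 0))"
        using exec_Seq[OF 1 2] unfolding i by simp
    next
      show "regs (?T (h z)) blank (S (h z - h z) 0) 3 0 \<notin> {1}"
        by (subst regs_test) (auto simp: S_def)
    qed
    then have 4: "exec orc (Loop 3 {1} (Pop 3 ;; Push 0 1)) (?R (S (h z) 0))
        (regs (tape_of (encode [h z])) blank (S 0 0))"
      by (simp add: encode_def)
    have "exec orc prog (regs (tape_of (encode [n])) blank (\<lambda>_. 0)) (regs (tape_of (encode [h z])) blank (S 0 0))"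
      unfolding prog_def
      by (rule exec_Seq[OF exec_Seq[OF exec_Seq[OF exec_Seq[OF 1 test] 2] 3] 4])
    moreover have "regs (tape_of (encode [n])) blank (\<lambda>_. 0) =
        (\<lambda>i. if i = 0 then tape_of (encode [n]) else (\<lambda>_. 0))"
      by (auto simp: regs_def reg_def tape_of_def fun_eq_iff)
    ultimately obtain m r where "(otm_step M orc ^^ m) (otm_init M [n]) =
        (halt_state, map (regs (tape_of (encode [h z])) blank (S 0 0)) [0..<k] @ [r])"
      using M(2) by metis
    moreover have "(map (regs (tape_of (encode [h z])) blank (S 0 0)) [0..<k] @ [r]) ! 0 = tape_of (encode [h z])"
      by (simp add: nth_append k_def regs_def)
    ultimately have "otm_outputs M orc [n] [h z]"
      unfolding otm_outputs_def by (intro exI conjI) (assumption, auto simp: tape_of_def)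
    with z show ?thesis by blast
  qed
  with M(1) show ?thesis by blast
qed

section \<open>Primitive recursion on structured data\<close>

text \<open>The codings are bijective, so quantifiers over data are quantifiers over numbers.\<close>

class enc =
  fixes en :: "'a \<Rightarrow> nat" and de :: "nat \<Rightarrow> 'a"
  assumes de_en [simp]: "de (en x) = x" and en_de [simp]: "en (de n) = n"

instantiation nat :: enc
begin
definition "en (n :: nat) = n"
definition "de (n :: nat) = n"
instance by standard (auto simp: en_nat_def de_nat_def)
end

instantiation prod :: (enc, enc) enc
begin
definition "en p = prod_encode (en (fst p), en (snd p))"
definition "de n = (de (fst (prod_decode n)), de (snd (prod_decode n)))"
instance by standard (auto simp: en_prod_def de_prod_def)
end

instantiation list :: (enc) enc
begin
definition "en l = list_encode (map en l)"
definition "de n = map de (list_decode n)"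
instance by standard (auto simp: en_list_def de_list_def comp_def)
end

lemma en_inject [simp]: "en x = en y \<longleftrightarrow> x = y"
  by (metis de_en)

lemma en_Nil: "en [] = 0"
  by (simp add: en_list_def)

lemma en_Cons: "en (x # l) = Suc (en (x, l))"
  by (simp add: en_list_def en_prod_def)

definition hd0 :: "'a::enc list \<Rightarrow> 'a" where
  "hd0 l = (case l of [] \<Rightarrow> de 0 | x # _ \<Rightarrow> x)"

definition nth0 :: "'a::enc list \<Rightarrow> nat \<Rightarrow> 'a" where
  "nth0 l i = hd0 (drop i l)"

lemma nth0_nth: "i < length l \<Longrightarrow> nth0 l i = l ! i"
  by (simp add: nth0_def hd0_def hd_drop_conv_nth split: list.split)
    (metis Cons_nth_drop_Suc list.inject)

lemma de_0_prod: "(de 0 :: 'a::enc \<times> 'b::enc) = (de 0, de 0)"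
  by (simp add: de_prod_def prod_decode_0)

lemma de_0_list: "(de 0 :: 'a::enc list) = []"
  by (metis de_en en_Nil)

text \<open>The default \<open>de 0\<close> of \<open>hd0\<close> makes this hold for the empty list
  too, as \<open>en [] - 1 = 0\<close> decodes to a pair of defaults. Head and tail become primitive
  recursive without a case distinction.\<close>

lemma de_pred_list: "de (en l - 1) = (hd0 l, tl l)"
  by (cases l) (auto simp: en_Cons en_Nil de_0_prod de_0_list hd0_def)

named_theorems pr_intro

context fixes orc :: "nat \<Rightarrow> nat list"
begin

definition pr :: "('a::enc \<Rightarrow> 'b::enc) \<Rightarrow> bool" where
  "pr f \<longleftrightarrow> PR orc (\<lambda>n. en (f (de n)))"

lemma pr_comp: "pr f \<Longrightarrow> pr g \<Longrightarrow> pr (\<lambda>x. f (g x))"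
  unfolding pr_def using PR_comp[of orc "\<lambda>n. en (f (de n))" "\<lambda>n. en (g (de n))"] by simp

lemma pr_cong: "pr f \<Longrightarrow> (\<And>x. f x = g x) \<Longrightarrow> pr g"
  by (simp add: ext[of f g])

lemma pr_id [pr_intro]: "pr (\<lambda>x. x)"
  unfolding pr_def using PR_id by simp

lemma pr_Suc [pr_intro]: "pr f \<Longrightarrow> pr (\<lambda>x. Suc (f x))"
  by (rule pr_comp[of Suc f]) (use PR_Suc in \<open>simp_all add: pr_def en_nat_def de_nat_def\<close>)

lemma pr_en [pr_intro]: "pr f \<Longrightarrow> pr (\<lambda>x. en (f x))"
  unfolding pr_def by (simp add: en_nat_def)

lemma pr_de [pr_intro]: "pr f \<Longrightarrow> pr (\<lambda>x. de (f x))"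
  unfolding pr_def by (simp add: en_nat_def)

lemma pr_const [pr_intro]: "pr (\<lambda>_ :: 'a::enc. c :: 'b::enc)"
proof -
  have "pr (\<lambda>_ :: 'a. n)" for n :: nat
  proof (induction n)
    case 0
    then show ?case using PR_zero by (simp add: pr_def en_nat_def)
  next
    case (Suc n)
    then show ?case by (rule pr_Suc)
  qed
  then have "pr (\<lambda>_ :: 'a. de (en c) :: 'b)" by (intro pr_de)
  then show ?thesis by simp
qed

lemma pr_Pair [pr_intro]: "pr f \<Longrightarrow> pr g \<Longrightarrow> pr (\<lambda>x. (f x, g x))"
  unfolding pr_def en_prod_def by (simp add: PR_pair)

lemma pr_fst [pr_intro]: "pr f \<Longrightarrow> pr (\<lambda>x. fst (f x))"
  by (rule pr_comp[of fst f]) (use PR_fst in \<open>simp_all add: pr_def de_prod_def\<close>)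

lemma pr_snd [pr_intro]: "pr f \<Longrightarrow> pr (\<lambda>x. snd (f x))"
  by (rule pr_comp[of snd f]) (use PR_snd in \<open>simp_all add: pr_def de_prod_def\<close>)

lemma pr_iter [pr_intro]:
  fixes F :: "'a::enc \<Rightarrow> 'b::enc \<Rightarrow> 'b"
  assumes "pr n" "pr a" and F: "pr (\<lambda>p. F (fst p) (snd p))"
  shows "pr (\<lambda>x. (F x ^^ n x) (a x))"
proof -
  \<comment> \<open>\<open>PR_iter\<close> has no parameters; x is carried along unchanged in the
    state.\<close>
  let ?G = "\<lambda>p :: 'a \<times> 'b. (fst p, F (fst p) (snd p))"
  let ?g = "\<lambda>m. en (?G (de m))"
  have G: "(?G ^^ j) (x, y) = (x, (F x ^^ j) y)" for j x y
    by (induction j) auto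
  have g: "(?g ^^ j) (en p) = en ((?G ^^ j) p)" for j p
    by (induction j) auto
  have "PR orc ?g"
    using pr_Pair[OF pr_fst[OF pr_id] F] unfolding pr_def .
  note PR_iter[OF this]
  moreover have "(\<lambda>m. (?g ^^ fst (prod_decode m)) (snd (prod_decode m))) =
      (\<lambda>m. en ((?G ^^ fst (de m :: nat \<times> 'a \<times> 'b)) (snd (de m :: nat \<times> 'a \<times> 'b))))"
  proof (rule ext)
    fix m
    have 1: "(?g ^^ j) n = en ((?G ^^ j) (de n))" for j n
      using g[of j "de n"] by (simp only: en_de)
    have 2: "(de m :: nat \<times> 'a \<times> 'b) = (fst (prod_decode m), de (snd (prod_decode m)))"
      by (simp add: de_prod_def de_nat_def)
    show "(?g ^^ fst (prod_decode m)) (snd (prod_decode m)) =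
        en ((?G ^^ fst (de m :: nat \<times> 'a \<times> 'b)) (snd (de m :: nat \<times> 'a \<times> 'b)))"
      unfolding 1 2 fst_conv snd_conv ..
  qed
  ultimately have "pr (\<lambda>q :: nat \<times> _. (?G ^^ fst q) (snd q))" unfolding pr_def by simp
  from pr_snd[OF pr_comp[OF this pr_Pair[OF assms(1) pr_Pair[OF pr_id assms(2)]]]]
  show ?thesis by (simp add: G)
qed

subsection \<open>Arithmetic and decidable predicates\<close>

text \<open>Truth is 0, the value that \<open>PR_search\<close> looks for and that truncated
  subtraction yields for \<open>f x \<le> g x\<close>.\<close>

definition dec :: "('a::enc \<Rightarrow> bool) \<Rightarrow> bool" where
  "dec P \<longleftrightarrow> pr (\<lambda>x. if P x then 0 else (1 :: nat))"

lemma pr_If_zero: "pr c \<Longrightarrow> pr a \<Longrightarrow> pr b \<Longrightarrow> pr (\<lambda>x. if c x = (0 :: nat) then a x else b x)"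
proof -
  assume c: "pr c" and a: "pr a" and b: "pr b"
  \<comment> \<open>A constant map iterated 0 times keeps a x, and iterated at least once gives b
    x.\<close>
  have "pr (\<lambda>x. ((\<lambda>_. b x) ^^ c x) (a x))"
    by (intro pr_iter c a) (rule pr_comp[OF b pr_fst[OF pr_id]])
  moreover have "((\<lambda>_. b x) ^^ n) (a x) = (if n = 0 then a x else b x)" for n x
    by (induction n) auto
  ultimately show ?thesis by simp
qed

lemma pr_If [pr_intro]: "dec P \<Longrightarrow> pr a \<Longrightarrow> pr b \<Longrightarrow> pr (\<lambda>x. if P x then a x else b x)"
proof -
  assume "dec P" "pr a" "pr b"
  then have "pr (\<lambda>x. if (if P x then 0 else (1 :: nat)) = 0 then a x else b x)"
    unfolding dec_def by (rule pr_If_zero)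
  then show ?thesis by (rule pr_cong) simp
qed

lemma pr_pred: "pr f \<Longrightarrow> pr (\<lambda>x. f x - (1 :: nat))"
proof -
  assume f: "pr f"
  \<comment> \<open>The second component lags one step behind the counter.\<close>
  have "pr (\<lambda>x. snd (((\<lambda>p :: nat \<times> nat. (Suc (fst p), fst p)) ^^ f x) (0, 0)))"
    by (intro pr_intro f)
  moreover have "((\<lambda>p. (Suc (fst p), fst p)) ^^ n) (0 :: nat, 0 :: nat) = (n, n - 1)" for n
    by (induction n) auto
  ultimately show ?thesis by simp
qed

lemma pr_add [pr_intro]: "pr f \<Longrightarrow> pr g \<Longrightarrow> pr (\<lambda>x. f x + g x :: nat)"
proof -
  assume f: "pr f" and g: "pr g"
  have "pr (\<lambda>x. (Suc ^^ f x) (g x))" by (intro pr_intro f g)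
  then show ?thesis by simp
qed

lemma pr_diff [pr_intro]: "pr f \<Longrightarrow> pr g \<Longrightarrow> pr (\<lambda>x. f x - g x :: nat)"
proof -
  assume f: "pr f" and g: "pr g"
  have "pr (\<lambda>x. ((\<lambda>n. n - 1) ^^ g x) (f x))" by (intro pr_iter f g pr_pred pr_snd pr_id)
  moreover have "((\<lambda>n. n - 1) ^^ k) m = m - k" for k m :: nat
    by (induction k) auto
  ultimately show ?thesis by simp
qed

lemma pr_mult [pr_intro]: "pr f \<Longrightarrow> pr g \<Longrightarrow> pr (\<lambda>x. f x * g x :: nat)"
proof -
  assume f: "pr f" and g: "pr g"
  have "pr (\<lambda>x. ((\<lambda>n. f x + n) ^^ g x) 0)" by (intro pr_intro f g pr_comp[OF f])
  moreover have "((\<lambda>n. m + n) ^^ k) 0 = m * k" for k m :: nat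
    by (induction k) auto
  ultimately show ?thesis by simp
qed

lemma pr_power [pr_intro]: "pr f \<Longrightarrow> pr g \<Longrightarrow> pr (\<lambda>x. f x ^ g x :: nat)"
proof -
  assume f: "pr f" and g: "pr g"
  have "pr (\<lambda>x. ((\<lambda>n. f x * n) ^^ g x) 1)" by (intro pr_intro f g pr_comp[OF f])
  moreover have "((\<lambda>n. m * n) ^^ k) 1 = m ^ k" for k m :: nat
    by (induction k) auto
  ultimately show ?thesis by simp
qed

lemma dec_zero: "pr f \<Longrightarrow> dec (\<lambda>x. f x = (0 :: nat))"
  unfolding dec_def by (intro pr_If_zero pr_const)

lemma dec_le [pr_intro]: "pr f \<Longrightarrow> pr g \<Longrightarrow> dec (\<lambda>x. f x \<le> (g x :: nat))"
  using dec_zero[OF pr_diff[of f g]] by simp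

lemma dec_less [pr_intro]: "pr f \<Longrightarrow> pr g \<Longrightarrow> dec (\<lambda>x. f x < (g x :: nat))"
  using dec_le[OF pr_Suc[of f], of g] by (simp add: Suc_le_eq)

lemma dec_not [pr_intro]: "dec P \<Longrightarrow> dec (\<lambda>x. \<not> P x)"
proof -
  assume "dec P"
  from pr_If[OF this, of "\<lambda>_. 1 :: nat" "\<lambda>_. 0"] have "pr (\<lambda>x. if P x then (1 :: nat) else 0)"
    by (simp add: pr_const)
  then show ?thesis unfolding dec_def by (rule pr_cong) simp
qed

lemma dec_conj [pr_intro]: "dec P \<Longrightarrow> dec Q \<Longrightarrow> dec (\<lambda>x. P x \<and> Q x)"
proof -
  assume P: "dec P" and "dec Q"
  then have "pr (\<lambda>x. if P x then if Q x then 0 else (1 :: nat) else 1)"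
    by (intro pr_If pr_const) (simp_all add: dec_def)
  then show ?thesis unfolding dec_def by (rule pr_cong) simp
qed

lemma dec_disj [pr_intro]: "dec P \<Longrightarrow> dec Q \<Longrightarrow> dec (\<lambda>x. P x \<or> Q x)"
  using dec_not[OF dec_conj[OF dec_not[of P] dec_not[of Q]]] by simp

lemma dec_eq [pr_intro]: "pr f \<Longrightarrow> pr g \<Longrightarrow> dec (\<lambda>x. f x = g x)"
proof -
  assume "pr f" "pr g"
  then have "dec (\<lambda>x. en (f x) \<le> en (g x) \<and> en (g x) \<le> en (f x))" by (intro pr_intro)
  moreover have "en (f x) \<le> en (g x) \<and> en (g x) \<le> en (f x) \<longleftrightarrow> f x = g x" for x
    by (metis en_inject order_antisym order_refl)
  ultimately show ?thesis by simp
qed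

lemma dec_comp: "dec P \<Longrightarrow> pr f \<Longrightarrow> dec (\<lambda>x. P (f x))"
  unfolding dec_def by (rule pr_comp[of "\<lambda>x. if P x then 0 else 1" f])

subsection \<open>Lists\<close>

lemma pr_Cons [pr_intro]: "pr (f :: 'a::enc \<Rightarrow> 'b::enc) \<Longrightarrow> pr g \<Longrightarrow> pr (\<lambda>x. f x # g x)"
proof -
  assume "pr f" "pr g"
  then have "pr (\<lambda>x. de (Suc (en (f x, g x))) :: 'b list)" by (intro pr_intro)
  then show ?thesis by (simp only: en_Cons[symmetric] de_en)
qed

lemma pr_tl [pr_intro]: "pr (f :: 'a::enc \<Rightarrow> 'b::enc list) \<Longrightarrow> pr (\<lambda>x. tl (f x))"
proof -
  assume "pr f"
  then have "pr (\<lambda>x. snd (de (en (f x) - 1) :: 'b \<times> 'b list))" by (intro pr_intro pr_pred)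
  then show ?thesis by (simp only: de_pred_list snd_conv)
qed

lemma pr_hd0 [pr_intro]: "pr (f :: 'a::enc \<Rightarrow> 'b::enc list) \<Longrightarrow> pr (\<lambda>x. hd0 (f x))"
proof -
  assume "pr f"
  then have "pr (\<lambda>x. fst (de (en (f x) - 1) :: 'b \<times> 'b list))" by (intro pr_intro pr_pred)
  then show ?thesis by (simp only: de_pred_list fst_conv)
qed

lemma pr_nth0 [pr_intro]: "pr (f :: 'a::enc \<Rightarrow> 'b::enc list) \<Longrightarrow> pr g \<Longrightarrow> pr (\<lambda>x. nth0 (f x) (g x))"
proof -
  assume f: "pr f" and g: "pr g"
  have "pr (\<lambda>x. hd0 ((tl ^^ g x) (f x)))" by (intro pr_intro f g)
  moreover have "(tl ^^ i) l = drop i l" for i and l :: "'b list"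
    by (induction i) (auto simp: tl_drop drop_Suc)
  ultimately show ?thesis by (simp add: nth0_def)
qed

text \<open>The code of a list bounds its length, so it can serve as number of iterations; the
  iteration idles once the list is used up. Most list functions below are such folds.\<close>

lemma pr_foldl [pr_intro]:
  assumes l: "pr (l :: 'a::enc \<Rightarrow> 'b::enc list)" and a: "pr a" and f: "pr (\<lambda>p. f (fst p) (fst (snd p)) (snd (snd p)))"
  shows "pr (\<lambda>x. foldl (f x) (a x) (l x))"
proof -
  let ?s = "\<lambda>x p. if snd p = [] then p else (f x (fst p) (hd0 (snd p)), tl (snd p))"
  have "pr (\<lambda>q. f (fst q) (fst (snd q)) (hd0 (snd (snd q))))"
    using pr_comp[OF f, of "\<lambda>q. (fst q, fst (snd q), hd0 (snd (snd q)))"]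
    by (simp add: pr_intro)
  then have "pr (\<lambda>x. fst ((?s x ^^ en (l x)) (a x, l x)))"
    by (intro pr_intro l a)
  moreover have "length l \<le> n \<Longrightarrow> (?s x ^^ n) (y, l) = (foldl (f x) y l, [])" for x n y l
  proof (induction n arbitrary: y l)
    case (Suc n)
    then show ?case
      by (cases l) (auto simp: funpow_Suc_right hd0_def simp del: funpow.simps)
  qed auto
  moreover have "length l \<le> en l" for l :: "'b list"
  proof (induction l)
    case (Cons x l)
    then show ?case using le_prod_encode_2[of "en l" "en x"] by (simp add: en_Cons en_prod_def)
  qed simp
  ultimately show ?thesis by simp
qed

lemma pr_rev [pr_intro]: "pr (f :: 'a::enc \<Rightarrow> 'b::enc list) \<Longrightarrow> pr (\<lambda>x. rev (f x))"
proof -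
  assume f: "pr f"
  have "pr (\<lambda>x. foldl (\<lambda>s e. e # s) [] (f x))" by (intro pr_intro f)
  moreover have "foldl (\<lambda>s e. e # s) acc l = rev l @ acc" for l acc :: "'b list"
    by (induction l arbitrary: acc) auto
  ultimately show ?thesis by simp
qed

lemma pr_append [pr_intro]: "pr (f :: 'a::enc \<Rightarrow> 'b::enc list) \<Longrightarrow> pr g \<Longrightarrow> pr (\<lambda>x. f x @ g x)"
proof -
  assume f: "pr f" and g: "pr g"
  have "pr (\<lambda>x. foldl (\<lambda>s e. e # s) (g x) (rev (f x)))" by (intro pr_intro f g)
  moreover have "foldl (\<lambda>s e. e # s) acc (rev l) = l @ acc" for l acc :: "'b list"
    by (induction l arbitrary: acc) auto
  ultimately show ?thesis by simp
qed

lemma pr_map [pr_intro]: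
  assumes l: "pr l" and f: "pr (\<lambda>p. f (fst p) (snd p))"
  shows "pr (\<lambda>x. map (f x) (l x))"
proof -
  have "pr (\<lambda>q. f (fst q) (snd (snd q)))"
    using pr_comp[OF f, of "\<lambda>q. (fst q, snd (snd q))"] by (simp add: pr_intro)
  then have "pr (\<lambda>x. rev (foldl (\<lambda>s e. f x e # s) [] (l x)))" by (intro pr_intro l)
  moreover have "foldl (\<lambda>s e. f x e # s) acc l = rev (map (f x) l) @ acc" for x l acc
    by (induction l arbitrary: acc) auto
  ultimately show ?thesis by simp
qed

lemma pr_concat [pr_intro]: "pr (f :: 'a::enc \<Rightarrow> 'b::enc list list) \<Longrightarrow> pr (\<lambda>x. concat (f x))"
proof -
  assume f: "pr f"
  have "pr (\<lambda>x. foldl (\<lambda>s e. s @ e) [] (f x))" by (intro pr_intro f)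
  moreover have "foldl (\<lambda>s e. s @ e) acc l = acc @ concat l" for l and acc :: "'b list"
    by (induction l arbitrary: acc) auto
  ultimately show ?thesis by simp
qed

lemma pr_length [pr_intro]: "pr (f :: 'a::enc \<Rightarrow> 'b::enc list) \<Longrightarrow> pr (\<lambda>x. length (f x))"
proof -
  assume f: "pr f"
  have "pr (\<lambda>x. foldl (\<lambda>s e. Suc s) 0 (f x))" by (intro pr_intro f)
  moreover have "foldl (\<lambda>s e. Suc s) n l = n + length l" for n and l :: "'b list"
    by (induction l arbitrary: n) auto
  ultimately show ?thesis by simp
qed

lemma pr_sum_list [pr_intro]: "pr f \<Longrightarrow> pr (\<lambda>x. sum_list (f x) :: nat)"
proof -
  assume f: "pr f"
  have "pr (\<lambda>x. foldl (\<lambda>s e. s + e) 0 (f x))" by (intro pr_intro f)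
  moreover have "foldl (\<lambda>s e. s + e) n l = n + sum_list l" for n and l :: "nat list"
    by (induction l arbitrary: n) auto
  ultimately show ?thesis by simp
qed

lemma pr_prod_list [pr_intro]: "pr f \<Longrightarrow> pr (\<lambda>x. prod_list (f x) :: nat)"
proof -
  assume f: "pr f"
  have "pr (\<lambda>x. foldl (\<lambda>s e. s * e) 1 (f x))" by (intro pr_intro f)
  moreover have "foldl (\<lambda>s e. s * e) n l = n * prod_list l" for n and l :: "nat list"
    by (induction l arbitrary: n) auto
  ultimately show ?thesis by simp
qed

lemma dec_ball [pr_intro]:
  assumes l: "pr l" and P: "dec (\<lambda>p. P (fst p) (snd p))"
  shows "dec (\<lambda>x. \<forall>y\<in>set (l x). P x y)"
proof -
  have "dec (\<lambda>q. P (fst q) (snd (snd q)))"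
    using dec_comp[OF P, of "\<lambda>q. (fst q, snd (snd q))"] by (simp add: pr_intro)
  then have "pr (\<lambda>x. foldl (\<lambda>s e. if P x e then s else (1 :: nat)) 0 (l x))" by (intro pr_intro l)
  moreover have "foldl (\<lambda>s e. if P x e then s else 1) n l = (if \<forall>y\<in>set l. P x y then n else 1)"
    for x l and n :: nat
    by (induction l arbitrary: n) auto
  ultimately show ?thesis unfolding dec_def by simp
qed

lemma dec_member [pr_intro]: "pr f \<Longrightarrow> pr l \<Longrightarrow> dec (\<lambda>x. f x \<in> set (l x))"
proof -
  assume f: "pr f" and l: "pr l"
  have "dec (\<lambda>x. \<not> (\<forall>y\<in>set (l x). y \<noteq> f x))" by (intro pr_intro l pr_comp[OF f])
  then show ?thesis by simp
qed

lemma dec_distinct [pr_intro]: "pr (l :: 'a::enc \<Rightarrow> 'b::enc list) \<Longrightarrow> dec (\<lambda>x. distinct (l x))"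
proof -
  assume l: "pr l"
  let ?f = "\<lambda>s e. (e # fst s, if e \<in> set (fst s) then 1 else snd s)"
  have "pr (\<lambda>x. snd (foldl ?f ([], 0 :: nat) (l x)))" by (intro pr_intro l)
  moreover have "snd (foldl ?f (acc, n) l) = (if distinct l \<and> set l \<inter> set acc = {} then n else (1 :: nat))"
    for acc n and l :: "'b list"
    by (induction l arbitrary: acc n) auto
  ultimately show ?thesis unfolding dec_def by simp
qed

lemma pr_upt [pr_intro]: "pr f \<Longrightarrow> pr (\<lambda>x. [0..<f x])"
proof -
  assume f: "pr f"
  have "pr (\<lambda>x. ((\<lambda>l. l @ [length l]) ^^ f x) [])" by (intro pr_intro f)
  moreover have "((\<lambda>l. l @ [length l]) ^^ n) [] = [0..<n]" for n
    by (induction n) auto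
  ultimately show ?thesis by simp
qed

lemma pr_replicate [pr_intro]: "pr f \<Longrightarrow> pr (g :: 'a::enc \<Rightarrow> 'b::enc) \<Longrightarrow> pr (\<lambda>x. replicate (f x) (g x))"
proof -
  assume f: "pr f" and g: "pr g"
  have "pr (\<lambda>x. ((\<lambda>l. g x # l) ^^ f x) [])" by (intro pr_intro f pr_comp[OF g])
  moreover have "((\<lambda>l. a # l) ^^ n) [] = replicate n a" for n and a :: 'b
    by (induction n) auto
  ultimately show ?thesis by simp
qed

lemma pr_encode [pr_intro]: "pr f \<Longrightarrow> pr (\<lambda>x. encode (f x))"
  unfolding encode_def by (intro pr_intro)

lemma pr_oracle [pr_intro]: "pr f \<Longrightarrow> pr (\<lambda>x. orc (f x))"
proof -
  assume f: "pr f"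
  have "pr (\<lambda>n. rev (orc n))"
    using PR_oracle by (simp add: pr_def en_list_def en_nat_def[abs_def] de_nat_def)
  from pr_rev[OF pr_comp[OF this f]] show ?thesis by simp
qed

text \<open>A table with finitely many entries is a nest of case distinctions. This is how the
  transition function of a given machine is handled.\<close>

lemma pr_finite:
  assumes "finite A"
  shows "\<exists>F. pr F \<and> (\<forall>x\<in>A. F x = f x)"
  using assms
proof induction
  case empty
  then show ?case using pr_const by blast
next
  case (insert a A)
  then obtain F where "pr F" "\<forall>x\<in>A. F x = f x" by blast
  then have "pr (\<lambda>x. if x = a then f a else F x) \<and> (\<forall>x\<in>insert a A. (if x = a then f a else F x) = f x)"
    by (auto intro!: pr_intro)
  then show ?case by (rule exI[of _ "\<lambda>x. if x = a then f a else F x"])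
qed

section \<open>Recursively enumerable relations\<close>

text \<open>Recursive enumerability in normal form. One numerical witness is enough because the
  bijective codings pack further witnesses into it.\<close>

definition re :: "('a::enc \<Rightarrow> bool) \<Rightarrow> bool" where
  "re P \<longleftrightarrow> (\<exists>Q. dec Q \<and> (\<forall>x. P x \<longleftrightarrow> (\<exists>z :: nat. Q (x, z))))"

lemma re_dec: "dec P \<Longrightarrow> re P"
  unfolding re_def by (rule exI[of _ "\<lambda>p. P (fst p)"]) (auto intro!: dec_comp[of P] pr_fst pr_id)

lemma re_comp: "re P \<Longrightarrow> pr f \<Longrightarrow> re (\<lambda>x. P (f x))"
proof -
  assume "re P" and f: "pr f"
  then obtain P' where P': "dec P'" "\<And>x. P x \<longleftrightarrow> (\<exists>z :: nat. P' (x, z))"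
    unfolding re_def by blast
  have "dec (\<lambda>p :: _ \<times> nat. P' (f (fst p), snd p))"
    by (intro dec_comp[OF P'(1)] pr_intro pr_comp[OF f])
  then show ?thesis unfolding re_def P' by (intro exI[of _ "\<lambda>p. P' (f (fst p), snd p)"]) auto
qed

lemma re_ex:
  fixes P :: "'a::enc \<Rightarrow> 'b::enc \<Rightarrow> bool"
  assumes "re (\<lambda>p. P (fst p) (snd p))"
  shows "re (\<lambda>x. \<exists>y. P x y)"
proof -
  from assms obtain P' where P': "dec P'" "\<And>p. P (fst p) (snd p) \<longleftrightarrow> (\<exists>z :: nat. P' (p, z))"
    unfolding re_def by blast
  have "(\<exists>y. P x y) \<longleftrightarrow> (\<exists>z. P' ((x, fst (de z :: 'b \<times> nat)), snd (de z :: 'b \<times> nat)))" for x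
  proof
    assume "\<exists>y. P x y"
    then obtain y z where "P' ((x, y), z)" using P'(2)[of "(x, _)"] by auto
    then show "\<exists>z. P' ((x, fst (de z :: 'b \<times> nat)), snd (de z :: 'b \<times> nat))" by (intro exI[of _ "en (y, z)"]) simp
  next
    assume "\<exists>z. P' ((x, fst (de z :: 'b \<times> nat)), snd (de z :: 'b \<times> nat))"
    then show "\<exists>y. P x y" using P'(2)[of "(x, _)"] by auto
  qed
  moreover have "dec (\<lambda>p :: _ \<times> nat. P' ((fst p, fst (de (snd p) :: 'b \<times> nat)), snd (de (snd p) :: 'b \<times> nat)))"
    by (intro dec_comp[OF P'(1)] pr_intro)
  ultimately show ?thesis unfolding re_def
    by (intro exI[of _ "\<lambda>p. P' ((fst p, fst (de (snd p) :: 'b \<times> nat)), snd (de (snd p) :: 'b \<times> nat))"]) auto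
qed

lemma re_conj: "re P \<Longrightarrow> re Q \<Longrightarrow> re (\<lambda>x. P x \<and> Q x)"
proof -
  assume "re P" "re Q"
  then obtain P' Q' where P': "dec P'" "\<And>x. P x \<longleftrightarrow> (\<exists>z :: nat. P' (x, z))"
    and Q': "dec Q'" "\<And>x. Q x \<longleftrightarrow> (\<exists>z :: nat. Q' (x, z))"
    unfolding re_def by blast
  have "re (\<lambda>x. \<exists>y z. P' (x, y) \<and> Q' (x, z))"
    by (intro re_ex re_dec pr_intro dec_comp[OF P'(1)] dec_comp[OF Q'(1)])
  then show ?thesis by (simp add: P'(2) Q'(2))
qed

lemma re_disj: "re P \<Longrightarrow> re Q \<Longrightarrow> re (\<lambda>x. P x \<or> Q x)"
proof -
  assume "re P" "re Q"
  then obtain P' Q' where P': "dec P'" "\<And>x. P x \<longleftrightarrow> (\<exists>z :: nat. P' (x, z))"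
    and Q': "dec Q'" "\<And>x. Q x \<longleftrightarrow> (\<exists>z :: nat. Q' (x, z))"
    unfolding re_def by blast
  have "re (\<lambda>x. \<exists>z. P' (x, z) \<or> Q' (x, z))"
    by (intro re_ex re_dec pr_intro dec_comp[OF P'(1)] dec_comp[OF Q'(1)])
  then show ?thesis by (simp add: P'(2) Q'(2) ex_disj_distrib)
qed

text \<open>The witnesses, one for each entry of the list, are collected into a single list of
  pairs, which is again one witness.\<close>

lemma re_ball:
  assumes l: "pr l" and P: "re (\<lambda>p. P (fst p) (snd p))"
  shows "re (\<lambda>x. \<forall>y\<in>set (l x). P x y)"
proof -
  from P obtain P' where P': "dec P'" "\<And>p. P (fst p) (snd p) \<longleftrightarrow> (\<exists>z :: nat. P' (p, z))"
    unfolding re_def by blast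
  have "(\<forall>y\<in>set (l x). P x y) \<longleftrightarrow> (\<exists>zs. map fst zs = l x \<and> (\<forall>q\<in>set zs. P' ((x, fst q), snd q)))" for x
  proof
    assume *: "\<forall>y\<in>set (l x). P x y"
    have "\<exists>z. P' ((x, y), z)" if "y \<in> set (l x)" for y
      using * that P'(2)[of "(x, y)"] by auto
    then obtain z where "\<And>y. y \<in> set (l x) \<Longrightarrow> P' ((x, y), z y)" by metis
    then show "\<exists>zs. map fst zs = l x \<and> (\<forall>q\<in>set zs. P' ((x, fst q), snd q))"
      by (intro exI[of _ "map (\<lambda>y. (y, z y)) (l x)"]) (auto simp: comp_def)
  next
    assume "\<exists>zs. map fst zs = l x \<and> (\<forall>q\<in>set zs. P' ((x, fst q), snd q))"
    then obtain zs where zs: "map fst zs = l x" "\<And>q. q \<in> set zs \<Longrightarrow> P' ((x, fst q), snd q)" by blast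
    show "\<forall>y\<in>set (l x). P x y"
      unfolding zs(1)[symmetric] using zs(2) P'(2)[of "(x, _)"] by fastforce
  qed
  moreover have "re (\<lambda>x. \<exists>zs. map fst zs = l x \<and> (\<forall>q\<in>set zs. P' ((x, fst q), snd q)))"
    by (intro re_ex re_dec pr_intro pr_comp[OF l] dec_comp[OF P'(1)])
  ultimately show ?thesis by simp
qed

lemma re_all_less:
  assumes "pr (n :: 'a::enc \<Rightarrow> nat)" and "re (\<lambda>p. P (fst p) (snd p))"
  shows "re (\<lambda>x. \<forall>i<n x. P x i)"
  using re_ball[OF pr_upt[OF assms(1)] assms(2)] by (simp add: atLeast0LessThan lessThan_iff Ball_def)

text \<open>The search runs over pairs (k, z) of a candidate and a witness for it, since
  \<open>R n k\<close> is only enumerable; the pair found is projected to k.\<close>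

lemma re_search:
  assumes "re (\<lambda>p. R (fst p) (snd p))" and "\<And>n. 1 \<le> n \<Longrightarrow> \<exists>k. R n k"
  shows "\<exists>M. wf_otm M \<and> (\<forall>n\<ge>1. \<exists>k. R n k \<and> otm_outputs M orc [n] [k])"
proof -
  from assms(1) obtain Q where Q: "dec Q" "\<And>p. R (fst p) (snd p) \<longleftrightarrow> (\<exists>z :: nat. Q (p, z))"
    unfolding re_def by blast
  let ?q = "\<lambda>p :: nat \<times> nat \<times> nat. if Q ((fst p, fst (snd p)), snd (snd p)) then 0 else (1 :: nat)"
  have q: "pr ?q"
    by (intro pr_intro dec_comp[OF Q(1)])
  have h: "pr (\<lambda>z :: nat. fst (de z :: nat \<times> nat))" by (intro pr_intro)
  have "\<exists>z. en (?q (de (prod_encode (n, z)))) = 0" if n: "1 \<le> n" for n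
  proof -
    obtain k z where "Q ((n, k), z)"
      using assms(2)[OF n] Q(2)[of "(n, _)"] by auto
    then show ?thesis
      by (intro exI[of _ "en (k, z)"]) (simp add: de_prod_def en_prod_def en_nat_def de_nat_def)
  qed
  from PR_search[OF q[unfolded pr_def] h[unfolded pr_def] this]
  obtain M where M: "wf_otm M" "\<And>n. 1 \<le> n \<Longrightarrow> \<exists>z. en (?q (de (prod_encode (n, z)))) = 0 \<and>
      otm_outputs M orc [n] [en (fst (de (de z) :: nat \<times> nat))]"
    by blast
  have "\<exists>k. R n k \<and> otm_outputs M orc [n] [k]" if n: "1 \<le> n" for n
  proof -
    obtain z where z: "en (?q (de (prod_encode (n, z)))) = 0"
      "otm_outputs M orc [n] [en (fst (de (de z) :: nat \<times> nat))]"
      using M(2)[OF n] by blast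
    define k where "k = fst (de z :: nat \<times> nat)"
    have "Q ((n, k), snd (de z :: nat \<times> nat))"
      using z(1) by (simp add: de_prod_def en_nat_def de_nat_def k_def split: if_splits)
    then have "R n k" using Q(2)[of "(n, k)"] by auto
    moreover have "en (fst (de (de z) :: nat \<times> nat)) = k"
      by (simp add: k_def en_nat_def) (simp add: de_nat_def)
    ultimately show ?thesis using z(2) by metis
  qed
  with M(1) show ?thesis by blast
qed

end

section \<open>Simulation of oracle machines\<close>

text \<open>A tape is represented by the cells to the left of the head, nearest first, and the other cells.\<close>

definition tape_abs :: "nat list \<times> nat list \<Rightarrow> tape" where
  "tape_abs p = (\<lambda>z. if 0 \<le> z then nth0 (snd p) (nat z) else nth0 (fst p) (nat (- z - 1)))"

lemma hd0_simps [simp]: "hd0 ([] :: nat list) = 0" "hd0 (x # l) = x"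
  by (auto simp: hd0_def de_nat_def)

lemma nth0_simps [simp]: "nth0 ([] :: nat list) i = 0" "nth0 (x # l) 0 = x" "nth0 (x # l) (Suc i) = nth0 l i"
  by (auto simp: nth0_def)

lemma nth0_tl: "nth0 (tl l) i = nth0 l (Suc i)"
  by (simp add: nth0_def drop_Suc)

lemma hd0_conv_nth0: "hd0 l = nth0 l 0"
  by (simp add: nth0_def)

lemma nth0_ge: "length l \<le> i \<Longrightarrow> nth0 (l :: nat list) i = 0"
  by (simp add: nth0_def)

lemma tape_abs_simps:
  "tape_abs p (int n) = nth0 (snd p) n" "tape_abs p (- int n - 1) = nth0 (fst p) n"
  by (auto simp: tape_abs_def)

definition move_code :: "move \<Rightarrow> nat" where
  "move_code m = (case m of Move_Left \<Rightarrow> 0 | Move_Right \<Rightarrow> 1 | No_Move \<Rightarrow> 2)"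

definition sim_action :: "nat \<times> nat \<Rightarrow> nat list \<times> nat list \<Rightarrow> nat list \<times> nat list" where
  "sim_action act p =
    (if snd act = 0 then (tl (fst p), hd0 (fst p) # fst act # tl (snd p))
     else if snd act = 1 then (fst act # fst p, tl (snd p))
     else (fst p, fst act # tl (snd p)))"

lemma nth0_Cons: "nth0 (x # l) i = (if i = 0 then x else nth0 l (i - 1))"
  by (cases i) auto

lemma tape_abs_sim_action:
  "tape_abs (sim_action (a, move_code m) p) = apply_action (a, m) (tape_abs p)"
proof
  fix z :: int
  obtain n where "z = int n \<or> z = - int n - 1"
    by (cases "0 \<le> z") (auto intro: that[of "nat z"] that[of "nat (- z - 1)"])
  then show "tape_abs (sim_action (a, move_code m) p) z = apply_action (a, m) (tape_abs p) z"
    by (elim disjE; cases m; auto simp: tape_abs_def sim_action_def move_code_def apply_action_def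
        nth0_Cons nth0_tl hd0_conv_nth0 nat_diff_distrib nat_add_distrib Suc_diff_Suc
        intro!: arg_cong[where f = "nth0 _"])
qed

text \<open>A fold with a flag that is raised at the first symbol other than a stroke; in this form
  \<open>pr_foldl\<close> applies.\<close>

definition strokes :: "nat list \<Rightarrow> nat" where
  "strokes r = fst (foldl (\<lambda>s e. if snd s = 0 \<and> e = 1 then (Suc (fst s), 0) else (fst s, 1 :: nat)) (0, 0) r)"

lemma strokes_takeWhile: "strokes r = length (takeWhile (\<lambda>e. e = 1) r)"
proof -
  have "fst (foldl (\<lambda>s e. if snd s = 0 \<and> e = 1 then (Suc (fst s), 0) else (fst s, 1 :: nat)) (n, b) r) =
      (if b = 0 then n + length (takeWhile (\<lambda>e. e = 1) r) else n)" for n b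
    by (induction r arbitrary: n b) auto
  then show ?thesis by (simp add: strokes_def)
qed

lemma query_number_tape_abs: "query_number (tape_abs p) = strokes (snd p)"
proof -
  let ?n = "length (takeWhile (\<lambda>e. e = 1) (snd p))"
  have "nth0 (snd p) ?n \<noteq> 1"
  proof (cases "?n < length (snd p)")
    case True
    then show ?thesis using nth_length_takeWhile[OF True] by (simp add: nth0_nth)
  next
    case False
    then show ?thesis by (simp add: nth0_ge)
  qed
  moreover have "nth0 (snd p) k = 1" if "k < ?n" for k
    using that takeWhile_nth[OF that] nth_mem[OF that] length_takeWhile_le[of "\<lambda>e. e = 1" "snd p"]
      set_takeWhileD[of "takeWhile (\<lambda>e. e = 1) (snd p) ! k" "\<lambda>e. e = 1" "snd p"]
    by (simp add: nth0_nth)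
  ultimately show ?thesis
    unfolding query_number_def strokes_takeWhile tape_abs_simps
    by (intro Least_equality) (auto intro: leI)
qed

lemma tape_abs_tape_of: "tape_abs ([], w) = tape_of w"
  by (auto simp: tape_abs_def tape_of_def fun_eq_iff nth0_nth nth0_ge)

lemma pr_strokes [pr_intro]: "pr orc f \<Longrightarrow> pr orc (\<lambda>x. strokes (f x))"
  unfolding strokes_def by (intro pr_intro)

lemma pr_sim_action [pr_intro]:
  "pr orc f \<Longrightarrow> pr orc h \<Longrightarrow> pr orc (\<lambda>x. sim_action (f x) (h x))"
  unfolding sim_action_def by (intro pr_intro)

definition sim_step :: "(nat \<Rightarrow> nat list) \<Rightarrow> nat \<Rightarrow> (nat \<times> nat list \<Rightarrow> nat \<times> (nat \<times> nat) list) \<Rightarrow>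
    nat \<times> (nat list \<times> nat list) list \<Rightarrow> nat \<times> (nat list \<times> nat list) list" where
  "sim_step orc k F c =
    (if fst c = halt_state then c
     else if fst c = query_state then
       (answer_state, map (\<lambda>j. if j = 1 then ([], encode (orc (strokes (snd (nth0 (snd c) 1)))))
          else nth0 (snd c) j) [0..<k])
     else (fst (F (fst c, map (\<lambda>t. hd0 (snd t)) (snd c))),
       map (\<lambda>j. sim_action (nth0 (snd (F (fst c, map (\<lambda>t. hd0 (snd t)) (snd c)))) j) (nth0 (snd c) j)) [0..<k]))"

lemma pr_sim_step:
  assumes "pr orc F"
  shows "pr orc (sim_step orc k F)"
  unfolding sim_step_def[abs_def] by (intro pr_intro pr_comp[OF assms])

lemma encode_symbols: "set (encode ws) \<subseteq> {1, 2}"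
  by (auto simp: encode_def)

text \<open>Kleene's predicate: one step is primitive recursive, hence so is the configuration after
  n steps, and the halting time n is the witness.\<close>

lemma re_otm_outputs:
  assumes M: "wf_otm M"
  shows "re orc (\<lambda>p. otm_outputs M orc (fst p) (snd p))"
proof -
  define k K S where "k = tm_tapes M" and "K = tm_symbols M" and "S = tm_states M"
  have k: "2 \<le> k" "3 \<le> K" "4 \<le> S"
    using M by (auto simp: wf_otm_def k_def K_def S_def)
  have delta: "fst (tm_delta M q as) < S" "length (snd (tm_delta M q as)) = k"
      "fst ` set (snd (tm_delta M q as)) \<subseteq> {..<K}"
    if "q < S" "length as = k" "set as \<subseteq> {..<K}" for q as
    using M that unfolding wf_otm_def k_def K_def S_def by (auto simp: case_prod_unfold)
  let ?A = "{..<S} \<times> {as. set as \<subseteq> {..<K} \<and> length as = k}"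
  let ?f = "\<lambda>p. (fst (tm_delta M (fst p) (snd p)),
    map (\<lambda>act. (fst act, move_code (snd act))) (snd (tm_delta M (fst p) (snd p))))"
  \<comment> \<open>\<open>tm_delta\<close> is an arbitrary function; what makes it recursive is
    that only the finite table of its values on proper states and symbols matters.\<close>
  have "finite ?A" by (intro finite_cartesian_product finite_lists_length_eq) auto
  then obtain F where F: "pr orc F" "\<And>x. x \<in> ?A \<Longrightarrow> F x = ?f x"
    using pr_finite[of ?A orc ?f] by blast
  define sim where "sim = sim_step orc k F"
  have sim: "pr orc sim" unfolding sim_def by (rule pr_sim_step[OF F(1)])
  \<comment> \<open>The invariant that keeps the run inside this table; \<open>wf_otm\<close>
    preserves it.\<close>
  define ok where "ok c \<longleftrightarrow> fst c < S \<and> length (snd c) = k \<and>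
    (\<forall>t\<in>set (snd c). set (fst t) \<subseteq> {..<K} \<and> set (snd t) \<subseteq> {..<K})"
    for c :: "nat \<times> (nat list \<times> nat list) list"
  let ?abs = "\<lambda>c. (fst c, map tape_abs (snd c))"
  have hd0_K: "hd0 l < K" if "set l \<subseteq> {..<K}" for l
    using that k by (cases l) auto
  have tl_K: "set (tl l) \<subseteq> {..<K}" if "set l \<subseteq> {..<K}" for l :: "nat list"
    using that by (cases l) auto
  have step: "ok (sim c) \<and> ?abs (sim c) = otm_step M orc (?abs c)" if c: "ok c" for c
  proof -
    obtain q tl where qtl: "c = (q, tl)" by fastforce
    have q: "q < S" and tl: "length tl = k"
      and sym: "\<And>t. t \<in> set tl \<Longrightarrow> set (fst t) \<subseteq> {..<K} \<and> set (snd t) \<subseteq> {..<K}"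
      using c by (auto simp: ok_def qtl)
    have nth: "nth0 tl j = tl ! j" if "j < k" for j using that tl by (simp add: nth0_nth)
    consider "q = halt_state" | "q = query_state" | "q \<noteq> halt_state" "q \<noteq> query_state" by blast
    then show ?thesis
    proof cases
      case 1
      then show ?thesis using c by (simp add: sim_def sim_step_def qtl)
    next
      case 2
      let ?a = "encode (orc (strokes (snd (tl ! 1))))"
      have s: "sim c = (answer_state, tl[1 := ([], ?a)])"
        using 2 k tl by (auto simp: sim_def sim_step_def qtl nth nth_list_update intro!: nth_equalityI)
      have "ok (sim c)"
        using k tl sym encode_symbols[of "orc (strokes (snd (tl ! 1)))"]
          set_update_subset_insert[of tl 1 "([], ?a)"]
        by (auto simp: s ok_def) (fastforce dest!: subsetD)+
      moreover have "map tape_abs (tl[1 := ([], ?a)]) = (map tape_abs tl)[1 := tape_of ?a]"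
        by (simp add: map_update tape_abs_tape_of)
      ultimately show ?thesis
        unfolding s using 2 k tl by (simp add: qtl query_number_tape_abs)
    next
      case 3
      define as where "as = map (\<lambda>t. hd0 (snd t)) tl"
      have as: "length as = k" "set as \<subseteq> {..<K}"
        using tl sym hd0_K by (auto simp: as_def)
      define d where "d = tm_delta M q as"
      note d = delta[OF q as, folded d_def]
      have Fd: "F (q, as) = (fst d, map (\<lambda>act. (fst act, move_code (snd act))) (snd d))"
        using F(2)[of "(q, as)"] q as by (simp add: d_def)
      have s: "sim c = (fst d, map (\<lambda>j. sim_action (fst (snd d ! j), move_code (snd (snd d ! j))) (tl ! j)) [0..<k])"
        using 3 d(2) by (simp add: sim_def sim_step_def qtl as_def[symmetric] Fd nth nth0_nth)
      have "set (fst (sim_action (a, m) t)) \<subseteq> {..<K} \<and> set (snd (sim_action (a, m) t)) \<subseteq> {..<K}"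
        if "a < K" "set (fst t) \<subseteq> {..<K} \<and> set (snd t) \<subseteq> {..<K}" for a m t
        using that tl_K[of "fst t"] tl_K[of "snd t"] hd0_K[of "fst t"] by (auto simp: sim_action_def)
      moreover have "fst (snd d ! j) < K" if "j < k" for j
        using d(2,3) that by (metis (no_types, lifting) image_subset_iff lessThan_iff nth_mem)
      moreover have "tl ! j \<in> set tl" if "j < k" for j using that tl by simp
      ultimately have "ok (sim c)"
        unfolding s ok_def using d(1) sym by auto
      moreover have "map tape_abs (map (\<lambda>j. sim_action (fst (snd d ! j), move_code (snd (snd d ! j))) (tl ! j)) [0..<k])
          = map2 apply_action (snd d) (map tape_abs tl)"
        by (rule nth_equalityI) (use d(2) tl in \<open>auto simp: tape_abs_sim_action\<close>)
      moreover have "map (\<lambda>t. t 0) (map tape_abs tl) = as"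
        by (simp add: as_def tape_abs_def hd0_conv_nth0)
      ultimately show ?thesis
        unfolding s using 3 by (simp add: qtl d_def case_prod_unfold)
    qed
  qed
  define c0 :: "nat list \<Rightarrow> nat \<times> (nat list \<times> nat list) list"
    where "c0 inp = (0, ([], encode inp) # replicate (k - 1) ([], []))" for inp
  have "ok (c0 inp)" for inp
    using k encode_symbols[of inp] by (auto simp: ok_def c0_def)
  moreover have "?abs (c0 inp) = otm_init M inp" for inp
    by (simp add: c0_def otm_init_def k_def tape_abs_tape_of)
      (auto simp: tape_of_def fun_eq_iff)
  ultimately have run: "ok ((sim ^^ n) (c0 inp)) \<and>
      ?abs ((sim ^^ n) (c0 inp)) = (otm_step M orc ^^ n) (otm_init M inp)" for n inp
  proof (induction n)
    case (Suc n)
    then show ?case using step[of "(sim ^^ n) (c0 inp)"] by simp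
  qed simp
  let ?r = "\<lambda>n inp. snd (nth0 (snd ((sim ^^ n) (c0 inp))) 0)"
  let ?P = "\<lambda>n inp out. fst ((sim ^^ n) (c0 inp)) = halt_state \<and>
      (\<forall>i\<in>set [0..<length (encode out)]. nth0 (?r n inp) i = nth0 (encode out) i) \<and>
      nth0 (?r n inp) (length (encode out)) = 0"
  have "otm_outputs M orc inp out \<longleftrightarrow> (\<exists>n. ?P n inp out)" for inp out
  proof -
    have "(\<exists>ts. (otm_step M orc ^^ n) (otm_init M inp) = (halt_state, ts) \<and>
        (\<forall>k < length (encode out). (ts ! 0) (int k) = encode out ! k) \<and>
        (ts ! 0) (int (length (encode out))) = 0) \<longleftrightarrow> ?P n inp out" for n
    proof -
      obtain q tl where c: "(sim ^^ n) (c0 inp) = (q, tl)" by fastforce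
      have r: "(otm_step M orc ^^ n) (otm_init M inp) = (q, map tape_abs tl)" and tl: "length tl = k"
        using run[of n inp] by (auto simp: c ok_def)
      have "nth0 tl 0 = tl ! 0" "map tape_abs tl ! 0 = tape_abs (tl ! 0)"
        using k tl by (auto simp: nth0_nth)
      then show ?thesis
        unfolding c r by (auto simp: tape_abs_simps nth0_nth)
    qed
    then show ?thesis unfolding otm_outputs_def by blast
  qed
  moreover have "re orc (\<lambda>p. \<exists>n. ?P n (fst p) (snd p))"
    unfolding c0_def
    by (intro re_ex re_dec pr_intro pr_comp[OF sim])
  ultimately show ?thesis by simp
qed

lemma re_outputs:
  "wf_otm M \<Longrightarrow> pr orc f \<Longrightarrow> pr orc h \<Longrightarrow> re orc (\<lambda>x. otm_outputs M orc (f x) (h x))"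
  using re_comp[OF re_otm_outputs[of M orc] pr_Pair[of orc f h]] by simp

section \<open>Uniqueness of outputs\<close>

lemma encode_inject: "encode ms = encode ns \<Longrightarrow> ms = ns"
proof (induction ms arbitrary: ns)
  case Nil
  then show ?case by (cases ns) (auto simp: encode_def)
next
  case (Cons m ms)
  have e: "encode (x # xs) = replicate x 1 @ 2 # encode xs" for x xs
    by (simp add: encode_def)
  obtain n ns' where ns: "ns = n # ns'"
    using Cons.prems by (cases ns) (auto simp: encode_def)
  have "takeWhile (\<lambda>a. a = 1) (encode (x # xs)) = replicate x 1"
    "dropWhile (\<lambda>a. a = 1) (encode (x # xs)) = 2 # encode xs" for x xs
    unfolding e by (auto simp: takeWhile_append dropWhile_append)
  then have "replicate m (1 :: nat) = replicate n 1" "encode ms = encode ns'"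
    using Cons.prems unfolding ns by (metis, metis list.inject)
  then show ?case using Cons.IH ns by (metis length_replicate)
qed

text \<open>The hypotheses assert that some output is correct; with uniqueness every output is, so
  an output relation inside a certificate determines the value meant. Halting configurations are
  fixed points, so two runs can be compared at time n + n', and codes contain no blank, so the first
  blank fixes their length.\<close>

lemma otm_outputs_unique:
  assumes "otm_outputs M orc inp out" and "otm_outputs M orc inp out'"
  shows "out = out'"
proof -
  obtain n ts where n: "(otm_step M orc ^^ n) (otm_init M inp) = (halt_state, ts)"
    "\<forall>k < length (encode out). (ts ! 0) (int k) = encode out ! k" "(ts ! 0) (int (length (encode out))) = 0"
    using assms(1) unfolding otm_outputs_def by blast
  obtain n' ts' where n': "(otm_step M orc ^^ n') (otm_init M inp) = (halt_state, ts')"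
    "\<forall>k < length (encode out'). (ts' ! 0) (int k) = encode out' ! k" "(ts' ! 0) (int (length (encode out'))) = 0"
    using assms(2) unfolding otm_outputs_def by blast
  have halt: "(otm_step M orc ^^ j) (halt_state, us) = (halt_state, us)" for j us
    by (induction j) auto
  have "(otm_step M orc ^^ (n + n')) (otm_init M inp) = (halt_state, ts)"
    unfolding add.commute[of n n'] funpow_add using n(1) halt by simp
  moreover have "(otm_step M orc ^^ (n + n')) (otm_init M inp) = (halt_state, ts')"
    unfolding funpow_add using n'(1) halt by simp
  ultimately have ts: "ts' = ts" by simp
  have nz: "encode ws ! k \<noteq> 0" if "k < length (encode ws)" for ws k
    using encode_symbols[of ws] nth_mem[OF that] by auto
  have "length (encode out) = length (encode out')"
    using n(2,3) n'(2,3) nz[of _ out] nz[of _ out'] unfolding ts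
    by (metis linorder_neqE_nat)
  then have "encode out = encode out'"
    by (rule nth_equalityI) (use n(2) n'(2) in \<open>simp add: ts \<open>length _ = _\<close>[symmetric]\<close>)
  then show ?thesis by (rule encode_inject)
qed

section \<open>Decompositions and cylinders\<close>

definition translate :: "int \<Rightarrow> (int \<Rightarrow> nat) \<Rightarrow> (int \<Rightarrow> nat)" where
  "translate m x = (\<lambda>k. x (k + m))"

lemma translate_translate [simp]: "translate m (translate n x) = translate (m + n) x"
  by (auto simp: translate_def fun_eq_iff algebra_simps)

lemma translate_0 [simp]: "translate 0 x = x"
  by (simp add: translate_def)

lemma shift_eq_translate: "shift = translate 1"
  by (auto simp: shift_def translate_def fun_eq_iff)

lemma continuous_translate: "continuous_on A (translate m)"
  unfolding translate_def
  by (intro continuous_on_coordinatewise_then_product continuous_on_product_coordinates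
      continuous_on_subset[OF _ subset_UNIV])

lemma decompositionD:
  assumes "decomposition G x (\<tau>, \<gamma>)"
  shows "\<gamma> j \<in> G" "\<tau> (j + 1) = \<tau> j + int (length (\<gamma> j))" "\<tau> 0 \<le> 0" "0 < \<tau> 1"
    "m < length (\<gamma> j) \<Longrightarrow> x (\<tau> j + int m) = \<gamma> j ! m"
  using assms by (auto simp: decomposition_def)

lemma decomposition_translate:
  assumes "decomposition G x (\<tau>, \<gamma>)" and "\<tau> J \<le> m" and "m < \<tau> (J + 1)"
  shows "decomposition G (translate m x) (\<lambda>j. \<tau> (j + J) - m, \<lambda>j. \<gamma> (j + J))"
proof -
  have "\<tau> (j + 1 + J) = \<tau> (j + J) + int (length (\<gamma> (j + J)))" for j
    using decompositionD(2)[OF assms(1), of "j + J"] by (simp add: algebra_simps)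
  then show ?thesis
    using assms decompositionD(1,5)[OF assms(1)]
    by (auto simp: decomposition_def translate_def algebra_simps)
qed

lemma decomposition_block:
  assumes "decomposition G x (\<tau>, \<gamma>)" and ne: "[] \<notin> G"
  shows "\<exists>J. \<tau> J \<le> m \<and> m < \<tau> (J + 1)"
proof (induction m rule: int_induct[where k = 0])
  case base
  then show ?case using decompositionD(3,4)[OF assms(1)] by (intro exI[of _ 0]) auto
next
  case (step1 i)
  then obtain J where J: "\<tau> J \<le> i" "i < \<tau> (J + 1)" by blast
  have "length (\<gamma> (J + 1)) > 0" using decompositionD(1)[OF assms(1), of "J + 1"] ne by auto
  then have "\<tau> (J + 1) < \<tau> (J + 1 + 1)" using decompositionD(2)[OF assms(1), of "J + 1"] by simp
  then show ?case using J
    by (cases "i + 1 < \<tau> (J + 1)") (auto intro: exI[of _ J] exI[of _ "J + 1"])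
next
  case (step2 i)
  then obtain J where J: "\<tau> J \<le> i" "i < \<tau> (J + 1)" by blast
  have "length (\<gamma> (J - 1)) > 0" using decompositionD(1)[OF assms(1), of "J - 1"] ne by auto
  then have "\<tau> (J - 1) < \<tau> J" using decompositionD(2)[OF assms(1), of "J - 1"] by simp
  then show ?case using J
    by (cases "\<tau> J \<le> i - 1") (auto intro: exI[of _ J] exI[of _ "J - 1"])
qed

lemma translate_X_con: "[] \<notin> G \<Longrightarrow> x \<in> X_con G \<Longrightarrow> translate m x \<in> X_con G"
  unfolding X_con_def using decomposition_block decomposition_translate by fast

lemma translate_coded_shift:
  assumes "[] \<notin> G" and "x \<in> coded_shift G"
  shows "translate m x \<in> coded_shift G"
proof -
  have "translate m ` closure (X_con G) \<subseteq> closure (X_con G)"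
    by (rule image_closure_subset[OF continuous_translate closed_closure])
      (use translate_X_con[OF assms(1)] closure_subset in blast)
  then show ?thesis using assms(2) unfolding coded_shift_def by blast
qed

lemma decomposition_concat:
  assumes "decomposition G x (\<tau>, \<gamma>)"
    and "\<And>j. j < length hs \<Longrightarrow> \<gamma> (J + int j) = hs ! j"
  shows "\<tau> (J + int (length hs)) = \<tau> J + int (length (concat hs))"
    and "i < length (concat hs) \<Longrightarrow> x (\<tau> J + int i) = concat hs ! i"
proof -
  have "\<tau> (J + int (length hs)) = \<tau> J + int (length (concat hs)) \<and>
     (\<forall>i < length (concat hs). x (\<tau> J + int i) = concat hs ! i)"
    using assms(2)
  proof (induction hs arbitrary: J)
    case (Cons h hs)
    have h: "\<gamma> J = h" using Cons.prems[of 0] by simp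
    have IH: "\<tau> (J + 1 + int (length hs)) = \<tau> (J + 1) + int (length (concat hs)) \<and>
      (\<forall>i < length (concat hs). x (\<tau> (J + 1) + int i) = concat hs ! i)"
    proof (rule Cons.IH)
      fix j assume "j < length hs"
      then show "\<gamma> (J + 1 + int j) = hs ! j"
        using Cons.prems[of "Suc j"] by (simp add: algebra_simps)
    qed
    have J: "\<tau> (J + 1) = \<tau> J + int (length h)"
      using decompositionD(2)[OF assms(1), of J] h by simp
    have "x (\<tau> J + int i) = concat (h # hs) ! i" if "i < length (concat (h # hs))" for i
    proof (cases "i < length h")
      case True
      then show ?thesis using decompositionD(5)[OF assms(1), of i J] h by (simp add: nth_append)
    next
      case False
      have "i - length h < length (concat hs)" using False that by auto
      from IH[THEN conjunct2, rule_format, OF this]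
      have "x (\<tau> (J + 1) + int (i - length h)) = concat hs ! (i - length h)" .
      then show ?thesis using False by (simp add: J nth_append of_nat_diff)
    qed
    then show ?case using IH J by (auto simp: algebra_simps)
  qed simp
  then show "\<tau> (J + int (length hs)) = \<tau> J + int (length (concat hs))"
    and "i < length (concat hs) \<Longrightarrow> x (\<tau> J + int i) = concat hs ! i" by auto
qed

text \<open>Coordinate 0 is at offset \<open>o'\<close> of the block \<open>hs ! N\<close>.\<close>

definition block_cyl :: "nat list set \<Rightarrow> nat \<Rightarrow> nat list list \<Rightarrow> nat \<Rightarrow> (int \<Rightarrow> nat) set" where
  "block_cyl G N hs o' = {x. \<exists>\<tau> \<gamma>. decomposition G x (\<tau>, \<gamma>) \<and> \<tau> 0 = - int o' \<and>
     (\<forall>j < length hs. \<gamma> (int j - int N) = hs ! j)}"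

text \<open>Translation by m puts the start of \<open>hs\<close> at coordinate -m, so that
  coordinate 0 lies at offset \<open>o'\<close> of \<open>hs ! N\<close>. With invariance this
  transfers the given measure of a \<open>G_cylinder\<close> to every piece.\<close>

lemma translate_block_cyl_iff:
  assumes N: "N < length hs" and o': "o' < length (hs ! N)" and ne: "[] \<notin> G"
    and m: "m = int (o' + length (concat (take N hs)))"
  shows "translate m y \<in> block_cyl G N hs o' \<longleftrightarrow> y \<in> G_cylinder G hs"
proof
  assume "y \<in> G_cylinder G hs"
  then obtain \<tau> \<gamma> where d: "decomposition G y (\<tau>, \<gamma>)" "\<tau> 0 = 0" "\<forall>j < length hs. \<gamma> (int j) = hs ! j"
    unfolding G_cylinder_def by auto
  have "\<tau> (0 + int (length (take N hs))) = \<tau> 0 + int (length (concat (take N hs)))"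
    by (rule decomposition_concat[OF d(1)]) (use d(3) N in auto)
  then have tN: "\<tau> (int N) = m - int o'" using N d(2) m by simp
  moreover have "\<tau> (int N + 1) = \<tau> (int N) + int (length (hs ! N))"
    using decompositionD(2)[OF d(1), of "int N"] d(3) N by simp
  ultimately have "decomposition G (translate m y) (\<lambda>j. \<tau> (j + int N) - m, \<lambda>j. \<gamma> (j + int N))"
    using decomposition_translate[OF d(1), of "int N" m] o' by simp
  moreover have "\<forall>j < length hs. \<gamma> (int j - int N + int N) = hs ! j" using d(3) by simp
  ultimately show "translate m y \<in> block_cyl G N hs o'"
    unfolding block_cyl_def using tN by fastforce
next
  assume "translate m y \<in> block_cyl G N hs o'"
  then obtain \<tau> \<gamma> where d: "decomposition G (translate m y) (\<tau>, \<gamma>)" "\<tau> 0 = - int o'"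
    "\<forall>j < length hs. \<gamma> (int j - int N) = hs ! j"
    unfolding block_cyl_def by auto
  have "\<tau> (- int N + int (length (take N hs))) = \<tau> (- int N) + int (length (concat (take N hs)))"
    by (rule decomposition_concat[OF d(1)]) (use d(3) N in auto)
  then have tN: "\<tau> (- int N) = - m" using N d(2) m by simp
  moreover have "length (\<gamma> (- int N)) > 0" using decompositionD(1)[OF d(1), of "- int N"] ne by auto
  ultimately have "decomposition G (translate (- m) (translate m y))
      (\<lambda>j. \<tau> (j + - int N) - (- m), \<lambda>j. \<gamma> (j + - int N))"
    using decompositionD(2)[OF d(1), of "- int N"]
    by (intro decomposition_translate[OF d(1)]) auto
  moreover have "\<tau> (0 + - int N) - (- m) = 0" using tN by simp
  moreover have "\<forall>j < length hs. \<gamma> (int j + - int N) = hs ! j" using d(3) by simp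
  ultimately show "y \<in> G_cylinder G hs"
    unfolding G_cylinder_def by fastforce
qed

text \<open>Unique representation enters here: pieces that differ in blocks or offset would give one
  point two different decompositions.\<close>

lemma block_cyl_disjoint:
  assumes u: "uniquely_represents G"
    and "length hs = length hs'" and "x \<in> block_cyl G N hs o'" and "x \<in> block_cyl G N hs' o''"
  shows "hs = hs' \<and> o' = o''"
proof -
  obtain \<tau> \<gamma> where d: "decomposition G x (\<tau>, \<gamma>)" "\<tau> 0 = - int o'"
    "\<forall>j < length hs. \<gamma> (int j - int N) = hs ! j"
    using assms(3) unfolding block_cyl_def by auto
  obtain \<tau>' \<gamma>' where d': "decomposition G x (\<tau>', \<gamma>')" "\<tau>' 0 = - int o''"
    "\<forall>j < length hs'. \<gamma>' (int j - int N) = hs' ! j"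
    using assms(4) unfolding block_cyl_def by auto
  have "x \<in> X_con G" using d(1) unfolding X_con_def by blast
  then have "(\<tau>, \<gamma>) = (\<tau>', \<gamma>')" using u d(1) d'(1) unfolding uniquely_represents_def by blast
  then show ?thesis using d d' assms(2) by (auto intro: nth_equalityI)
qed

definition central_word :: "nat \<Rightarrow> (int \<Rightarrow> nat) \<Rightarrow> nat list" where
  "central_word N x = map (\<lambda>i. x (int i - int N)) [0..<2 * N + 1]"

text \<open>
  \<open>w\<close> is what the blocks \<open>hs\<close> show around coordinate 0 if that is at offset \<open>o'\<close> of the middle block.
  Blocks are nonempty, so \<open>N\<close> of them on either side cover \<open>w\<close>.
\<close>

definition fits :: "nat list \<Rightarrow> nat list list \<Rightarrow> nat \<Rightarrow> bool" where
  "fits w hs o' \<longleftrightarrow> (\<exists>L h R pre suf. hs = L @ h # R \<and> length w = 2 * length L + 1 \<and> length R = length L \<and>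
     concat hs = pre @ w @ suf \<and> length pre + length L = o' + length (concat L) \<and> o' < length h)"

lemma fits_length: "fits w hs o' \<Longrightarrow> length hs = length w"
  by (auto simp: fits_def)

lemma fits_block_cyl:
  assumes w: "length w = 2 * N + 1" and "fits w hs o'" and x: "x \<in> block_cyl G N hs o'"
  shows "central_word N x = w"
proof -
  obtain L h R pre suf where f: "hs = L @ h # R" "length w = 2 * length L + 1" "length R = length L"
    "concat hs = pre @ w @ suf" "length pre + length L = o' + length (concat L)" "o' < length h"
    using assms(2) unfolding fits_def by blast
  have N: "length L = N" using f(2) w by simp
  obtain \<tau> \<gamma> where d: "decomposition G x (\<tau>, \<gamma>)" "\<tau> 0 = - int o'"
    "\<forall>j < length hs. \<gamma> (int j - int N) = hs ! j"
    using x unfolding block_cyl_def by auto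
  have "\<tau> (- int N + int (length L)) = \<tau> (- int N) + int (length (concat L))"
    by (rule decomposition_concat[OF d(1)]) (use d(3) in \<open>auto simp: f(1) nth_append\<close>)
  \<comment> \<open>By the length equation in \<open>fits\<close>, \<open>pre\<close> ends right
    before coordinate -N, where w has to begin.\<close>
  then have tN: "\<tau> (- int N) = - int (length pre + N)"
    using N d(2) f(5) by simp
  have "x (int i - int N) = w ! i" if "i < length w" for i
  proof -
    have "x (\<tau> (- int N) + int (length pre + i)) = concat hs ! (length pre + i)"
      by (rule decomposition_concat(2)[OF d(1)]) (use d(3) that in \<open>auto simp: f(4)\<close>)
    then show ?thesis using that by (simp add: tN f(4) nth_append algebra_simps)
  qed
  then show ?thesis
    using w by (auto simp: central_word_def intro!: nth_equalityI simp del: upt_Suc)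
qed

lemma length_concat_ge: "[] \<notin> set l \<Longrightarrow> length l \<le> length (concat l)"
proof (induction l)
  case (Cons a l)
  then show ?case by (cases a) auto
qed simp

lemma block_cyl_cover:
  assumes x: "x \<in> X_con G" and ne: "[] \<notin> G"
  shows "\<exists>hs o'. set hs \<subseteq> G \<and> fits (central_word N x) hs o' \<and> x \<in> block_cyl G N hs o'"
proof -
  obtain \<tau> \<gamma> where d: "decomposition G x (\<tau>, \<gamma>)"
    using x unfolding X_con_def by auto
  define hs where "hs = map (\<lambda>j. \<gamma> (int j - int N)) [0..<2 * N + 1]"
  define L where "L = map (\<lambda>j. \<gamma> (int j - int N)) [0..<N]"
  define R where "R = map (\<lambda>j. \<gamma> (int j + 1)) [0..<N]"
  define o' where "o' = nat (- \<tau> 0)"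
  let ?w = "central_word N x"
  have hs: "hs = L @ \<gamma> 0 # R"
    by (rule nth_equalityI)
      (auto simp: hs_def L_def R_def nth_append nth_Cons' of_nat_diff algebra_simps simp del: upt_Suc)
  have G: "set hs \<subseteq> G" using decompositionD(1)[OF d] by (auto simp: hs_def)
  have o': "\<tau> 0 = - int o'" "o' < length (\<gamma> 0)"
    using decompositionD(2)[OF d, of 0] decompositionD(3,4)[OF d] by (auto simp: o'_def)
  have len: "length L = N" "length R = N" "length ?w = 2 * N + 1"
    by (auto simp: L_def R_def central_word_def)
  have "[] \<notin> set L" "[] \<notin> set R" using G ne by (auto simp: hs)
  then have cL: "N \<le> length (concat L)" and cR: "N \<le> length (concat R)"
    using length_concat_ge[of L] length_concat_ge[of R] len by auto
  have hsj: "\<And>j. j < length hs \<Longrightarrow> \<gamma> (- int N + int j) = hs ! j"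
    by (auto simp: hs_def simp del: upt_Suc)
  have "\<tau> (- int N + int (length L)) = \<tau> (- int N) + int (length (concat L))"
    by (rule decomposition_concat[OF d]) (auto simp: L_def)
  then have tN: "\<tau> (- int N) = - int (o' + length (concat L))"
    using len o' by simp
  \<comment> \<open>The number of letters of \<open>concat hs\<close> left of coordinate -N. The
    subtraction does not truncate, as the N nonempty blocks of L have at least N letters.\<close>
  define k where "k = o' + length (concat L) - N"
  have k: "k + N = o' + length (concat L)" using cL by (simp add: k_def)
  have total: "k + length ?w \<le> length (concat hs)"
    using k cR o'(2) len by (simp add: hs)
  have "take (length ?w) (drop k (concat hs)) = ?w"
  proof (rule nth_equalityI)
    show "length (take (length ?w) (drop k (concat hs))) = length ?w" using total by simp
    fix i assume "i < length (take (length ?w) (drop k (concat hs)))"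
    then have i: "i < 2 * N + 1" using len by simp
    have "x (\<tau> (- int N) + int (k + i)) = concat hs ! (k + i)"
      by (rule decomposition_concat(2)[OF d hsj]) (use i total len in auto)
    moreover have "\<tau> (- int N) + int (k + i) = int i - int N"
      using arg_cong[OF k, of int] unfolding tN by simp
    ultimately have "concat hs ! (k + i) = x (int i - int N)" by (simp only:)
    then show "take (length ?w) (drop k (concat hs)) ! i = ?w ! i"
      using i total len by (simp add: central_word_def del: upt_Suc)
  qed
  then have "concat hs = take k (concat hs) @ ?w @ drop (k + length ?w) (concat hs)"
    by (metis append_take_drop_id drop_drop add.commute)
  moreover have "length (take k (concat hs)) = k" using total by simp
  ultimately have "fits ?w hs o'"
    unfolding fits_def using hs len k o'(2) by metis
  moreover have "x \<in> block_cyl G N hs o'"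
    unfolding block_cyl_def using d o'(1) hsj by (auto simp: algebra_simps)
  ultimately show ?thesis using G by blast
qed

section \<open>Measures of cylinders\<close>

text \<open>Continuity from below along the finite initial parts of an enumeration of T. It turns a
  strict lower bound for a measure into one with a finite witness.\<close>

lemma (in finite_measure) disjoint_countable_approx:
  assumes T: "countable T" and A: "\<And>t. t \<in> T \<Longrightarrow> A t \<in> sets M"
    and disj: "disjoint_family_on A T" and a: "a < measure M (\<Union>t\<in>T. A t)"
  shows "\<exists>E. finite E \<and> E \<subseteq> T \<and> a < (\<Sum>t\<in>E. measure M (A t))"
proof -
  let ?E = "\<lambda>n. to_nat_on T -` {..n} \<inter> T"
  define B where "B n = (\<Union>t\<in>?E n. A t)" for n
  have E: "finite (?E n)" for n
    by (rule finite_vimage_IntI[OF finite_atMost inj_on_to_nat_on[OF T]])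
  have "(\<Union>n. B n) = (\<Union>t\<in>T. A t)" by (auto simp: B_def)
  moreover have "range B \<subseteq> sets M"
    unfolding B_def using A E by (intro subsetI, elim imageE, simp) (intro sets.finite_UN, auto)
  moreover have "incseq B" unfolding B_def by (intro monoI UN_mono) auto
  ultimately have "(\<lambda>n. measure M (B n)) \<longlonglongrightarrow> measure M (\<Union>t\<in>T. A t)"
    using finite_Lim_measure_incseq[of B] by simp
  then have "eventually (\<lambda>n. a < measure M (B n)) sequentially"
    using a by (rule order_tendstoD)
  then obtain n where n: "a < measure M (B n)"
    using eventually_happens'[OF sequentially_bot] by blast
  have "measure M (B n) = (\<Sum>t\<in>?E n. measure M (A t))"
    unfolding B_def
    by (rule finite_measure_finite_Union[OF E])
      (use A disjoint_family_on_mono[OF Int_lower2 disj] in auto)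
  then show ?thesis using n E by (intro exI[of _ "?E n"]) auto
qed

section \<open>Measure of the pieces and full measure of the concatenations\<close>

locale bernoulli_coded_shift =
  fixes d :: nat and G :: "nat list set" and p :: "nat list \<Rightarrow> real" and c :: real
    and \<mu> :: "(int \<Rightarrow> nat) measure"
  assumes gen: "generating_set d G" and uniq: "uniquely_represents G"
    and bernoulli: "bernoulli_measure G p c \<mu>"
begin

abbreviation "X \<equiv> coded_shift G"

lemma ne: "[] \<notin> G"
  using gen by (auto simp: generating_set_def)

lemma p_pos: "h \<in> G \<Longrightarrow> 0 < p h"
  using bernoulli by (auto simp: bernoulli_measure_def)

lemma prob: "prob_space \<mu>" and space_mu: "space \<mu> = X"
  and sets_mu: "sets \<mu> = sets (restrict_space borel X)" and distr_mu: "distr \<mu> \<mu> shift = \<mu>"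
  using bernoulli by (auto simp: bernoulli_measure_def invariant_measure_def)

sublocale prob_space \<mu> by (rule prob)

lemma has_sum_p: "(p has_sum 1) G" and has_sum_c: "((\<lambda>h. real (length h) * p h) has_sum c) G"
  using bernoulli by (auto simp: bernoulli_measure_def)

text \<open>Generators have length at least 1, so c is at least the sum of all p, which is
  1.\<close>

lemma c_pos: "0 < c"
proof -
  have "1 \<le> c"
  proof (rule has_sum_mono[OF has_sum_p has_sum_c])
    fix h assume h: "h \<in> G"
    then have "1 \<le> real (length h)" using ne by (cases h) auto
    then show "p h \<le> real (length h) * p h" using p_pos[OF h] by simp
  qed
  then show ?thesis by simp
qed

lemma measure_G_cylinder:
  "hs \<noteq> [] \<Longrightarrow> set hs \<subseteq> G \<Longrightarrow> prob (G_cylinder G hs) = 1 / c * (\<Prod>h\<leftarrow>hs. p h)"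
  using bernoulli by (auto simp: bernoulli_measure_def)

lemma prod_list_p_pos: "set hs \<subseteq> G \<Longrightarrow> 0 < (\<Prod>h\<leftarrow>hs. p h)"
  by (induction hs) (auto simp: p_pos)

text \<open>\<open>measure\<close> vanishes outside the sigma-algebra, whereas the Bernoulli formula
  gives a positive value; so the formula itself forces measurability.\<close>

lemma sets_G_cylinder:
  assumes "hs \<noteq> []" "set hs \<subseteq> G"
  shows "G_cylinder G hs \<in> sets \<mu>"
proof (rule ccontr)
  assume "\<not> ?thesis"
  then have "prob (G_cylinder G hs) = 0" by (rule measure_notin_sets)
  moreover have "0 < 1 / c * (\<Prod>h\<leftarrow>hs. p h)"
    using c_pos prod_list_p_pos[OF assms(2)] by simp
  ultimately show False using measure_G_cylinder[OF assms] by linarith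
qed

lemma measurable_translate: "translate m \<in> measurable \<mu> \<mu>"
proof -
  have "translate m \<in> measurable (restrict_space borel X) (restrict_space borel X)"
  proof (rule measurable_restrict_space2)
    show "translate m \<in> space (restrict_space borel X) \<rightarrow> X"
      using translate_coded_shift[OF ne] by (auto simp: space_restrict_space)
    show "translate m \<in> borel_measurable (restrict_space borel X)"
      by (rule borel_measurable_continuous_on_restrict[OF continuous_translate])
  qed
  then show ?thesis using measurable_cong_sets[OF sets_mu sets_mu] by blast
qed

lemma measure_translate:
  assumes "A \<in> sets \<mu>"
  shows "prob (translate (int m) -` A \<inter> X) = prob A"
proof (induction m)
  case 0
  have "A \<inter> X = A" using sets.sets_into_space[OF assms] space_mu by auto
  moreover have "translate (int 0) -` A = A" by auto
  ultimately show ?case by simp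
next
  case (Suc m)
  let ?B = "translate (int m) -` A \<inter> X"
  have B: "?B \<in> sets \<mu>" using measurable_sets[OF measurable_translate assms] by (simp add: space_mu)
  have "shift \<in> measurable \<mu> \<mu>" unfolding shift_eq_translate by (rule measurable_translate)
  from measure_distr[OF this B] have "prob ?B = prob (shift -` ?B \<inter> X)"
    unfolding distr_mu space_mu .
  also have "shift -` ?B \<inter> X = translate (int (Suc m)) -` A \<inter> X"
    using translate_coded_shift[OF ne] by (auto simp: shift_eq_translate add.commute)
  finally show ?case using Suc by simp
qed

lemma block_cyl_subset: "block_cyl G N hs o' \<subseteq> X"
  using closure_subset unfolding block_cyl_def coded_shift_def X_con_def by fast

lemma
  assumes N: "N < length hs" and o': "o' < length (hs ! N)" and hs: "set hs \<subseteq> G"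
  shows sets_block_cyl: "block_cyl G N hs o' \<in> sets \<mu>"
    and measure_block_cyl: "prob (block_cyl G N hs o') = 1 / c * (\<Prod>h\<leftarrow>hs. p h)"
proof -
  define m where "m = o' + length (concat (take N hs))"
  note iff = translate_block_cyl_iff[OF N o' ne, of "int m"]
  have hs': "hs \<noteq> []" using N by auto
  have "translate (- int m) -` G_cylinder G hs \<inter> X = block_cyl G N hs o'"
    using block_cyl_subset iff[of "translate (- int m) _"] by (auto simp: m_def)
  then show s: "block_cyl G N hs o' \<in> sets \<mu>"
    using measurable_sets[OF measurable_translate sets_G_cylinder[OF hs' hs], of "- int m"]
    by (simp add: space_mu)
  \<comment> \<open>\<open>measure_translate\<close> speaks of nonnegative translations, so the
    measure is obtained by pulling the piece back to the cylinder, not the cylinder to the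
    piece.\<close>
  have "translate (int m) -` block_cyl G N hs o' \<inter> X = G_cylinder G hs"
    using iff sets.sets_into_space[OF sets_G_cylinder[OF hs' hs]] by (auto simp: m_def space_mu)
  then show "prob (block_cyl G N hs o') = 1 / c * (\<Prod>h\<leftarrow>hs. p h)"
    using measure_translate[OF s, of m] measure_G_cylinder[OF hs' hs] by simp
qed

abbreviation first :: "nat list \<times> nat \<Rightarrow> (int \<Rightarrow> nat) set" where
  "first t \<equiv> block_cyl G 0 [fst t] (snd t)"

lemma X_con_union: "X_con G = (\<Union>t\<in>{(h, o'). h \<in> G \<and> o' < length h}. first t)"
proof (intro equalityI subsetI)
  fix x assume "x \<in> X_con G"
  then obtain \<tau> \<gamma> where d: "decomposition G x (\<tau>, \<gamma>)" unfolding X_con_def by auto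
  have "x \<in> block_cyl G 0 [\<gamma> 0] (nat (- \<tau> 0))"
    unfolding block_cyl_def using d decompositionD(3)[OF d] by auto
  moreover have "\<gamma> 0 \<in> G" "nat (- \<tau> 0) < length (\<gamma> 0)"
    using decompositionD(1,2)[OF d, of 0] decompositionD(3,4)[OF d] by (auto simp: nat_less_iff)
  ultimately show "x \<in> (\<Union>t\<in>{(h, o'). h \<in> G \<and> o' < length h}. first t)"
    by (intro UN_I[of "(\<gamma> 0, nat (- \<tau> 0))"]) auto
qed (auto simp: block_cyl_def X_con_def)

lemma sets_X_con: "X_con G \<in> sets \<mu>"
  unfolding X_con_union
  by (rule sets.countable_UN'') (auto intro!: sets_block_cyl)

text \<open>\<open>X_con\<close> is the disjoint union of the sets \<open>first (h, o')\<close>.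
  Each h contributes |h| offsets of measure p h / c, so the total is c / c = 1; finitely many h
  already give 1 - e.\<close>

lemma measure_X_con: "prob (X_con G) = 1"
proof (rule antisym)
  show "1 \<le> prob (X_con G)"
  proof (rule field_le_epsilon)
    fix e :: real assume e: "0 < e"
    \<comment> \<open>The error is e * c because the sum is divided by c afterwards.\<close>
    obtain F where F: "finite F" "F \<subseteq> G" "dist (\<Sum>h\<in>F. real (length h) * p h) c \<le> e * c"
      using has_sum_finite_approximation[OF has_sum_c, of "e * c"] e c_pos by auto
    let ?I = "SIGMA h:F. {..<length h}"
    have "prob (\<Union>t\<in>?I. first t) = (\<Sum>t\<in>?I. prob (first t))"
    proof (rule finite_measure_finite_Union)
      show "disjoint_family_on first ?I"
        using block_cyl_disjoint[OF uniq, of "[_]" "[_]"] by (fastforce simp: disjoint_family_on_def)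
      show "first ` ?I \<subseteq> sets \<mu>"
        using F by (auto intro!: sets_block_cyl)
    qed (use F in auto)
    also have "\<dots> = (\<Sum>t\<in>?I. 1 / c * p (fst t))"
      using F by (intro sum.cong) (auto simp: measure_block_cyl subset_iff)
    also have "\<dots> = (\<Sum>h\<in>F. \<Sum>o'\<in>{..<length h}. 1 / c * p h)"
      using F by (subst sum.Sigma) (auto simp: case_prod_unfold)
    also have "\<dots> = 1 / c * (\<Sum>h\<in>F. real (length h) * p h)"
      by (simp add: sum_distrib_left algebra_simps)
    also have "\<dots> \<ge> 1 / c * (c - e * c)"
      using F(3) c_pos by (intro mult_left_mono) (auto simp: dist_real_def)
    also have "1 / c * (c - e * c) = 1 - e"
      using c_pos by (simp add: field_simps)
    finally have "1 - e \<le> prob (\<Union>t\<in>?I. first t)" .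
    also have "\<dots> \<le> prob (X_con G)"
      using F by (intro finite_measure_mono sets_X_con) (auto simp: X_con_union)
    finally show "1 \<le> prob (X_con G) + e" by simp
  qed
qed simp

section \<open>Words as disjoint unions of pieces, up to a null set\<close>

definition word_cyl :: "nat \<Rightarrow> nat list \<Rightarrow> (int \<Rightarrow> nat) set" where
  "word_cyl N w = {x \<in> X. central_word N x = w}"

definition patterns :: "nat list \<Rightarrow> (nat list list \<times> nat) set" where
  "patterns w = {(hs, o'). set hs \<subseteq> G \<and> fits w hs o'}"

lemma central_word_eq_iff:
  "central_word N x = central_word N y \<longleftrightarrow> (\<forall>k. \<bar>k\<bar> \<le> int N \<longrightarrow> x k = y k)"
proof
  assume eq: "central_word N x = central_word N y"
  show "\<forall>k. \<bar>k\<bar> \<le> int N \<longrightarrow> x k = y k"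
  proof (intro allI impI)
    fix k assume "\<bar>k\<bar> \<le> int N"
    then have "nat (k + int N) < 2 * N + 1" "int (nat (k + int N)) - int N = k" by auto
    then show "x k = y k"
      using arg_cong[OF eq, of "\<lambda>l. l ! nat (k + int N)"] by (simp add: central_word_def del: upt_Suc)
  qed
qed (auto simp: central_word_def simp del: upt_Suc)

lemma open_central_word: "open {x. central_word N x = w}"
  unfolding open_iff_shift_dist
proof
  fix x assume "x \<in> {x. central_word N x = w}"
  then show "\<exists>e>0. \<forall>y. shift_dist x y < e \<longrightarrow> y \<in> {x. central_word N x = w}"
    by (intro exI[of _ "(1/2) ^ N"]) (simp add: shift_dist_less_iff central_word_eq_iff[symmetric])
qed

lemma sets_word_cyl: "word_cyl N w \<in> sets (restrict_space borel X)"
proof -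
  have "word_cyl N w = X \<inter> {x. central_word N x = w}" by (auto simp: word_cyl_def)
  then show ?thesis using open_central_word[of N w] by (auto simp: sets_restrict_space)
qed

lemma patternsD:
  assumes "(hs, o') \<in> patterns w" and w: "length w = 2 * N + 1"
  shows "N < length hs" "o' < length (hs ! N)" "set hs \<subseteq> G"
proof -
  obtain L h R where "hs = L @ h # R" "length w = 2 * length L + 1" "o' < length h"
    using assms(1) unfolding patterns_def fits_def by blast
  moreover from this have "length L = N" using w by simp
  ultimately show "N < length hs" "o' < length (hs ! N)" by (auto simp: nth_append)
  show "set hs \<subseteq> G" using assms(1) by (simp add: patterns_def)
qed

abbreviation piece :: "nat \<Rightarrow> nat list list \<times> nat \<Rightarrow> (int \<Rightarrow> nat) set" where
  "piece N t \<equiv> block_cyl G N (fst t) (snd t)"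

abbreviation mass :: "nat list list \<times> nat \<Rightarrow> real" where
  "mass t \<equiv> 1 / c * (\<Prod>h\<leftarrow>fst t. p h)"

lemma
  assumes w: "length w = 2 * N + 1" and t: "t \<in> patterns w"
  shows sets_pattern: "piece N t \<in> sets \<mu>"
    and prob_pattern: "prob (piece N t) = mass t"
proof -
  have "(fst t, snd t) \<in> patterns w" using t by simp
  note t = patternsD[OF this w]
  show "piece N t \<in> sets \<mu>"
    "prob (piece N t) = mass t"
    by (rule sets_block_cyl measure_block_cyl; use t in simp)+
qed

lemma disjoint_patterns:
  "disjoint_family_on (piece N) (patterns w)"
  unfolding disjoint_family_on_def
proof (intro ballI impI)
  fix t t' assume t: "t \<in> patterns w" "t' \<in> patterns w" "t \<noteq> t'"
  then have "length (fst t) = length (fst t')"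
    using fits_length by (auto simp: patterns_def)
  then show "piece N t \<inter> piece N t' = {}"
    using block_cyl_disjoint[OF uniq, of "fst t" "fst t'" _ N "snd t" "snd t'"] t(3)
    by (auto simp: prod_eq_iff)
qed

text \<open>Soundness of finite lower bounds: the pieces are disjoint, and each of them reads w
  around coordinate 0.\<close>

lemma sum_patterns_le:
  assumes w: "length w = 2 * N + 1" and E: "finite E" "E \<subseteq> patterns w"
  shows "sum mass E \<le> prob (word_cyl N w)"
proof -
  note s = sets_pattern[OF w subsetD[OF E(2)]] prob_pattern[OF w subsetD[OF E(2)]]
  have "sum mass E = (\<Sum>t\<in>E. prob (piece N t))"
    using s by simp
  also have "\<dots> = prob (\<Union>t\<in>E. piece N t)"
    by (rule finite_measure_finite_Union[symmetric])
      (use E s disjoint_family_on_mono[OF E(2) disjoint_patterns] in auto)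
  also have "\<dots> \<le> prob (word_cyl N w)"
  proof (rule finite_measure_mono)
    show "(\<Union>t\<in>E. piece N t) \<subseteq> word_cyl N w"
    proof
      fix x assume "x \<in> (\<Union>t\<in>E. piece N t)"
      then obtain t where t: "t \<in> E" "x \<in> piece N t" by blast
      then have "fits w (fst t) (snd t)" using E by (auto simp: patterns_def)
      from fits_block_cyl[OF w this t(2)] show "x \<in> word_cyl N w"
        using block_cyl_subset t(2) by (auto simp: word_cyl_def)
    qed
  qed (use sets_word_cyl sets_mu in auto)
  finally show ?thesis .
qed

text \<open>Completeness of finite lower bounds: \<open>X_con\<close> has full measure, and its part
  inside the word is covered by countably many pieces, of which finitely many already exceed
  a.\<close>

lemma patterns_approx:
  assumes w: "length w = 2 * N + 1" and a: "a < prob (word_cyl N w)"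
  shows "\<exists>E. finite E \<and> E \<subseteq> patterns w \<and> a < sum mass E"
proof -
  note s = sets_pattern[OF w] prob_pattern[OF w]
  have W: "word_cyl N w \<in> sets \<mu>" using sets_word_cyl sets_mu by auto
  have "a < prob (word_cyl N w \<inter> X_con G)"
    using a measure_space_inter[OF W sets_X_con] by (simp add: measure_X_con prob_space)
  also have "\<dots> \<le> prob (\<Union>t\<in>patterns w. piece N t)"
  proof (rule finite_measure_mono)
    show "word_cyl N w \<inter> X_con G \<subseteq> (\<Union>t\<in>patterns w. piece N t)"
    proof
      fix x assume x: "x \<in> word_cyl N w \<inter> X_con G"
      obtain hs o' where "set hs \<subseteq> G" "fits (central_word N x) hs o'" "x \<in> block_cyl G N hs o'"
        using block_cyl_cover[OF _ ne, of x N] x by blast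
      then show "x \<in> (\<Union>t\<in>patterns w. piece N t)"
        using x by (intro UN_I[of "(hs, o')"]) (auto simp: word_cyl_def patterns_def)
    qed
    show "(\<Union>t\<in>patterns w. piece N t) \<in> sets \<mu>"
      by (rule sets.countable_UN'') (auto intro: s)
  qed
  finally have "a < prob (\<Union>t\<in>patterns w. piece N t)" .
  from disjoint_countable_approx[OF countableI_type s(1) disjoint_patterns this]
  obtain E where "finite E" "E \<subseteq> patterns w"
    "a < (\<Sum>t\<in>E. prob (piece N t))"
    by blast
  moreover from this have "(\<Sum>t\<in>E. prob (piece N t)) = sum mass E"
    by (intro sum.cong refl s(2)) auto
  ultimately show ?thesis by metis
qed

end

section \<open>Ideal measures and the transport distance\<close>

lemma sum_list_ennreal_indicator:
  "(\<Sum>(i, a, b)\<leftarrow>L. ennreal (real a / real b) * indicator A (s i)) =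
   ennreal (\<Sum>(i, a, b)\<leftarrow>(L :: (nat \<times> nat \<times> nat) list). real a / real b * indicator A (s i))"
proof (induction L)
  case (Cons t L)
  obtain i a b where "t = (i, a, b)" using prod_cases3 by blast
  moreover have "0 \<le> (\<Sum>(i, a, b)\<leftarrow>L. real a / real b * indicator A (s i))"
    by (rule sum_list_nonneg) auto
  ultimately show ?case using Cons by (cases "s i \<in> A") (simp_all add: ennreal_plus)
qed simp

lemma
  fixes s :: "nat \<Rightarrow> int \<Rightarrow> nat"
  shows sets_ideal_measure: "sets (ideal_measure X s L) = sets (restrict_space borel X)"
    and space_ideal_measure: "space (ideal_measure X s L) = X"
    and measure_ideal_measure: "A \<in> sets (restrict_space borel X) \<Longrightarrow>
      measure (ideal_measure X s L) A = (\<Sum>(i, a, b)\<leftarrow>L. real a / real b * indicator A (s i))"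
    and prob_space_ideal_measure: "ideal_code L \<Longrightarrow> s ` {1..} \<subseteq> X \<Longrightarrow> prob_space (ideal_measure X s L)"
proof -
  let ?M = "sets (restrict_space (borel :: (int \<Rightarrow> nat) measure) X)"
  let ?f = "\<lambda>A. \<Sum>(i, a, b)\<leftarrow>L. ennreal (real a / real b) * indicator A (s i)"
  interpret sigma_algebra X ?M
    using sets.sigma_algebra_axioms[of "restrict_space (borel :: (int \<Rightarrow> nat) measure) X"]
    by (simp add: space_restrict_space)
  show sets: "sets (ideal_measure X s L) = ?M"
    unfolding ideal_measure_def by (rule sets_measure_of_eq)
  show space: "space (ideal_measure X s L) = X"
    unfolding ideal_measure_def by (rule space_measure_of_eq)
  have "positive ?M ?f" by (auto simp: positive_def case_prod_unfold)
  moreover have "countably_additive ?M ?f"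
    unfolding countably_additive_def
  proof (intro allI impI)
    fix A :: "nat \<Rightarrow> (int \<Rightarrow> nat) set" assume disj: "disjoint_family A"
    show "(\<Sum>n. ?f (A n)) = ?f (\<Union>n. A n)"
    proof (induction L)
      case (Cons t L)
      obtain i a b where t: "t = (i, a, b)" using prod_cases3 by blast
      have "(\<Sum>n. ennreal (real a / real b) * indicator (A n) (s i)) =
          ennreal (real a / real b) * indicator (\<Union>n. A n) (s i)"
        using suminf_indicator[OF disj, of "s i"] by simp
      then show ?case
        using Cons by (simp add: t suminf_add[symmetric])
    qed simp
  qed
  ultimately have f: "emeasure (ideal_measure X s L) A = ?f A" if "A \<in> ?M" for A
    unfolding ideal_measure_def using that
    by (intro emeasure_measure_of_sigma sigma_algebra_axioms)
  have nn: "0 \<le> (\<Sum>(i, a, b)\<leftarrow>L. real a / real b * indicator A (s i))" for A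
    by (rule sum_list_nonneg) auto
  show "measure (ideal_measure X s L) A = (\<Sum>(i, a, b)\<leftarrow>L. real a / real b * indicator A (s i))"
    if "A \<in> ?M"
    unfolding measure_def f[OF that] sum_list_ennreal_indicator using nn by simp
  show "prob_space (ideal_measure X s L)" if L: "ideal_code L" and s: "s ` {1..} \<subseteq> X"
  proof
    have "?f X = ennreal (\<Sum>(i, a, b)\<leftarrow>L. real a / real b * indicator X (s i))"
      by (rule sum_list_ennreal_indicator)
    also have "(\<Sum>(i, a, b)\<leftarrow>L. real a / real b * indicator X (s i)) = (\<Sum>(i, a, b)\<leftarrow>L. real a / real b)"
    proof (rule arg_cong[where f = sum_list], rule map_cong[OF refl])
      fix t assume "t \<in> set L"
      then have "fst t \<ge> 1" using L by (auto simp: ideal_code_def)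
      then have "s (fst t) \<in> X" using s by auto
      then show "(case t of (i, a, b) \<Rightarrow> real a / real b * indicator X (s i)) = (case t of (i, a, b) \<Rightarrow> real a / real b)"
        by (auto simp: case_prod_unfold)
    qed
    finally show "emeasure (ideal_measure X s L) (space (ideal_measure X s L)) = 1"
      using f[OF top] L by (simp add: space ideal_code_def)
  qed
qed

section \<open>Transport distance bounded through common mass on words\<close>

context bernoulli_coded_shift
begin

lemma shift_dist_le_1: "shift_dist x y \<le> 1"
  by (auto simp: shift_dist_def power_le_one)

abbreviation lipschitz :: "((int \<Rightarrow> nat) \<Rightarrow> real) \<Rightarrow> bool" where
  "lipschitz f \<equiv> \<forall>x\<in>X. \<forall>y\<in>X. \<bar>f x - f y\<bar> \<le> shift_dist x y"

text \<open>The functions in \<open>W1\<close> are arbitrary off X and not assumed measurable. As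
  the metric induces the product topology, they are continuous on X.\<close>

lemma lipschitz_measurable:
  assumes "lipschitz f"
  shows "f \<in> borel_measurable (restrict_space borel X)"
proof (rule borel_measurable_continuous_on_restrict)
  show "continuous_on X f"
    unfolding continuous_on_topological
  proof (intro ballI allI impI)
    fix x B assume x: "x \<in> X" and B: "open B" "f x \<in> B"
    then obtain e where e: "0 < e" "ball (f x) e \<subseteq> B" using open_contains_ball by blast
    obtain N where N: "(1/2) ^ N < e" using real_arch_pow_inv[OF e(1), of "1/2"] by auto
    have "f y \<in> B" if "y \<in> X" "central_word N y = central_word N x" for y
    proof -
      have "shift_dist x y < (1/2) ^ N"
        using that(2) by (simp add: shift_dist_less_iff central_word_eq_iff)
      then have "\<bar>f x - f y\<bar> < e" using assms x that(1) N by (meson le_less_trans less_trans)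
      then show ?thesis using e(2) by (auto simp: dist_real_def)
    qed
    then show "\<exists>A. open A \<and> x \<in> A \<and> (\<forall>y\<in>X. y \<in> A \<longrightarrow> f y \<in> B)"
      by (intro exI[of _ "{y. central_word N y = central_word N x}"]) (auto simp: open_central_word)
  qed
qed

text \<open>On a word cylinder h differs from its value at the sample point \<open>y w\<close> by
  less than 2^-N, so a step function with values \<open>h (y w) - (1/2) ^ N\<close> lies below
  h.\<close>

lemma integral_lower_bound:
  assumes prob: "prob_space \<kappa>" and space: "space \<kappa> = X" and sets: "sets \<kappa> = sets (restrict_space borel X)"
    and h: "lipschitz h" and h01: "\<And>x. x \<in> X \<Longrightarrow> 0 \<le> h x \<and> h x \<le> 1"
    and F: "finite F" and \<alpha>: "\<And>w. w \<in> F \<Longrightarrow> 0 \<le> \<alpha> w \<and> \<alpha> w \<le> measure \<kappa> (word_cyl N w)"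
    and y: "\<And>w. word_cyl N w \<noteq> {} \<Longrightarrow> y w \<in> word_cyl N w"
  shows "integrable \<kappa> h" and "(\<Sum>w\<in>F. \<alpha> w * (h (y w) - (1/2) ^ N)) \<le> (\<integral>x. h x \<partial>\<kappa>)"
proof -
  interpret \<kappa>: prob_space \<kappa> by fact
  have meas: "h \<in> borel_measurable \<kappa>"
    using lipschitz_measurable[OF h] measurable_cong_sets[OF sets refl] by blast
  show int: "integrable \<kappa> h"
    by (rule \<kappa>.integrable_const_bound[of _ 1]) (use meas h01 space in auto)
  \<comment> \<open>The positive part: with nonnegative values the sum does not decrease when
    \<alpha> w is replaced by the measure of the cylinder, and the step function stays below h
    because h is nonnegative.\<close>
  define u where "u w = max 0 (h (y w) - (1/2) ^ N)" for w
  let ?g = "\<lambda>x. \<Sum>w\<in>F. u w * indicator (word_cyl N w) x"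
  have W: "word_cyl N w \<in> sets \<kappa>" for w using sets_word_cyl sets by simp
  have "(\<Sum>w\<in>F. \<alpha> w * (h (y w) - (1/2) ^ N)) \<le> (\<Sum>w\<in>F. u w * measure \<kappa> (word_cyl N w))"
  proof (rule sum_mono)
    fix w assume w: "w \<in> F"
    have "\<alpha> w * (h (y w) - (1/2) ^ N) \<le> \<alpha> w * u w"
      using \<alpha>[OF w] by (intro mult_left_mono) (auto simp: u_def)
    also have "\<dots> \<le> measure \<kappa> (word_cyl N w) * u w"
      using \<alpha>[OF w] by (intro mult_right_mono) (auto simp: u_def)
    finally show "\<alpha> w * (h (y w) - (1/2) ^ N) \<le> u w * measure \<kappa> (word_cyl N w)"
      by (simp add: mult.commute)
  qed
  also have "\<dots> = (\<integral>x. ?g x \<partial>\<kappa>)"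
    using W by (subst Bochner_Integration.integral_sum) (auto simp: \<kappa>.emeasure_eq_measure)
  also have "\<dots> \<le> (\<integral>x. h x \<partial>\<kappa>)"
  proof (rule integral_mono[OF _ int])
    show "integrable \<kappa> ?g" using W by (auto simp: \<kappa>.emeasure_eq_measure)
    fix x assume "x \<in> space \<kappa>"
    then have x: "x \<in> X" by (simp add: space)
    let ?w = "central_word N x"
    have xw: "x \<in> word_cyl N ?w" using x by (simp add: word_cyl_def)
    have "?g x = (\<Sum>w\<in>F. if w = ?w then u w else 0)"
      using x by (intro sum.cong) (auto simp: word_cyl_def)
    also have "\<dots> \<le> u ?w" using F by (simp add: u_def)
    also have "\<dots> \<le> h x"
    proof -
      have yw: "y ?w \<in> word_cyl N ?w" using y xw by blast
      then have "y ?w \<in> X" "central_word N (y ?w) = ?w" by (auto simp: word_cyl_def)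
      then have "\<bar>h (y ?w) - h x\<bar> < (1/2) ^ N"
        using h x shift_dist_less_iff[of "y ?w" x N] central_word_eq_iff[of N "y ?w" x] by fastforce
      then show ?thesis using h01[OF x] by (simp add: u_def)
    qed
    finally show "?g x \<le> h x" .
  qed
  finally show "(\<Sum>w\<in>F. \<alpha> w * (h (y w) - (1/2) ^ N)) \<le> (\<integral>x. h x \<partial>\<kappa>)" .
qed

text \<open>The lower bound is applied to h under \<rho> and to 1 - h under \<kappa>. When the two
  are added the sample values cancel, and the total of \<alpha> remains up to an error of at most 2
  * 2^-N.\<close>

lemma integral_difference_bound:
  assumes \<kappa>: "prob_space \<kappa>" "space \<kappa> = X" "sets \<kappa> = sets (restrict_space borel X)"
    and \<rho>: "prob_space \<rho>" "space \<rho> = X" "sets \<rho> = sets (restrict_space borel X)"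
    and F: "finite F" and \<alpha>: "\<And>w. w \<in> F \<Longrightarrow> 0 \<le> \<alpha> w"
    and \<alpha>\<kappa>: "\<And>w. w \<in> F \<Longrightarrow> \<alpha> w \<le> measure \<kappa> (word_cyl N w)"
    and \<alpha>\<rho>: "\<And>w. w \<in> F \<Longrightarrow> \<alpha> w \<le> measure \<rho> (word_cyl N w)"
    and f: "lipschitz f"
  shows "(\<integral>x. f x \<partial>\<kappa>) - (\<integral>x. f x \<partial>\<rho>) \<le> 1 - (\<Sum>w\<in>F. \<alpha> w) + 2 * (1/2) ^ N"
proof -
  interpret \<kappa>: prob_space \<kappa> by fact
  interpret \<rho>: prob_space \<rho> by fact
  obtain x0 where x0: "x0 \<in> X" using \<kappa>.not_empty \<kappa>(2) by auto
  have diff: "f x - f y \<le> 1" if "x \<in> X" "y \<in> X" for x y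
    using f that shift_dist_le_1[of x y] by (smt (verit))
  have bdd: "bdd_below (f ` X)"
    by (rule bdd_belowI[of _ "f x0 - 1"]) (use diff[OF x0] in fastforce)
  \<comment> \<open>Subtracting the infimum brings f into [0, 1], as X has diameter at most 1;
    differences of integrals do not change.\<close>
  define m where "m = Inf (f ` X)"
  define h where "h x = f x - m" for x
  have h01: "0 \<le> h x \<and> h x \<le> 1" if "x \<in> X" for x
  proof
    show "0 \<le> h x" using cInf_lower[OF imageI[OF that] bdd] by (simp add: h_def m_def)
    have "f x - 1 \<le> m"
      unfolding m_def by (rule cInf_greatest) (use that diff[OF that] in fastforce)+
    then show "h x \<le> 1" by (simp add: h_def)
  qed
  have h: "lipschitz h" "lipschitz (\<lambda>x. 1 - h x)"
    using f by (auto simp: h_def abs_minus_commute)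
  define y where "y w = (SOME x. x \<in> word_cyl N w)" for w
  have y: "\<And>w. word_cyl N w \<noteq> {} \<Longrightarrow> y w \<in> word_cyl N w"
    by (simp add: y_def some_in_eq)
  have 1: "integrable \<rho> h" "(\<Sum>w\<in>F. \<alpha> w * (h (y w) - (1/2) ^ N)) \<le> (\<integral>x. h x \<partial>\<rho>)"
    using integral_lower_bound[OF \<rho> h(1) h01 F _ y, of \<alpha>] \<alpha> \<alpha>\<rho> by auto
  have 2: "integrable \<kappa> (\<lambda>x. 1 - h x)"
      "(\<Sum>w\<in>F. \<alpha> w * (1 - h (y w) - (1/2) ^ N)) \<le> (\<integral>x. 1 - h x \<partial>\<kappa>)"
    using integral_lower_bound[OF \<kappa> h(2) _ F _ y, of \<alpha>] h01 \<alpha> \<alpha>\<kappa> by auto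
  have ik: "integrable \<kappa> h"
    using integral_lower_bound(1)[OF \<kappa> h(1) h01 F _ y, of \<alpha>] \<alpha> \<alpha>\<kappa> by auto
  have "(\<integral>x. 1 - h x \<partial>\<kappa>) = 1 - (\<integral>x. h x \<partial>\<kappa>)"
    using ik by (simp add: \<kappa>.prob_space)
  moreover have "(\<Sum>w\<in>F. \<alpha> w * (h (y w) - (1/2) ^ N)) + (\<Sum>w\<in>F. \<alpha> w * (1 - h (y w) - (1/2) ^ N)) =
      (\<Sum>w\<in>F. \<alpha> w) - (\<Sum>w\<in>F. \<alpha> w) * (2 * (1/2) ^ N)"
    unfolding sum.distrib[symmetric] sum_distrib_right sum_subtractf[symmetric]
    by (rule sum.cong) (auto simp: algebra_simps)
  moreover have "(\<Sum>w\<in>F. \<alpha> w) * (2 * (1/2) ^ N) \<le> 1 * (2 * (1/2) ^ N)"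
  proof (rule mult_right_mono)
    have "(\<Sum>w\<in>F. \<alpha> w) \<le> (\<Sum>w\<in>F. measure \<kappa> (word_cyl N w))" by (rule sum_mono[OF \<alpha>\<kappa>])
    also have "\<dots> = measure \<kappa> (\<Union>w\<in>F. word_cyl N w)"
      by (rule \<kappa>.finite_measure_finite_Union[symmetric])
        (use F \<kappa> sets_word_cyl in \<open>auto simp: disjoint_family_on_def word_cyl_def\<close>)
    finally show "(\<Sum>w\<in>F. \<alpha> w) \<le> 1" using \<kappa>.prob_le_1 by (meson order_trans)
  qed simp
  ultimately have "(\<integral>x. h x \<partial>\<kappa>) - (\<integral>x. h x \<partial>\<rho>) \<le> 1 - (\<Sum>w\<in>F. \<alpha> w) + 2 * (1/2) ^ N"
    using 1(2) 2(2) by linarith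
  moreover have "(\<integral>x. f x \<partial>\<kappa>) = (\<integral>x. h x \<partial>\<kappa>) + m" "(\<integral>x. f x \<partial>\<rho>) = (\<integral>x. h x \<partial>\<rho>) + m"
  proof -
    have "(\<integral>x. h x + m \<partial>\<kappa>) = (\<integral>x. h x \<partial>\<kappa>) + m" "(\<integral>x. h x + m \<partial>\<rho>) = (\<integral>x. h x \<partial>\<rho>) + m"
      using ik 1(1) by (simp_all add: \<kappa>.prob_space \<rho>.prob_space)
    then show "(\<integral>x. f x \<partial>\<kappa>) = (\<integral>x. h x \<partial>\<kappa>) + m" "(\<integral>x. f x \<partial>\<rho>) = (\<integral>x. h x \<partial>\<rho>) + m"
      by (simp_all add: h_def)
  qed
  ultimately show ?thesis by simp
qed

lemma W1_le:
  assumes \<rho>: "prob_space \<rho>" "space \<rho> = X" "sets \<rho> = sets (restrict_space borel X)"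
    and F: "finite F" and \<alpha>: "\<And>w. w \<in> F \<Longrightarrow> 0 \<le> \<alpha> w"
    and \<alpha>\<mu>: "\<And>w. w \<in> F \<Longrightarrow> \<alpha> w \<le> prob (word_cyl N w)"
    and \<alpha>\<rho>: "\<And>w. w \<in> F \<Longrightarrow> \<alpha> w \<le> measure \<rho> (word_cyl N w)"
  shows "W1 X \<mu> \<rho> \<le> 1 - (\<Sum>w\<in>F. \<alpha> w) + 2 * (1/2) ^ N"
  unfolding W1_def
proof (rule cSUP_least)
  show "{f :: (int \<Rightarrow> nat) \<Rightarrow> real. lipschitz f} \<noteq> {}"
    by (auto simp: shift_dist_def intro!: exI[of _ "\<lambda>_. 0"])
  fix f assume "f \<in> {f :: (int \<Rightarrow> nat) \<Rightarrow> real. lipschitz f}"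
  then have f: "lipschitz f" by simp
  show "\<bar>(\<integral>x. f x \<partial>\<mu>) - (\<integral>x. f x \<partial>\<rho>)\<bar> \<le> 1 - (\<Sum>w\<in>F. \<alpha> w) + 2 * (1/2) ^ N"
    using integral_difference_bound[OF prob space_mu sets_mu \<rho> F \<alpha> \<alpha>\<mu> \<alpha>\<rho> f]
      integral_difference_bound[OF \<rho> prob space_mu sets_mu F \<alpha> \<alpha>\<rho> \<alpha>\<mu> f] by linarith
qed

text \<open>This guarantees that the search succeeds: word masses are rounded down to multiples of 1
  / D and placed on ideal points inside the words.\<close>

lemma ideal_measure_approx:
  assumes s: "s ` {1..} \<subseteq> X" "X \<subseteq> closure (s ` {1..})" and e: "0 < (e :: real)"
  shows "\<exists>F a D L. distinct F \<and> 0 < D \<and> ideal_code L \<and> (1 - e) * real D \<le> real (\<Sum>w\<leftarrow>F. a w) \<and>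
    (\<forall>w\<in>set F. length w = 2 * N + 1 \<and> real (a w) / real D < prob (word_cyl N w) \<and>
      real (a w) / real D \<le> measure (ideal_measure X s L) (word_cyl N w))"
proof -
  have W: "word_cyl N w \<in> sets \<mu>" for w using sets_word_cyl sets_mu by simp
  have disj: "disjoint_family_on (word_cyl N) T" for T
    by (auto simp: disjoint_family_on_def word_cyl_def)
  let ?T = "{w. length w = 2 * N + 1}"
  have "(\<Union>w\<in>?T. word_cyl N w) = X"
    by (auto simp: word_cyl_def central_word_def)
  \<comment> \<open>One half of e pays for the words left out of E, the other half for
    rounding.\<close>
  then have "1 - e / 2 < prob (\<Union>w\<in>?T. word_cyl N w)"
    using e prob_space space_mu by simp
  from disjoint_countable_approx[OF countableI_type W disj this]
  obtain E where E: "finite E" "E \<subseteq> ?T" "1 - e / 2 < (\<Sum>w\<in>E. prob (word_cyl N w))" by blast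
  \<comment> \<open>Rounding loses at most 1 / D for each word of E; this D keeps the total loss at
    most e / 2.\<close>
  define D where "D = nat \<lceil>2 * real (card E) / e\<rceil> + 1"
  have D: "0 < D" "real (card E) \<le> e / 2 * real D"
  proof -
    have "2 * real (card E) / e \<le> real D" unfolding D_def by linarith
    then show "real (card E) \<le> e / 2 * real D" using e by (simp add: field_simps)
  qed (simp add: D_def)
  \<comment> \<open>Ceiling minus 1 instead of floor, because the bound has to be strict even where
    the mass is a multiple of 1 / D.\<close>
  define a where "a w = nat \<lceil>prob (word_cyl N w) * real D\<rceil> - 1" for w
  \<comment> \<open>Words with a w = 0 are dropped: ideal codes need positive weights, and the
    strict bound would fail for words of mass 0.\<close>
  obtain F where F: "set F = {w \<in> E. 0 < a w}" "distinct F"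
    using finite_distinct_list[of "{w \<in> E. 0 < a w}"] E(1) by auto
  have a1: "real (a w) < prob (word_cyl N w) * real D" if "0 < a w" for w
    using that unfolding a_def by linarith
  have a2: "prob (word_cyl N w) * real D - 1 \<le> real (a w)" for w
    unfolding a_def by linarith
  have sum_F: "(\<Sum>w\<leftarrow>F. a w) = (\<Sum>w\<in>E. a w)"
    using E(1) F by (simp add: sum_list_distinct_conv_sum_set) (intro sum.mono_neutral_left, auto)
  have "(1 - e) * real D \<le> (\<Sum>w\<in>E. prob (word_cyl N w)) * real D - real (card E)"
    using mult_right_mono[OF less_imp_le[OF E(3)], of "real D"] D by (simp add: algebra_simps)
  also have "\<dots> = (\<Sum>w\<in>E. prob (word_cyl N w) * real D - 1)"
    by (simp add: sum_subtractf sum_distrib_right)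
  also have "\<dots> \<le> (\<Sum>w\<in>E. real (a w))" by (rule sum_mono[OF a2])
  finally have large: "(1 - e) * real D \<le> real (\<Sum>w\<leftarrow>F. a w)" by (simp add: sum_F)
  \<comment> \<open>Strictness leaves a positive weight for the first entry of L below.\<close>
  have small: "(\<Sum>w\<leftarrow>F. a w) < D"
  proof (cases "F = []")
    case False
    have "real (\<Sum>w\<leftarrow>F. a w) = (\<Sum>w\<in>set F. real (a w))"
      using F by (simp add: sum_list_distinct_conv_sum_set)
    also have "\<dots> < (\<Sum>w\<in>set F. prob (word_cyl N w) * real D)"
    proof (rule sum_strict_mono)
      fix w assume "w \<in> set F"
      then have "0 < a w" by (simp add: F)
      then show "real (a w) < prob (word_cyl N w) * real D" by (rule a1)
    qed (use False in simp_all)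
    also have "\<dots> = prob (\<Union>w\<in>set F. word_cyl N w) * real D"
      using W disj by (subst finite_measure_finite_Union) (auto simp: sum_distrib_right)
    also have "\<dots> \<le> 1 * real D" by (intro mult_right_mono) auto
    finally show ?thesis by simp
  qed (use D in simp)
  have "\<exists>i\<ge>1. s i \<in> word_cyl N w" if "w \<in> set F" for w
  proof -
    have "0 < prob (word_cyl N w)"
      using a1[of w] that F D by (smt (verit) mem_Collect_eq mult_nonneg_nonneg of_nat_0_le_iff measure_nonneg mult_eq_0_iff)
    then have "word_cyl N w \<noteq> {}" by auto
    then obtain x where x: "x \<in> X" "central_word N x = w" by (auto simp: word_cyl_def)
    \<comment> \<open>The cylinder is open and meets X, so by density it contains an ideal
      point.\<close>
    then have "{x. central_word N x = w} \<inter> s ` {1..} \<noteq> {}"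
      using s(2) open_central_word[of N w] open_Int_closure_eq_empty[of "{x. central_word N x = w}" "s ` {1..}"] by blast
    then show ?thesis using s(1) by (fastforce simp: word_cyl_def)
  qed
  then obtain j where j: "\<And>w. w \<in> set F \<Longrightarrow> 1 \<le> j w \<and> s (j w) \<in> word_cyl N w" by metis
  define L where "L = (1, D - (\<Sum>w\<leftarrow>F. a w), D) # map (\<lambda>w. (j w, a w, D)) F"
  have "(\<Sum>w\<leftarrow>F. real (a w) / real D) = real (\<Sum>w\<leftarrow>F. a w) / real D"
    by (induction F) (auto simp: add_divide_distrib)
  then have "(\<Sum>(i, a, b)\<leftarrow>L. real a / real b) = 1"
    using small D by (simp add: L_def comp_def of_nat_diff field_simps)
  then have L: "ideal_code L"
    using small D j F by (auto simp: ideal_code_def L_def)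
  have "real (a w) / real D \<le> measure (ideal_measure X s L) (word_cyl N w)" if w: "w \<in> set F" for w
  proof -
    let ?g = "\<lambda>(i, a, b). real a / real b * indicator (word_cyl N w) (s i)"
    have "?g (j w, a w, D) \<le> sum_list (map ?g L)"
      by (rule member_le_sum_list) (use w in \<open>auto simp: L_def\<close>)
    then show ?thesis
      using j[OF w] by (simp add: measure_ideal_measure[OF sets_word_cyl])
  qed
  moreover have "length w = 2 * N + 1" "real (a w) / real D < prob (word_cyl N w)" if "w \<in> set F" for w
    using that F E(2) a1[of w] D by (auto simp: field_simps)
  ultimately show ?thesis
    using F(2) D(1) L large by (intro exI[of _ F] exI[of _ a] exI[of _ D] exI[of _ L]) auto
qed

end

section \<open>Approximation by fractions with a common denominator\<close>

text \<open>Ceiling minus 1 here and floor plus 1 in \<open>upper_num\<close> keep the bounds strict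
  even when x * D is an integer; the error stays at most 1 / D after division.\<close>

definition lower_num :: "nat \<Rightarrow> real \<Rightarrow> nat" where
  "lower_num D x = nat \<lceil>x * real D\<rceil> - 1"

definition upper_num :: "nat \<Rightarrow> real \<Rightarrow> nat" where
  "upper_num D x = nat \<lfloor>x * real D\<rfloor> + 1"

lemma lower_num_less: "0 < x \<Longrightarrow> 0 < D \<Longrightarrow> real (lower_num D x) / real D < x"
proof -
  assume "0 < x" "0 < D"
  then have "0 < x * real D" by simp
  then have "real (lower_num D x) < x * real D" unfolding lower_num_def by linarith
  then show ?thesis using \<open>0 < D\<close> by (simp add: field_simps)
qed

lemma upper_num_greater: "0 < D \<Longrightarrow> x < real (upper_num D x) / real D"
proof -
  assume "0 < D"
  have "x * real D < real (upper_num D x)" unfolding upper_num_def by linarith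
  then show ?thesis using \<open>0 < D\<close> by (simp add: field_simps)
qed

lemma tendsto_common_denominator:
  assumes "\<And>D. 0 < D \<Longrightarrow> \<bar>real (f D) - x * real D\<bar> \<le> 1"
  shows "(\<lambda>D. real (f D) / real D) \<longlonglongrightarrow> x"
proof -
  have bound: "\<bar>real (f D) / real D - x\<bar> \<le> 1 / real D" if D: "0 < D" for D
  proof -
    have "real (f D) / real D - x = (real (f D) - x * real D) / real D" using D by (simp add: field_simps)
    then show ?thesis using assms[OF D] D by (simp add: divide_right_mono)
  qed
  have "(\<lambda>D. \<bar>real (f D) / real D - x\<bar>) \<longlonglongrightarrow> 0"
  proof (rule tendsto_sandwich[OF _ _ tendsto_const lim_1_over_n])
    show "eventually (\<lambda>D. \<bar>real (f D) / real D - x\<bar> \<le> 1 / real D) sequentially"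
      by (rule eventually_mono[OF eventually_gt_at_top[of 0] bound])
  qed simp
  then have "(\<lambda>D. real (f D) / real D - x) \<longlonglongrightarrow> 0" by (rule tendsto_rabs_zero_cancel)
  then show ?thesis by (simp add: LIM_zero_iff)
qed

lemma tendsto_lower_num: "0 < x \<Longrightarrow> (\<lambda>D. real (lower_num D x) / real D) \<longlonglongrightarrow> x"
proof (rule tendsto_common_denominator)
  fix D :: nat assume "0 < x" "0 < D"
  then have "0 < x * real D" by simp
  then show "\<bar>real (lower_num D x) - x * real D\<bar> \<le> 1" unfolding lower_num_def by linarith
qed

lemma tendsto_upper_num: "0 < x \<Longrightarrow> (\<lambda>D. real (upper_num D x) / real D) \<longlonglongrightarrow> x"
proof (rule tendsto_common_denominator)
  fix D :: nat assume "0 < x" "0 < D"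
  then have "0 < x * real D" by simp
  then show "\<bar>real (upper_num D x) - x * real D\<bar> \<le> 1" unfolding upper_num_def by linarith
qed

section \<open>The measure of a word is semicomputable from below\<close>

lemma real_fraction_le_iff:
  fixes D q T :: real
  assumes "0 < D" "0 < q" "0 < T"
  shows "a * q * T + D * q + B * D * T \<le> A * D * T + b * q * T \<longleftrightarrow> (a - b) / D + 1 / T \<le> (A - B) / q"
proof -
  have "(A - B) / q - ((a - b) / D + 1 / T) =
      (A * D * T + b * q * T - (a * q * T + D * q + B * D * T)) / (q * D * T)"
    using assms by (simp add: field_simps)
  moreover have "0 < q * D * T" using assms by simp
  ultimately show ?thesis
    by (smt (verit) divide_nonneg_pos divide_neg_pos)
qed

text \<open>Subtracted terms are moved to the other side, so the comparison becomes a decidable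
  inequality of natural numbers although a - b and A - B may be negative.\<close>

lemma fraction_le_iff:
  assumes "0 < D" "0 < q"
  shows "a * q * 2 ^ n + D * q + B * D * 2 ^ n \<le> A * D * 2 ^ n + b * q * 2 ^ n \<longleftrightarrow>
    (real a - real b) / real D + (1/2) ^ n \<le> (real A - real B) / real q"
  using real_fraction_le_iff[of "real D" "real q" "2 ^ n" "real a" "real B" "real A" "real b"] assms
  unfolding of_nat_le_iff[where 'a = real, symmetric] by (simp add: power_one_over)

lemma half_power_less: "0 < (e :: real) \<Longrightarrow> \<exists>n\<ge>1. (1/2) ^ n < e"
proof -
  assume e: "0 < e"
  obtain n where "(1/2) ^ n < e" using real_arch_pow_inv[OF e, of "1/2"] by auto
  moreover have "(1/2 :: real) ^ Suc n \<le> (1/2) ^ n" by simp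
  ultimately have "(1/2) ^ Suc n < e" by linarith
  then show ?thesis by (intro exI[of _ "Suc n"] conjI) simp_all
qed

text \<open>A fraction lies below r i iff some approximation of accuracy 2^-n exceeds it by at least
  2^-n. A is a relation so that it can be the output relation of a machine.\<close>

lemma re_approximable_above:
  fixes r :: "nat \<Rightarrow> real"
  assumes A: "\<And>n i. 1 \<le> n \<Longrightarrow> 1 \<le> i \<Longrightarrow> \<exists>a b q. q > 0 \<and> A n i a b q"
    and sound: "\<And>n i a b q. 1 \<le> n \<Longrightarrow> 1 \<le> i \<Longrightarrow> A n i a b q \<Longrightarrow>
      \<bar>(real a - real b) / real q - r i\<bar> < (1/2) ^ n"
    and re: "re orc (\<lambda>(n, i, a, b, q). A n i a b q)"
  shows "re orc (\<lambda>(i, a, b, D). 1 \<le> i \<and> 0 < D \<and> (real a - real b) / real D < r i)"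
proof -
  have "1 \<le> i \<and> 0 < D \<and> (real a - real b) / real D < r i \<longleftrightarrow> 1 \<le> i \<and> 0 < D \<and>
      (\<exists>n a' b' q. 1 \<le> n \<and> 0 < q \<and> A n i a' b' q \<and>
        a * q * 2 ^ n + D * q + b' * D * 2 ^ n \<le> a' * D * 2 ^ n + b * q * 2 ^ n)" (is "_ \<longleftrightarrow> _ \<and> _ \<and> ?R")
    for i a b D
  proof -
    have "?R \<longleftrightarrow> (real a - real b) / real D < r i" if i: "1 \<le> i" "0 < D"
    proof
      assume ?R
      then obtain n a' b' q where "1 \<le> n" "0 < q" "A n i a' b' q"
        "a * q * 2 ^ n + D * q + b' * D * 2 ^ n \<le> a' * D * 2 ^ n + b * q * 2 ^ n" by blast
      then show "(real a - real b) / real D < r i"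
        using sound[of n i a' b' q] fraction_le_iff[of D q a n b' a' b] i by linarith
    next
      assume "(real a - real b) / real D < r i"
      \<comment> \<open>Half of the gap: one 2^-n for the error of the approximation and one for the
        demanded margin.\<close>
      then obtain n where n: "1 \<le> n" "(1/2) ^ n < (r i - (real a - real b) / real D) / 2"
        using half_power_less[of "(r i - (real a - real b) / real D) / 2"] by auto
      obtain a' b' q where q: "q > 0" "A n i a' b' q" using A[OF n(1) i(1)] by blast
      have "(real a - real b) / real D + (1/2) ^ n \<le> (real a' - real b') / real q"
        using sound[OF n(1) i(1) q(2)] n(2) by (simp add: abs_less_iff)
      then have "a * q * 2 ^ n + D * q + b' * D * 2 ^ n \<le> a' * D * 2 ^ n + b * q * 2 ^ n"
        using fraction_le_iff[OF i(2) q(1)] by blast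
      with n(1) q show ?R by blast
    qed
    then show ?thesis by blast
  qed
  moreover have re': "re orc (\<lambda>x. A (n x) (i x) (a x) (b x) (q x))"
    if "pr orc n" "pr orc i" "pr orc a" "pr orc b" "pr orc q" for n i a b q
    using re_comp[OF re, of "\<lambda>x. (n x, i x, a x, b x, q x)"] that by (simp add: pr_intro)
  have "re orc (\<lambda>(i, a, b, D). 1 \<le> i \<and> 0 < D \<and> (\<exists>n a' b' q. 1 \<le> n \<and> 0 < q \<and> A n i a' b' q \<and>
        a * q * 2 ^ n + D * q + b' * D * 2 ^ n \<le> a' * D * 2 ^ n + b * q * 2 ^ n))"
    unfolding case_prod_unfold
    by (intro re_conj re_ex re' pr_intro; intro re_dec pr_intro)
  ultimately show ?thesis by simp
qed

lemma
  assumes "uniformly_computable orc r"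
  shows uniformly_computable_above:
      "re orc (\<lambda>(i, a, b, D). 1 \<le> i \<and> 0 < D \<and> (real a - real b) / real D < r i)"
    and uniformly_computable_below:
      "re orc (\<lambda>(i, a, b, D). 1 \<le> i \<and> 0 < D \<and> (real a - real b) / real D < - r i)"
proof -
  obtain M where M: "wf_otm M"
    "\<And>n i. 1 \<le> n \<Longrightarrow> 1 \<le> i \<Longrightarrow> \<exists>a b q. q > 0 \<and> otm_outputs M orc [n, i] [a, b, q] \<and>
        \<bar>(real a - real b) / real q - r i\<bar> < (1/2) ^ n"
    using assms unfolding uniformly_computable_def by blast
  have out: "\<bar>(real a - real b) / real q - r i\<bar> < (1/2) ^ n"
    if "1 \<le> n" "1 \<le> i" "otm_outputs M orc [n, i] [a, b, q]" for n i a b q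
    using M(2)[OF that(1,2)] otm_outputs_unique[OF that(3)] by blast
  show "re orc (\<lambda>(i, a, b, D). 1 \<le> i \<and> 0 < D \<and> (real a - real b) / real D < r i)"
  proof (rule re_approximable_above[where A = "\<lambda>n i a b q. otm_outputs M orc [n, i] [a, b, q]"])
    show "re orc (\<lambda>(n, i, a, b, q). otm_outputs M orc [n, i] [a, b, q])"
      unfolding case_prod_unfold by (intro re_outputs M(1) pr_intro)
    show "\<exists>a b q. q > 0 \<and> otm_outputs M orc [n, i] [a, b, q]" if "1 \<le> n" "1 \<le> i" for n i
      using M(2)[OF that] by blast
  qed (rule out)
  show "re orc (\<lambda>(i, a, b, D). 1 \<le> i \<and> 0 < D \<and> (real a - real b) / real D < - r i)"
  \<comment> \<open>Exchanging a and b negates the output, so upper bounds for r become lower bounds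
    for - r.\<close>
  proof (rule re_approximable_above[where A = "\<lambda>n i a b q. otm_outputs M orc [n, i] [b, a, q]"])
    show "re orc (\<lambda>(n, i, a, b, q). otm_outputs M orc [n, i] [b, a, q])"
      unfolding case_prod_unfold by (intro re_outputs M(1) pr_intro)
    show "\<bar>(real a - real b) / real q - - r i\<bar> < (1/2) ^ n"
      if "1 \<le> n" "1 \<le> i" "otm_outputs M orc [n, i] [b, a, q]" for n i a b q
      using out[OF that] by (simp add: diff_divide_distrib)
    show "\<exists>a b q. q > 0 \<and> otm_outputs M orc [n, i] [b, a, q]" if "1 \<le> n" "1 \<le> i" for n i
      using M(2)[OF that] by blast
  qed
qed

section \<open>Enumerable bounds for p, for c and for the masses of words\<close>

locale computable_bernoulli = bernoulli_coded_shift +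
  fixes g :: "nat \<Rightarrow> nat list"
  assumes enum: "oracle_of G g" and c_comp: "G_computable g p c"
    and p_comp: "uniformly_computable (oracle_access g) (\<lambda>i. p (g i))"
begin

abbreviation "orc \<equiv> oracle_access g"

definition p_above :: "nat \<Rightarrow> nat \<Rightarrow> nat \<Rightarrow> bool" where
  "p_above i a D \<longleftrightarrow> 1 \<le> i \<and> 0 < D \<and> real a / real D < p (g i)"

definition p_below :: "nat \<Rightarrow> nat \<Rightarrow> nat \<Rightarrow> bool" where
  "p_below i a D \<longleftrightarrow> 1 \<le> i \<and> 0 < D \<and> p (g i) < real a / real D"

definition c_below :: "nat \<Rightarrow> nat \<Rightarrow> bool" where
  "c_below a D \<longleftrightarrow> 0 < D \<and> c < real a / real D"

definition word_above :: "nat \<Rightarrow> nat list \<Rightarrow> nat \<Rightarrow> nat \<Rightarrow> bool" where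
  "word_above N w a D \<longleftrightarrow> 0 < D \<and> length w = 2 * N + 1 \<and> real a / real D < prob (word_cyl N w)"

lemma re_p_above: "pr orc i \<Longrightarrow> pr orc a \<Longrightarrow> pr orc D \<Longrightarrow> re orc (\<lambda>x. p_above (i x) (a x) (D x))"
  using re_comp[OF uniformly_computable_above[OF p_comp], of "\<lambda>x. (i x, a x, 0, D x)"]
  by (simp add: p_above_def pr_intro)

lemma re_p_below: "pr orc i \<Longrightarrow> pr orc a \<Longrightarrow> pr orc D \<Longrightarrow> re orc (\<lambda>x. p_below (i x) (a x) (D x))"
  using re_comp[OF uniformly_computable_below[OF p_comp], of "\<lambda>x. (i x, 0, a x, D x)"]
  by (simp add: p_below_def pr_intro)

lemma orc_eq: "1 \<le> i \<Longrightarrow> orc i = g i"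
  by (simp add: oracle_access_def)

lemma g_in_G: "1 \<le> i \<Longrightarrow> g i \<in> G"
  using enum by (auto simp: oracle_of_def bij_betw_def)

lemma ex_index: "h \<in> G \<Longrightarrow> \<exists>i\<ge>1. g i = h"
  using enum by (auto simp: oracle_of_def bij_betw_def image_iff)

lemma partial_sum_le_c: "(\<Sum>j<l. real (length (g (Suc j))) * p (g (Suc j))) \<le> c"
proof -
  have inj: "inj_on (\<lambda>j. g (Suc j)) {..<l}"
    using enum by (auto simp: oracle_of_def bij_betw_def inj_on_def)
  have "(\<Sum>j<l. real (length (g (Suc j))) * p (g (Suc j))) =
      (\<Sum>h\<in>(\<lambda>j. g (Suc j)) ` {..<l}. real (length h) * p h)"
    by (simp add: sum.reindex[OF inj])
  also have "\<dots> \<le> c"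
  proof (rule finite_sum_le_has_sum[OF has_sum_c])
    fix h assume "h \<in> G - (\<lambda>j. g (Suc j)) ` {..<l}"
    then show "0 \<le> real (length h) * p h" using p_pos[of h] by simp
  qed (use g_in_G in auto)
  finally show ?thesis .
qed

text \<open>Entry j of \<open>us\<close> belongs to generator j + 1: lists start at 0, the oracle at
  1.\<close>

definition weighted_sum :: "nat \<Rightarrow> nat list \<Rightarrow> nat" where
  "weighted_sum l us = sum_list (map (\<lambda>j. length (orc (Suc j)) * nth0 us j) [0..<l])"

lemma weighted_sum: "real (weighted_sum l us) = (\<Sum>j<l. real (length (g (Suc j))) * real (nth0 us j))"
  by (simp add: weighted_sum_def interv_sum_list_conv_sum_set_nat atLeast0LessThan orc_eq)

lemma pr_weighted_sum:
  assumes "pr orc l" and us: "pr orc us"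
  shows "pr orc (\<lambda>x. weighted_sum (l x) (us x))"
  unfolding weighted_sum_def by (intro pr_intro pr_comp[OF us] assms(1))

text \<open>The machine for c yields the cut-off l for accuracy r. The entries of \<open>us\<close>
  are numerators of upper bounds for the first l values of p, and the final inequality says that
  their weighted sum plus 2^-r for the tail is at most C / D.\<close>

lemma re_c_below: "re orc (\<lambda>x. c_below (fst x) (snd x))"
proof -
  obtain M where M: "wf_otm M"
    "\<And>n. 1 \<le> n \<Longrightarrow> \<exists>l\<ge>1. otm_outputs M orc [n] [l] \<and>
        \<bar>c - (\<Sum>i=1..l. real (length (g i)) * p (g i))\<bar> < (1/2) ^ n"
    using c_comp unfolding G_computable_def by blast
  let ?S = "\<lambda>l. \<Sum>j<l. real (length (g (Suc j))) * p (g (Suc j))"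
  have shift: "(\<Sum>i=1..l. real (length (g i)) * p (g i)) = ?S l" for l
    by (rule sum.reindex_bij_witness[of _ Suc "\<lambda>i. i - 1"]) auto
  have out: "\<bar>c - ?S l\<bar> < (1/2) ^ n" if "1 \<le> n" "otm_outputs M orc [n] [l]" for n l
    using M(2)[OF that(1)] otm_outputs_unique[OF that(2)] unfolding shift by blast
  have "c_below C D \<longleftrightarrow> 0 < D \<and> (\<exists>r l us D'. 1 \<le> r \<and> 0 < D' \<and> otm_outputs M orc [r] [l] \<and> length us = l \<and>
      (\<forall>j<l. p_below (Suc j) (nth0 us j) D') \<and>
      weighted_sum l us * D * 2 ^ r + D' * D \<le> C * D' * 2 ^ r)" (is "_ \<longleftrightarrow> _ \<and> ?R") for C D
  proof -
    have "c < real C / real D \<longleftrightarrow> ?R" if D: "0 < D"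
    proof
      assume ?R
      then obtain r l us D' where *: "1 \<le> r" "0 < D'" "otm_outputs M orc [r] [l]" "length us = l"
        "\<And>j. j < l \<Longrightarrow> p_below (Suc j) (nth0 us j) D'"
        "weighted_sum l us * D * 2 ^ r + D' * D \<le> C * D' * 2 ^ r" by blast
      have "?S l \<le> (\<Sum>j<l. real (length (g (Suc j))) * (real (nth0 us j) / real D'))"
        using *(5) by (intro sum_mono mult_left_mono) (auto simp: p_below_def less_imp_le)
      also have "\<dots> = real (weighted_sum l us) / real D'"
        by (simp add: weighted_sum sum_divide_distrib)
      finally show "c < real C / real D"
        using out[OF *(1,3)] *(6) fraction_le_iff[OF *(2) D, of _ r 0 C 0] by fastforce
    next
      assume "c < real C / real D"
      then obtain r where r: "1 \<le> r" "(1/2) ^ r < real C / real D - c"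
        using half_power_less[of "real C / real D - c"] by auto
      obtain l where l: "otm_outputs M orc [r] [l]" using M(2)[OF r(1)] by blast
      let ?U = "\<lambda>D'. \<Sum>j<l. real (length (g (Suc j))) * (real (upper_num D' (p (g (Suc j)))) / real D')"
      let ?us = "\<lambda>D'. map (\<lambda>j. upper_num D' (p (g (Suc j)))) [0..<l]"
      have "?U \<longlonglongrightarrow> ?S l"
        by (intro tendsto_sum tendsto_mult tendsto_const tendsto_upper_num p_pos g_in_G) simp
      \<comment> \<open>Partial sums lie below c, so a gap of more than a single 2^-r between c and
        C / D is enough.\<close>
      moreover have "?S l < real C / real D - (1/2) ^ r"
        using partial_sum_le_c[of l] r(2) by simp
      ultimately have "eventually (\<lambda>D'. ?U D' < real C / real D - (1/2) ^ r) sequentially"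
        by (rule order_tendstoD)
      from eventually_conj[OF this eventually_gt_at_top[of 0]]
      obtain D' where D': "?U D' < real C / real D - (1/2) ^ r" "0 < D'"
        using eventually_happens'[OF sequentially_bot] by blast
      have "real (weighted_sum l (?us D')) / real D' = ?U D'"
        by (simp add: weighted_sum sum_divide_distrib nth0_nth)
      then have "weighted_sum l (?us D') * D * 2 ^ r + D' * D \<le> C * D' * 2 ^ r"
        using D'(1) fraction_le_iff[OF D'(2) D, of _ r 0 C 0] by simp
      moreover have "p_below (Suc j) (nth0 (?us D') j) D'" if "j < l" for j
        using that D'(2) upper_num_greater[OF D'(2)] by (simp add: p_below_def nth0_nth)
      ultimately show ?R
        using r(1) l D'(2)
        by (intro exI[of _ r] exI[of _ l] exI[of _ "?us D'"] exI[of _ D']) simp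
    qed
    then show ?thesis unfolding c_below_def by blast
  qed
  moreover have "re orc (\<lambda>x. 0 < snd x \<and> (\<exists>r l us D'. 1 \<le> r \<and> 0 < D' \<and> otm_outputs M orc [r] [l] \<and> length us = l \<and>
      (\<forall>j<l. p_below (Suc j) (nth0 us j) D') \<and>
      weighted_sum l us * snd x * 2 ^ r + D' * snd x \<le> fst x * D' * 2 ^ r))"
    by (intro re_conj re_ex re_all_less re_outputs[OF M(1)] re_p_below pr_intro;
        intro re_dec pr_intro pr_weighted_sum)
  ultimately show ?thesis by simp
qed

lemma re_c_below_comp: "pr orc a \<Longrightarrow> pr orc D \<Longrightarrow> re orc (\<lambda>x. c_below (a x) (D x))"
  using re_comp[OF re_c_below, of "\<lambda>x. (a x, D x)"] by (simp add: pr_intro)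

text \<open>A certificate entry consists of pairs (i, u) and an offset: i names the generator
  \<open>g i\<close>, and u is the numerator of a lower bound for its p. Naming generators by
  indices guarantees membership in G.\<close>

definition key :: "(nat \<times> nat) list \<times> nat \<Rightarrow> nat list list \<times> nat" where
  "key e = (map (\<lambda>iu. orc (fst iu)) (fst e), snd e)"

definition weight :: "(nat \<times> nat) list \<times> nat \<Rightarrow> nat" where
  "weight e = prod_list (map snd (fst e))"

lemma prod_list_divide: "(\<Prod>u\<leftarrow>us. real u / D) = real (prod_list us) / D ^ length us"
  by (induction us) (auto simp: field_simps)

lemma prod_list_mono_real:
  fixes f h :: "'z \<Rightarrow> real"
  shows "(\<And>x. x \<in> set xs \<Longrightarrow> 0 \<le> f x \<and> f x \<le> h x) \<Longrightarrow> 0 \<le> (\<Prod>x\<leftarrow>xs. f x) \<and> (\<Prod>x\<leftarrow>xs. f x) \<le> (\<Prod>x\<leftarrow>xs. h x)"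
proof (induction xs)
  case (Cons x xs)
  then have IH: "0 \<le> (\<Prod>x\<leftarrow>xs. f x)" "(\<Prod>x\<leftarrow>xs. f x) \<le> (\<Prod>x\<leftarrow>xs. h x)"
    and x: "0 \<le> f x" "f x \<le> h x" by simp_all
  show ?case
    using mult_nonneg_nonneg[OF x(1) IH(1)] mult_mono[OF x(2) IH(2) order_trans[OF x] IH(1)] by simp
qed simp

lemma tendsto_prod_list:
  fixes f :: "'z \<Rightarrow> nat \<Rightarrow> real"
  shows "(\<And>x. x \<in> set xs \<Longrightarrow> f x \<longlonglongrightarrow> h x) \<Longrightarrow> (\<lambda>D. \<Prod>x\<leftarrow>xs. f x D) \<longlonglongrightarrow> (\<Prod>x\<leftarrow>xs. h x)"
  by (induction xs) (auto intro!: tendsto_mult)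

lemma pattern_frac_iff:
  assumes "0 < D" "0 < D'" "0 < C"
  shows "a * C * D' ^ m < D * D' * S \<longleftrightarrow> real a / real D < (real S / real D' ^ m) * (real D' / real C)"
proof -
  have "a * C * D' ^ m < D * D' * S \<longleftrightarrow> real (a * C * D' ^ m) < real (D * D' * S)"
    by (rule of_nat_less_iff[symmetric])
  also have "\<dots> \<longleftrightarrow> real a / real D < (real S / real D' ^ m) * (real D' / real C)"
    using assms by (simp add: field_simps)
  finally show ?thesis .
qed

text \<open>The certificate consists of patterns for w with lower bounds for p and an upper bound C
  / D' for c. Keys rather than entries must be distinct, since one pattern with two different
  numerators would be counted twice. The last inequality compares a / D with S / D'^(2N + 1) times
  D' / C, where S is the sum of the weights.\<close>

lemma word_above_iff:
  "word_above N w a D \<longleftrightarrow> 0 < D \<and> length w = 2 * N + 1 \<and>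
    (\<exists>D' C E. 0 < D' \<and> c_below C D' \<and> distinct (map key E) \<and>
      (\<forall>e\<in>set E. (\<forall>iu\<in>set (fst e). p_above (fst iu) (snd iu) D') \<and> fits w (fst (key e)) (snd (key e))) \<and>
      a * C * D' ^ (2 * N + 1) < D * D' * sum_list (map weight E))" (is "_ \<longleftrightarrow> _ \<and> _ \<and> ?R")
proof -
  have "real a / real D < prob (word_cyl N w) \<longleftrightarrow> ?R" if D: "0 < D" and w: "length w = 2 * N + 1"
  proof
    assume ?R
    then obtain D' C E where *: "0 < D'" "c_below C D'" "distinct (map key E)"
      "\<And>e iu. e \<in> set E \<Longrightarrow> iu \<in> set (fst e) \<Longrightarrow> p_above (fst iu) (snd iu) D'"
      "\<And>e. e \<in> set E \<Longrightarrow> fits w (fst (key e)) (snd (key e))"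
      "a * C * D' ^ (2 * N + 1) < D * D' * sum_list (map weight E)" by blast
    have cC: "0 < real D' / real C" "real D' / real C \<le> 1 / c" "0 < C"
    proof -
      have "c * real D' < real C" using *(1,2) by (simp add: c_below_def field_simps)
      moreover from this have "0 < real C" using c_pos *(1) by (smt (verit) mult_pos_pos of_nat_0_less_iff)
      ultimately show "0 < real D' / real C" "real D' / real C \<le> 1 / c" "0 < C"
        using *(1) c_pos by (simp_all add: field_simps)
    qed
    have "real (weight e) / real D' ^ (2 * N + 1) \<le> (\<Prod>h\<leftarrow>fst (key e). p h)" if e: "e \<in> set E" for e
    proof -
      have "length (fst e) = 2 * N + 1"
        using fits_length[OF *(5)[OF e]] w by (simp add: key_def)
      then have "real (weight e) / real D' ^ (2 * N + 1) = (\<Prod>iu\<leftarrow>fst e. real (snd iu) / real D')"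
        using prod_list_divide[of "real D'" "map snd (fst e)"] by (simp add: weight_def comp_def)
      also have "\<dots> \<le> (\<Prod>iu\<leftarrow>fst e. p (g (fst iu)))"
        using *(4)[OF e] by (intro prod_list_mono_real[THEN conjunct2]) (auto simp: p_above_def less_imp_le)
      also have "map (\<lambda>iu. p (g (fst iu))) (fst e) = map p (fst (key e))"
        using *(4)[OF e] by (auto simp: key_def p_above_def orc_eq)
      finally show ?thesis by simp
    qed
    then have "(\<Sum>e\<leftarrow>E. real (weight e) / real D' ^ (2 * N + 1)) \<le> (\<Sum>e\<leftarrow>E. \<Prod>h\<leftarrow>fst (key e). p h)"
      by (rule sum_list_mono)
    also have "\<dots> = (\<Sum>t\<leftarrow>map key E. \<Prod>h\<leftarrow>fst t. p h)" by (simp add: comp_def)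
    also have "\<dots> = (\<Sum>t\<in>set (map key E). \<Prod>h\<leftarrow>fst t. p h)"
      by (rule sum_list_distinct_conv_sum_set[OF *(3)])
    finally have le: "(\<Sum>e\<leftarrow>E. real (weight e) / real D' ^ (2 * N + 1)) \<le>
      (\<Sum>t\<in>set (map key E). \<Prod>h\<leftarrow>fst t. p h)" .
    have eq: "real (sum_list (map weight E)) / real D' ^ (2 * N + 1) =
        (\<Sum>e\<leftarrow>E. real (weight e) / real D' ^ (2 * N + 1))"
      by (induction E) (auto simp: add_divide_distrib)
    have sub: "set (map key E) \<subseteq> patterns w"
    proof
      fix t assume "t \<in> set (map key E)"
      then obtain e where e: "e \<in> set E" "t = key e" by auto
      have "set (fst (key e)) \<subseteq> G"
        using *(4)[OF e(1)] g_in_G orc_eq by (auto simp: key_def p_above_def)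
      then show "t \<in> patterns w" using *(5)[OF e(1)] e(2) by (auto simp: patterns_def)
    qed
    have nn: "0 \<le> (\<Sum>t\<in>set (map key E). \<Prod>h\<leftarrow>fst t. p h)"
      using sub prod_list_p_pos by (intro sum_nonneg) (force simp: patterns_def less_imp_le)
    have "real a / real D < (real (sum_list (map weight E)) / real D' ^ (2 * N + 1)) * (real D' / real C)"
      using *(6) pattern_frac_iff[OF D *(1) cC(3)] by blast
    also have "\<dots> \<le> (\<Sum>t\<in>set (map key E). \<Prod>h\<leftarrow>fst t. p h) * (1 / c)"
      unfolding eq using le cC nn by (intro mult_mono) auto
    also have "\<dots> = (\<Sum>t\<in>set (map key E). mass t)"
      by (simp add: sum_distrib_left mult.commute)
    also have "\<dots> \<le> prob (word_cyl N w)"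
      by (rule sum_patterns_le[OF w _ sub]) simp
    finally show "real a / real D < prob (word_cyl N w)" .
  next
    assume "real a / real D < prob (word_cyl N w)"
    from patterns_approx[OF w this] obtain T where T: "finite T" "T \<subseteq> patterns w"
      "real a / real D < sum mass T" by blast
    obtain ts where ts: "set ts = T" "distinct ts" using finite_distinct_list[OF T(1)] by blast
    obtain ix where ix: "\<And>h. h \<in> G \<Longrightarrow> 1 \<le> ix h \<and> g (ix h) = h" using ex_index by metis
    define cert where "cert D' t = (map (\<lambda>h. (ix h, lower_num D' (p h))) (fst t), snd t)"
      for D' and t :: "nat list list \<times> nat"
    have TG: "set (fst t) \<subseteq> G" "fits w (fst t) (snd t)" if "t \<in> T" for t
    proof -
      have "t \<in> patterns w" using T(2) that by blast
      then show "set (fst t) \<subseteq> G" "fits w (fst t) (snd t)" by (auto simp: patterns_def)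
    qed
    have key: "key (cert D' t) = t" if "t \<in> T" for D' t
    proof -
      have "map (\<lambda>h. orc (ix h)) (fst t) = fst t"
        using TG(1)[OF that] ix orc_eq by (intro map_idI) auto
      then show ?thesis by (simp add: key_def cert_def comp_def)
    qed
    let ?L = "\<lambda>D'. \<Sum>t\<in>T. \<Prod>h\<leftarrow>fst t. real (lower_num D' (p h)) / real D'"
    \<comment> \<open>As D' grows, all bounds over the denominator D' converge simultaneously, so
      one D' serves c and the finitely many generators involved.\<close>
    have "(\<lambda>D'. ?L D' *
        inverse (real (upper_num D' c) / real D')) \<longlonglongrightarrow> (\<Sum>t\<in>T. \<Prod>h\<leftarrow>fst t. p h) * inverse c"
      using TG(1) p_pos c_pos
      by (intro tendsto_mult tendsto_sum tendsto_prod_list tendsto_inverse tendsto_lower_num tendsto_upper_num) auto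
    moreover have "real a / real D < (\<Sum>t\<in>T. \<Prod>h\<leftarrow>fst t. p h) * inverse c"
      using T(3) by (simp add: sum_distrib_left[symmetric] divide_inverse mult.commute)
    ultimately have "eventually (\<lambda>D'. real a / real D < ?L D' *
        inverse (real (upper_num D' c) / real D')) sequentially"
      by (rule order_tendstoD)
    from eventually_conj[OF this eventually_gt_at_top[of 0]]
    obtain D' where D': "real a / real D < ?L D' *
        inverse (real (upper_num D' c) / real D')" "0 < D'"
      using eventually_happens'[OF sequentially_bot] by blast
    let ?E = "map (cert D') ts"
    have sum_E: "sum_list (map weight ?E) = (\<Sum>t\<in>T. weight (cert D' t))"
      using sum_list_distinct_conv_sum_set[OF ts(2), of "\<lambda>t. weight (cert D' t)"] ts(1)
      by (simp add: comp_def)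
    have "?L D' =
        (\<Sum>t\<in>T. real (weight (cert D' t)) / real D' ^ (2 * N + 1))"
    proof (rule sum.cong[OF refl])
      fix t assume "t \<in> T"
      then have "length (fst t) = 2 * N + 1" using fits_length[OF TG(2)] w by simp
      then show "(\<Prod>h\<leftarrow>fst t. real (lower_num D' (p h)) / real D') = real (weight (cert D' t)) / real D' ^ (2 * N + 1)"
        using prod_list_divide[of "real D'" "map (\<lambda>h. lower_num D' (p h)) (fst t)"]
        by (simp add: weight_def cert_def comp_def)
    qed
    also have "\<dots> = real (sum_list (map weight ?E)) / real D' ^ (2 * N + 1)"
      unfolding sum_E by (simp add: sum_divide_distrib)
    finally have "real a / real D < (real (sum_list (map weight ?E)) / real D' ^ (2 * N + 1)) *
        (real D' / real (upper_num D' c))"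
      using D'(1) by (simp add: field_simps)
    moreover have up: "0 < upper_num D' c" by (simp add: upper_num_def)
    ultimately have "a * upper_num D' c * D' ^ (2 * N + 1) < D * D' * sum_list (map weight ?E)"
      using pattern_frac_iff[OF D D'(2) up] by blast
    moreover have "c_below (upper_num D' c) D'"
      using upper_num_greater[OF D'(2)] D'(2) by (simp add: c_below_def)
    moreover have "map key ?E = ts"
      unfolding map_map by (rule map_idI) (use ts(1) key in auto)
    moreover have "p_above (fst iu) (snd iu) D'" if "e \<in> set ?E" "iu \<in> set (fst e)" for e iu
    proof -
      obtain t h where th: "t \<in> T" "h \<in> set (fst t)" "iu = (ix h, lower_num D' (p h))"
        using \<open>e \<in> set ?E\<close> \<open>iu \<in> set (fst e)\<close> ts(1) by (auto simp: cert_def)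
      then have "h \<in> G" using TG(1) by blast
      then show ?thesis
        using th(3) ix[of h] lower_num_less[OF p_pos D'(2), of h] D'(2) by (simp add: p_above_def)
    qed
    moreover have "fits w (fst (key e)) (snd (key e))" if e: "e \<in> set ?E" for e
    proof -
      obtain t where "t \<in> T" "e = cert D' t" using e ts(1) by auto
      then show ?thesis using TG(2) by (simp add: key)
    qed
    ultimately show ?R
      using ts(2) D'(2) by (intro exI[of _ D'] exI[of _ "upper_num D' c"] exI[of _ ?E] conjI ballI) simp_all
  qed
  then show ?thesis unfolding word_above_def by blast
qed

lemma pr_key: "pr orc f \<Longrightarrow> pr orc (\<lambda>x. key (f x))"
  unfolding key_def by (intro pr_intro)

lemma pr_weight: "pr orc f \<Longrightarrow> pr orc (\<lambda>x. weight (f x))"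
  unfolding weight_def by (intro pr_intro)

lemma re_fits:
  assumes w: "pr orc w" and hs: "pr orc hs" and m: "pr orc m"
  shows "re orc (\<lambda>x. fits (w x) (hs x) (m x))"
  unfolding fits_def
  by (intro re_ex re_dec pr_intro pr_comp[OF w] pr_comp[OF hs] pr_comp[OF m])

lemma re_word_above:
  assumes "pr orc N" "pr orc w" "pr orc a" "pr orc D"
  shows "re orc (\<lambda>x. word_above (N x) (w x) (a x) (D x))"
proof -
  have "re orc (\<lambda>y. word_above (fst y) (fst (snd y)) (fst (snd (snd y))) (snd (snd (snd y))))"
    unfolding word_above_iff
    by (intro re_conj re_ex re_ball re_c_below_comp re_p_above re_fits pr_intro pr_key;
        intro re_dec pr_intro pr_key pr_weight)
  from re_comp[OF this, of "\<lambda>x. (N x, w x, a x, D x)"] show ?thesis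
    using assms by (simp add: pr_intro)
qed

end

section \<open>Certificates for closeness to an ideal measure\<close>

definition flatten :: "(nat \<times> nat \<times> nat) list \<Rightarrow> nat list" where
  "flatten L = concat (map (\<lambda>(j, a, b). [j, a, b]) L)"

lemma flatten_inject: "flatten L = flatten L' \<Longrightarrow> L = L'"
proof (induction L arbitrary: L')
  case Nil
  then show ?case by (cases L') (auto simp: flatten_def)
next
  case (Cons t L)
  then show ?case by (cases t; cases L') (auto simp: flatten_def)
qed

lemma dvd_prod_list: "x \<in> set xs \<Longrightarrow> (x :: nat) dvd prod_list xs"
  by (induction xs) auto

locale computable_bernoulli_ideal = computable_bernoulli +
  fixes s :: "nat \<Rightarrow> int \<Rightarrow> nat" and \<nu> :: "nat \<Rightarrow> (int \<Rightarrow> nat) measure"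
  assumes points: "ideal_points (oracle_access g) (coded_shift G) s"
    and enumer: "effective_enumeration (oracle_access g) (coded_shift G) s \<nu>"
begin

definition ideal_above :: "nat \<Rightarrow> nat \<Rightarrow> nat list \<Rightarrow> nat \<Rightarrow> nat \<Rightarrow> bool" where
  "ideal_above k N w a D \<longleftrightarrow> 1 \<le> k \<and> 0 < D \<and> length w = 2 * N + 1 \<and>
     real a / real D \<le> measure (\<nu> k) (word_cyl N w)"

lemma s_in_X: "s ` {1..} \<subseteq> X"
  using points by (auto simp: ideal_points_def)

lemma s_dense: "X \<subseteq> closure (s ` {1..})"
  using points by (auto simp: ideal_points_def)

text \<open>The coordinates of an ideal point are unique outputs of a machine, so agreement with the
  letters of w is an enumerable statement.\<close>

lemma re_word_at_point:
  "\<exists>P. (\<forall>j w N. 1 \<le> j \<longrightarrow> length w = 2 * N + 1 \<longrightarrow> P j N w = (s j \<in> word_cyl N w)) \<and>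
     re orc (\<lambda>x. P (fst x) (fst (snd x)) (snd (snd x)))"
proof -
  obtain M where M: "wf_otm M" "\<And>i m. 1 \<le> i \<Longrightarrow> otm_outputs M orc [i, nat m, nat (- m)] [s i m]"
    using points unfolding ideal_points_def by blast
  \<comment> \<open>For the coordinate m = i - N, the truncated differences \<open>i - N\<close> and
    \<open>N - i\<close> are its positive and its negative part.\<close>
  let ?P = "\<lambda>j N w. \<forall>i<2 * N + 1. otm_outputs M orc [j, i - N, N - i] [nth0 w i]"
  have "?P j N w = (s j \<in> word_cyl N w)" if j: "1 \<le> j" and w: "length w = 2 * N + 1" for j w N
  proof -
    have "otm_outputs M orc [j, i - N, N - i] [x] \<longleftrightarrow> x = s j (int i - int N)" for i x
    proof -
      have "nat (int i - int N) = i - N" "nat (- (int i - int N)) = N - i" by linarith+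
      then have "otm_outputs M orc [j, i - N, N - i] [s j (int i - int N)]"
        using M(2)[OF j, of "int i - int N"] by simp
      then show ?thesis using otm_outputs_unique by blast
    qed
    then have "?P j N w \<longleftrightarrow> (\<forall>i<2 * N + 1. w ! i = s j (int i - int N))"
      using w by (auto simp: nth0_nth)
    also have "\<dots> \<longleftrightarrow> central_word N (s j) = w"
      using w by (auto simp: central_word_def list_eq_iff_nth_eq simp del: upt_Suc)
    finally show ?thesis using s_in_X j by (auto simp: word_cyl_def)
  qed
  moreover have "re orc (\<lambda>x. ?P (fst x) (fst (snd x)) (snd (snd x)))"
    by (intro re_all_less re_outputs[OF M(1)] pr_intro)
  ultimately show ?thesis by (intro exI[of _ ?P]) blast
qed

text \<open>Each triple of the code receives a numerator u with u / D' at most its weight, and u = 0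
  unless its point is confirmed to read w. Only membership in the word is ever confirmed, never its
  failure.\<close>

lemma re_ideal_above: "re orc (\<lambda>(k, N, w, a, D). ideal_above k N w a D)"
proof -
  obtain P where P: "\<And>j w N. 1 \<le> j \<Longrightarrow> length w = 2 * N + 1 \<Longrightarrow> P j N w = (s j \<in> word_cyl N w)"
    and re_P: "re orc (\<lambda>x. P (fst x) (fst (snd x)) (snd (snd x)))"
    using re_word_at_point by blast
  obtain M where M: "wf_otm M" "\<And>i. 1 \<le> i \<Longrightarrow> \<exists>L. ideal_code L \<and> \<nu> i = ideal_measure X s L \<and>
        otm_outputs M orc [i] (flatten L)"
    using enumer unfolding effective_enumeration_def flatten_def by blast
  let ?R = "\<lambda>k N w a D. \<exists>L D'. 0 < D' \<and> otm_outputs M orc [k] (flatten (map fst L)) \<and>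
    (\<forall>t\<in>set L. snd t * snd (snd (fst t)) \<le> fst (snd (fst t)) * D' \<and> (snd t = 0 \<or> P (fst (fst t)) N w)) \<and>
    a * D' \<le> D * sum_list (map snd L)"
  have iff: "ideal_above k N w a D \<longleftrightarrow> 1 \<le> k \<and> 0 < D \<and> length w = 2 * N + 1 \<and> ?R k N w a D" for k N w a D
  proof -
    have "real a / real D \<le> measure (\<nu> k) (word_cyl N w) \<longleftrightarrow> ?R k N w a D"
      if k: "1 \<le> k" and D: "0 < D" and w: "length w = 2 * N + 1"
    proof -
      obtain L0 where L0: "ideal_code L0" "\<nu> k = ideal_measure X s L0" "otm_outputs M orc [k] (flatten L0)"
        using M(2)[OF k] by blast
      have code: "1 \<le> j \<and> 0 < A \<and> 0 < B" if "(j, A, B) \<in> set L0" for j A B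
        using L0(1) that by (auto simp: ideal_code_def)
      let ?I = "indicator (word_cyl N w) :: _ \<Rightarrow> real"
      have meas: "measure (\<nu> k) (word_cyl N w) = (\<Sum>t\<leftarrow>L0. real (fst (snd t)) / real (snd (snd t)) * ?I (s (fst t)))"
        unfolding L0(2) measure_ideal_measure[OF sets_word_cyl] case_prod_unfold ..
      show ?thesis
      proof
        assume "?R k N w a D"
        then obtain L D' where L: "0 < D'" "otm_outputs M orc [k] (flatten (map fst L))"
          "\<And>t. t \<in> set L \<Longrightarrow> snd t * snd (snd (fst t)) \<le> fst (snd (fst t)) * D' \<and> (snd t = 0 \<or> P (fst (fst t)) N w)"
          "a * D' \<le> D * sum_list (map snd L)" by blast
        have L0_eq: "L0 = map fst L"
          using flatten_inject[OF otm_outputs_unique[OF L0(3) L(2)]] .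
        have "real (snd t) / real D' \<le> real (fst (snd (fst t))) / real (snd (snd (fst t))) * ?I (s (fst (fst t)))"
          if t: "t \<in> set L" for t
        proof (cases "snd t = 0")
          case False
          obtain j A B u where tt: "t = ((j, A, B), u)" by (metis prod.collapse)
          have "(j, A, B) \<in> set L0" using t unfolding L0_eq tt by force
          note c = code[OF this]
          have "s j \<in> word_cyl N w" using L(3)[OF t] False P[of j w N] c w by (simp add: tt)
          moreover have "real (u * B) \<le> real (A * D')" using L(3)[OF t] unfolding tt by (simp only: of_nat_le_iff fst_conv snd_conv)
          ultimately show ?thesis using c L(1) by (simp add: tt field_simps)
        qed simp
        then have "(\<Sum>t\<leftarrow>L. real (snd t) / real D') \<le>
            (\<Sum>t\<leftarrow>L. real (fst (snd (fst t))) / real (snd (snd (fst t))) * ?I (s (fst (fst t))))"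
          by (rule sum_list_mono)
        also have "\<dots> = measure (\<nu> k) (word_cyl N w)"
          unfolding meas L0_eq by (simp add: comp_def)
        also have "(\<Sum>t\<leftarrow>L. real (snd t) / real D') = real (sum_list (map snd L)) / real D'"
          by (induction L) (auto simp: add_divide_distrib)
        finally have "real (sum_list (map snd L)) / real D' \<le> measure (\<nu> k) (word_cyl N w)" .
        moreover have "real (a * D') \<le> real (D * sum_list (map snd L))" using L(4) by (simp only: of_nat_le_iff)
        then have "real a / real D \<le> real (sum_list (map snd L)) / real D'"
          using D L(1) by (simp add: field_simps)
        ultimately show "real a / real D \<le> measure (\<nu> k) (word_cyl N w)" by linarith
      next
        assume le: "real a / real D \<le> measure (\<nu> k) (word_cyl N w)"
        \<comment> \<open>With the product of all denominators every weight is an exact multiple of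
          1 / D'. Exactness matters because the bound may hold with equality.\<close>
        define D' where "D' = prod_list (map (\<lambda>t. snd (snd t)) L0)"
        have D': "0 < D'"
        proof -
          have "\<forall>t\<in>set L0. 0 < snd (snd t)" using code by auto
          then show ?thesis unfolding D'_def by (induction L0) auto
        qed
        define u where "u t = (if s (fst t) \<in> word_cyl N w then fst (snd t) * (D' div snd (snd t)) else 0)"
          for t :: "nat \<times> nat \<times> nat"
        have dvd: "snd (snd t) dvd D'" "0 < snd (snd t)" "1 \<le> fst t" if "t \<in> set L0" for t
          using that code[of "fst t" "fst (snd t)" "snd (snd t)"]
          by (auto simp: D'_def intro!: dvd_prod_list)
        have "real (u t) / real D' = real (fst (snd t)) / real (snd (snd t)) * ?I (s (fst t))" if "t \<in> set L0" for t
          using dvd[OF that] D' by (auto simp: u_def real_of_nat_div)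
        then have "measure (\<nu> k) (word_cyl N w) = (\<Sum>t\<leftarrow>L0. real (u t) / real D')"
          unfolding meas by (intro arg_cong[where f = sum_list] map_cong refl) simp
        also have "\<dots> = real (sum_list (map u L0)) / real D'"
          by (induction L0) (auto simp: add_divide_distrib)
        finally have "real a / real D \<le> real (sum_list (map u L0)) / real D'" using le by simp
        then have "real (a * D') \<le> real (D * sum_list (map u L0))" using D D' by (simp add: field_simps)
        then have "a * D' \<le> D * sum_list (map u L0)" by (simp only: of_nat_le_iff)
        moreover have "u t * snd (snd t) \<le> fst (snd t) * D' \<and> (u t = 0 \<or> P (fst t) N w)" if "t \<in> set L0" for t
          using dvd[OF that] P[of "fst t" w N] w by (auto simp: u_def)
        ultimately show "?R k N w a D"
          using L0(3) D'
          by (intro exI[of _ "map (\<lambda>t. (t, u t)) L0"] exI[of _ D']) (auto simp: comp_def)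
      qed
    qed
    then show ?thesis unfolding ideal_above_def by blast
  qed
  have re_P': "re orc (\<lambda>y. P (f y) (h y) (q y))" if "pr orc f" "pr orc h" "pr orc q" for f h q
    using re_comp[OF re_P, of "\<lambda>y. (f y, h y, q y)"] that by (simp add: pr_intro)
  have "re orc (\<lambda>(k, N, w, a, D). 1 \<le> k \<and> 0 < D \<and> length w = 2 * N + 1 \<and> ?R k N w a D)"
    unfolding flatten_def case_prod_unfold
    by (intro re_conj re_ex re_ball re_disj re_outputs[OF M(1)] re_P' pr_intro; intro re_dec pr_intro)
  then show ?thesis by (simp only: iff)
qed

lemma re_ideal_above_comp:
  assumes "pr orc k" "pr orc N" "pr orc w" "pr orc a" "pr orc D"
  shows "re orc (\<lambda>x. ideal_above (k x) (N x) (w x) (a x) (D x))"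
  using re_comp[OF re_ideal_above, of "\<lambda>x. (k x, N x, w x, a x, D x)"] assms by (simp add: pr_intro)

text \<open>The last inequality is 1 - 2^-(n + 1) \<le> (sum of numerators) / D, cleared of
  denominators. With the window N = n + 3, \<open>W1_le\<close> gives 2^-(n + 1) + 2 * 2^-(n + 3),
  which is three quarters of 2^-n.\<close>

definition certified :: "nat \<Rightarrow> nat \<Rightarrow> bool" where
  "certified n k \<longleftrightarrow> 1 \<le> k \<and> (\<exists>F D. 0 < D \<and> distinct (map fst F) \<and>
     (\<forall>e\<in>set F. word_above (n + 3) (fst e) (snd e) D \<and> ideal_above k (n + 3) (fst e) (snd e) D) \<and>
     2 ^ (n + 1) * D \<le> 2 ^ (n + 1) * sum_list (map snd F) + D)"

lemma re_certified: "re orc (\<lambda>p. certified (fst p) (snd p))"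
  unfolding certified_def
  by (intro re_conj re_ex re_ball re_word_above re_ideal_above_comp pr_intro; intro re_dec pr_intro)

lemma certified_W1:
  assumes "certified n k"
  shows "W1 X \<mu> (\<nu> k) < (1/2) ^ n"
proof -
  obtain F D where k: "1 \<le> k" and D: "0 < D" and dist: "distinct (map fst F)"
    and F: "\<And>e. e \<in> set F \<Longrightarrow> word_above (n + 3) (fst e) (snd e) D \<and> ideal_above k (n + 3) (fst e) (snd e) D"
    and sum: "2 ^ (n + 1) * D \<le> 2 ^ (n + 1) * sum_list (map snd F) + D"
    using assms unfolding certified_def by blast
  obtain L where L: "ideal_code L" "\<nu> k = ideal_measure X s L"
    using enumer k unfolding effective_enumeration_def by blast
  \<comment> \<open>The words in F are distinct, so looking up a word recovers the numerator of its
    entry.\<close>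
  define \<alpha> where "\<alpha> w = real (the (map_of F w)) / real D" for w
  have \<alpha>: "\<alpha> (fst e) = real (snd e) / real D" if "e \<in> set F" for e
    using map_of_is_SomeI[OF dist, of "fst e" "snd e"] that by (simp add: \<alpha>_def)
  have "W1 X \<mu> (\<nu> k) \<le> 1 - (\<Sum>w\<in>set (map fst F). \<alpha> w) + 2 * (1/2) ^ (n + 3)"
  proof (rule W1_le)
    show "prob_space (\<nu> k)" "space (\<nu> k) = X" "sets (\<nu> k) = sets (restrict_space borel X)"
      unfolding L(2) by (rule prob_space_ideal_measure[OF L(1) s_in_X] space_ideal_measure sets_ideal_measure)+
    fix w assume "w \<in> set (map fst F)"
    then obtain e where e: "e \<in> set F" "w = fst e" by auto
    show "0 \<le> \<alpha> w" by (simp add: \<alpha>_def)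
    show "\<alpha> w \<le> prob (word_cyl (n + 3) w)" "\<alpha> w \<le> measure (\<nu> k) (word_cyl (n + 3) w)"
      using F[OF e(1)] \<alpha>[OF e(1)] e(2) by (auto simp: word_above_def ideal_above_def)
  qed simp
  also have "(\<Sum>w\<in>set (map fst F). \<alpha> w) = (\<Sum>w\<leftarrow>map fst F. \<alpha> w)"
    by (rule sum_list_distinct_conv_sum_set[OF dist, symmetric])
  also have "\<dots> = (\<Sum>e\<leftarrow>F. real (snd e) / real D)"
    using \<alpha> by (auto intro!: arg_cong[where f = sum_list])
  also have "\<dots> = real (sum_list (map snd F)) / real D"
    by (induction F) (auto simp: add_divide_distrib)
  finally have W: "W1 X \<mu> (\<nu> k) \<le> 1 - real (sum_list (map snd F)) / real D + 2 * (1/2) ^ (n + 3)" .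
  have "real (2 ^ (n + 1) * D) \<le> real (2 ^ (n + 1) * sum_list (map snd F) + D)"
    using sum by (simp only: of_nat_le_iff)
  then have "1 - real (sum_list (map snd F)) / real D \<le> 1 / 2 ^ (n + 1)"
    using D by (simp add: field_simps)
  moreover have "1 / 2 ^ (n + 1) + 2 * (1/2 :: real) ^ (n + 3) < (1/2) ^ n"
    by (simp add: power_add power_one_over field_simps)
  ultimately show ?thesis using W by linarith
qed

lemma ex_certified: "\<exists>k. certified n k"
proof -
  obtain F a D L where *: "distinct F" "0 < D" "ideal_code L"
      "(1 - 1 / 2 ^ (n + 1)) * real D \<le> real (\<Sum>w\<leftarrow>F. a w)"
      "\<And>w. w \<in> set F \<Longrightarrow> length w = 2 * (n + 3) + 1 \<and> real (a w) / real D < prob (word_cyl (n + 3) w) \<and>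
      real (a w) / real D \<le> measure (ideal_measure X s L) (word_cyl (n + 3) w)"
    using ideal_measure_approx[OF s_in_X s_dense, of "1 / 2 ^ (n + 1)" "n + 3"] by auto
  obtain k where k: "1 \<le> k" "\<nu> k = ideal_measure X s L"
    using enumer *(3) unfolding effective_enumeration_def by (metis (mono_tags, lifting) atLeast_iff imageE mem_Collect_eq)
  let ?F = "map (\<lambda>w. (w, a w)) F"
  have "real (2 ^ (n + 1) * D) \<le> real (2 ^ (n + 1) * (\<Sum>w\<leftarrow>F. a w) + D)"
    using *(4) by (simp add: field_simps)
  then have "2 ^ (n + 1) * D \<le> 2 ^ (n + 1) * (\<Sum>w\<leftarrow>F. a w) + D" by (simp only: of_nat_le_iff)
  then have "certified n k"
    unfolding certified_def using * k
    by (intro conjI exI[of _ ?F] exI[of _ D]) (auto simp: comp_def word_above_def ideal_above_def)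
  then show ?thesis ..
qed

lemma computable: "computable_measure orc X \<nu> \<mu>"
proof -
  obtain M where M: "wf_otm M" "\<And>n. 1 \<le> n \<Longrightarrow> \<exists>k. certified n k \<and> otm_outputs M orc [n] [k]"
    using re_search[OF re_certified] ex_certified by blast
  have "\<exists>k\<ge>1. otm_outputs M orc [n] [k] \<and> W1 X \<mu> (\<nu> k) < (1/2) ^ n" if "1 \<le> n" for n
    using M(2)[OF that] certified_W1 unfolding certified_def by blast
  with M(1) show ?thesis unfolding computable_measure_def by blast
qed

end

theorem theorem1:
  fixes d :: nat and G :: "nat list set" and g :: "nat \<Rightarrow> nat list"
    and p :: "nat list \<Rightarrow> real" and c :: real and \<mu> :: "(int \<Rightarrow> nat) measure"
    and s :: "nat \<Rightarrow> int \<Rightarrow> nat" and \<nu> :: "nat \<Rightarrow> (int \<Rightarrow> nat) measure"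
  assumes "generating_set d G"
    and "uniquely_represents G"
    and "oracle_of G g"
    and "bernoulli_measure G p c \<mu>"
    and "G_computable g p c"
    and "uniformly_computable (oracle_access g) (\<lambda>i. p (g i))"
    and "ideal_points (oracle_access g) (coded_shift G) s"
    and "effective_enumeration (oracle_access g) (coded_shift G) s \<nu>"
  shows "computable_measure (oracle_access g) (coded_shift G) \<nu> \<mu>"
proof -
  interpret computable_bernoulli_ideal d G p c \<mu> g s \<nu>
    by standard fact+
  show ?thesis by (rule computable)
qed

end
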